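(* Let $K \subset \mathbb R^3$ be a regular convex cone with everywhere positively curved boundary of class $C^k$, $k \geq 5$. Let $\gamma$ be the projective image of the boundary $\partial K$, a simple convex closed curve in the real projective plane $\mathbb{RP}^2$. Then there exists a $2\pi$-periodic parametrization of $\gamma$ of class $C^{k-1}$ by a real variable $t$ and a $2\pi$-periodic lift $y: \mathbb R \to \mathbb R^3$ of $\gamma$ of class $C^{k-2}$ such that $y(t)$ is a solution of the ordinary differential equation \[ y'''(t) + 2\alpha(t)y'(t) + \alpha'(t)y(t) + \beta(t)y(t) = 0 \] with $\alpha \equiv \mathrm{const}$ (and some $2\pi$-periodic function $\beta$). Here the value of the constant $\alpha$ is uniquely determined by the cone $K$.
   Context: A regular convex cone is a closed convex cone in $\mathbb R^3$ with non-empty interior and containing no lines. Because the boundary is positively curved, its projective image $\gamma$ is a closed convex curve of class $C^k$ without inflection points. Any regular parametrization of such a curve admits a lift $y(t)$ to $\mathbb R^3$, normalized so that $\det(y'',y',y) \equiv 1$, which solves the linear ODE $y''' + 2\alpha y' + \alpha' y + \beta y = 0$ for coefficient functions $\alpha,\beta$ (of class $C^{k-4}$, $C^{k-5}$ respectively); for a $2\pi$-periodic parametrization these coefficients are $2\pi$-periodic. The theorem asserts one can choose the periodic parametrization so that $\alpha$ is constant. *)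

theory Defs
  imports "HOL-Analysis.Analysis"
begin

primrec Ck_on :: "nat \<Rightarrow> 'a::real_normed_vector set \<Rightarrow> ('a \<Rightarrow> 'b::real_normed_vector) \<Rightarrow> bool" where
  "Ck_on 0 U f = continuous_on U f"
| "Ck_on (Suc n) U f =
     (\<exists>D. (\<forall>x\<in>U. (f has_derivative D x) (at x)) \<and> (\<forall>v. Ck_on n U (\<lambda>x. D x v)))"

definition regular_convex_cone :: "(real^3) set \<Rightarrow> bool" where
  "regular_convex_cone K \<longleftrightarrow> closed K \<and> convex K \<and> cone K \<and> interior K \<noteq> {} \<and>
     \<not> (\<exists>a v. v \<noteq> 0 \<and> (\<forall>s::real. a + s *\<^sub>R v \<in> K))"

text \<open>The boundary of K (away from the apex 0) is a C^k hypersurface which is everywhere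
  positively curved: near each boundary point p \<noteq> 0, K is the sublevel set {g \<le> 0} of a
  C^k function g with nonvanishing gradient, and the second fundamental form at p
  (Hessian of g restricted to the tangent plane) is nonzero, i.e. positive on some
  tangent vector (it is positive semidefinite by convexity and vanishes on the ray).\<close>
definition boundary_Ck_pos_curved :: "nat \<Rightarrow> (real^3) set \<Rightarrow> bool" where
  "boundary_Ck_pos_curved k K \<longleftrightarrow>
     (\<forall>p \<in> frontier K - {0}. \<exists>U g Dg Hp.
        open U \<and> p \<in> U \<and> Ck_on k U (g :: real^3 \<Rightarrow> real) \<and>
        (\<forall>x\<in>U. (g has_derivative Dg x) (at x) \<and> Dg x \<noteq> (\<lambda>_. 0)) \<and>
        K \<inter> U = {x \<in> U. g x \<le> 0} \<and>
        (\<forall>v. ((\<lambda>x. Dg x v) has_derivative (\<lambda>w. Hp v w)) (at p)) \<and>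
        (\<exists>v. Dg p v = 0 \<and> Hp v v > 0))"

definition det3 :: "real^3 \<Rightarrow> real^3 \<Rightarrow> real^3 \<Rightarrow> real" where
  "det3 a b c = det (vector [a, b, c] :: real^3^3)"

text \<open>y is a 2pi-periodic lift of a 2pi-periodic parametrization of the projective image
  of the boundary of K (traversing it exactly once per period), the parametrization being
  of class C^(k-1) (as a map into RP^2, i.e. its unit-sphere lift y/|y| is C^(k-1)),
  the lift being of class C^(k-2), normalized by det(y'',y',y) = 1 and solving
  y''' + 2 alpha y' + alpha' y + beta y = 0 with alpha constant (so alpha' = 0) and
  beta 2pi-periodic.\<close>
definition normal_lift :: "nat \<Rightarrow> (real^3) set \<Rightarrow> (real \<Rightarrow> real^3) \<Rightarrow> real \<Rightarrow> (real \<Rightarrow> real) \<Rightarrow> bool" where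
  "normal_lift k K y \<alpha> \<beta> \<longleftrightarrow>
     (\<forall>t. y (t + 2 * pi) = y t) \<and> (\<forall>t. \<beta> (t + 2 * pi) = \<beta> t) \<and>
     (\<forall>t. y t \<noteq> 0 \<and> (y t \<in> frontier K \<or> - y t \<in> frontier K)) \<and>
     (\<forall>x \<in> frontier K - {0}. \<exists>t \<in> {0..<2 * pi}. \<exists>c. x = c *\<^sub>R y t) \<and>
     (\<forall>s \<in> {0..<2 * pi}. \<forall>t \<in> {0..<2 * pi}. (\<exists>c. y s = c *\<^sub>R y t) \<longrightarrow> s = t) \<and>
     Ck_on (k - 1) UNIV (\<lambda>t. (1 / norm (y t)) *\<^sub>R y t) \<and>
     Ck_on (k - 2) UNIV y \<and>
     (\<exists>y1 y2 y3. \<forall>t.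
        (y has_vector_derivative y1 t) (at t) \<and>
        (y1 has_vector_derivative y2 t) (at t) \<and>
        (y2 has_vector_derivative y3 t) (at t) \<and>
        det3 (y2 t) (y1 t) (y t) = 1 \<and>
        y3 t + (2 * \<alpha>) *\<^sub>R y1 t + \<beta> t *\<^sub>R y t = 0)"

end

theory Submission
  imports Defs
begin

text \<open>
  Parametrize the boundary curve by the polar angle in an affine chart and lift it to \<open>y\<close> with
  \<open>det (y'', y', y) = 1\<close>, so that \<open>y''' + 2 \<alpha> y' + b y = 0\<close>. Under \<open>ds = dt / h\<close>, \<open>z = y / h\<close> the
  coefficient \<open>\<alpha>\<close> becomes \<open>h h'' - h'\<^sup>2 / 2 + \<alpha> h\<^sup>2\<close>. This is constant whenever \<open>h\<close> is a quadratic form in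
  solutions of Hill's equation \<open>f'' + (\<alpha> / 2) f = 0\<close>, and the form \<open>N t = f\<^sub>t (t + 2 \<pi>)\<close>, where \<open>f\<^sub>t\<close> is the solution
  with \<open>f\<^sub>t t = 0\<close> and \<open>f\<^sub>t' t = 1\<close>, is periodic. It remains to see that \<open>N > 0\<close>.

  For fixed \<open>a\<close> let \<open>u\<close> and \<open>v\<close> be the pairings of \<open>y t\<close> with the tangent line at \<open>a\<close> and of \<open>y a\<close> with the tangent
  line at \<open>t\<close>. By convexity both are positive on \<open>a < t < a + 2 \<pi>\<close>, and \<open>V = (u v) powr (1/4)\<close> satisfies
  \<open>V'' + (\<alpha> / 2) V = - (3/16) (u'/u - v'/v)\<^sup>2 V\<close>. Hence \<open>V\<close> is a supersolution and Sturm comparison gives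
  \<open>N \<ge> 0\<close>. If \<open>N a = 0\<close> then \<open>v\<close> is a multiple of \<open>u\<close>, the curve is a conic (\<open>b = \<alpha>'\<close>), and any
  linear functional that is positive on \<open>y\<close> can serve as \<open>h\<close> instead.

  Two lifts with constants \<open>A\<close> and \<open>B\<close> differ by a degree-one change of parameter with density \<open>1 / \<mu>\<close> where
  \<open>\<mu> \<mu>'' - \<mu>'\<^sup>2 / 2 + A \<mu>\<^sup>2 = B\<close>. For \<open>A \<le> 0\<close> the extrema of \<open>\<mu>\<close> force \<open>A = B\<close>; for \<open>A > 0\<close> the zeros of the
  solutions of the two Hill equations correspond, and counting them gives equal frequencies.
\<close>

section \<open>Functions of class C^k on the line\<close>

text \<open>The coefficient \<open>b\<close> splits as \<alpha>' + \<beta>, and \<beta> has no sign,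
  so the pairing \<open>u\<close> alone, which solves the third-order equation of the curve, admits
  no comparison. The dual curve \<open>y' \<times> y\<close> solves the adjoint equation, where
  \<alpha> is kept and \<beta> becomes -\<beta>; this is why \<open>u\<close> is multiplied by
  \<open>v\<close>. The exponent 1/4 comes from the conic: there both pairings are multiples of f^2
  for the Hill solution f vanishing at \<open>a\<close>, so \<open>(u v) powr (1/4)\<close> is a
  multiple of f itself. It stays positive over a whole period because a closed strictly convex curve
  meets each tangent plane only along the line of contact. At the ends of the period
  \<open>V\<close> vanishes. Comparison strictly inside is rescued by moving the base point, but at
  the far end only the weak inequality survives; hence the separate conic case. The other constraint
  is the loss of derivatives: the normalizer must be of class C^(k-2), so \<alpha> must be C^(k-4),
  one better than y''' suggests. The dual curve supplies this derivative.\<close>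

lemmas real_vd_iff = has_real_derivative_iff_has_vector_derivative

lemma Ck_on_cong:
  assumes "open S" "\<And>x. x \<in> S \<Longrightarrow> f x = g x"
  shows "Ck_on n S f \<longleftrightarrow> Ck_on n S g"
proof -
  have imp: "Ck_on n S g" if f: "Ck_on n S f" and eq: "\<And>x. x \<in> S \<Longrightarrow> f x = g x"
    for f g :: "'a \<Rightarrow> 'b"
  proof (cases n)
    case 0
    then show ?thesis using f eq by (auto cong: continuous_on_cong)
  next
    case (Suc m)
    then obtain D where D: "\<forall>x\<in>S. (f has_derivative D x) (at x)" "\<forall>v. Ck_on m S (\<lambda>x. D x v)"
      using f by auto
    have "(g has_derivative D x) (at x)" if x: "x \<in> S" for x
      using has_derivative_transform_within_open[of f "D x" x UNIV S g] D(1) x assms(1) eq by auto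
    then show ?thesis using D Suc by auto
  qed
  show ?thesis using imp[of f g] imp[of g f] assms(2) by auto
qed

lemma Ck_on_scaleR_const: "Ck_on n S f \<Longrightarrow> Ck_on n S (\<lambda>x. c *\<^sub>R f x)"
proof (induction n arbitrary: f)
  case 0
  then show ?case by (auto intro: continuous_intros)
next
  case (Suc n)
  then obtain D where D: "\<forall>x\<in>S. (f has_derivative D x) (at x)" "\<forall>v. Ck_on n S (\<lambda>x. D x v)"
    by auto
  have "(\<forall>x\<in>S. ((\<lambda>x. c *\<^sub>R f x) has_derivative (\<lambda>v. c *\<^sub>R D x v)) (at x))"
    using D by (auto intro!: derivative_intros)
  then show ?case using D Suc.IH by auto
qed

text \<open>A linear map on the line is determined by its value at 1, so a single derivative
  function replaces the family of directional derivatives in \<open>Ck_on\<close>.\<close>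

lemma Ck_on_Suc_real:
  fixes f :: "real \<Rightarrow> 'b::real_normed_vector"
  shows "Ck_on (Suc n) S f \<longleftrightarrow>
    (\<exists>f'. (\<forall>t\<in>S. (f has_vector_derivative f' t) (at t)) \<and> Ck_on n S f')"
proof
  assume "Ck_on (Suc n) S f"
  then obtain D where D: "\<forall>x\<in>S. (f has_derivative D x) (at x)" "\<forall>v. Ck_on n S (\<lambda>x. D x v)"
    by auto
  have "(f has_vector_derivative D t 1) (at t)" if "t \<in> S" for t
  proof -
    have "D t = (\<lambda>v. v *\<^sub>R D t 1)"
      using D(1) that by (metis has_derivative_bounded_linear bounded_linear.linear linear_scale real_scaleR_def mult.right_neutral)
    then show ?thesis using D(1) that unfolding has_vector_derivative_def by metis
  qed
  then show "\<exists>f'. (\<forall>t\<in>S. (f has_vector_derivative f' t) (at t)) \<and> Ck_on n S f'"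
    using D(2) by (intro exI[of _ "\<lambda>t. D t 1"]) auto
next
  assume "\<exists>f'. (\<forall>t\<in>S. (f has_vector_derivative f' t) (at t)) \<and> Ck_on n S f'"
  then obtain f' where "\<forall>t\<in>S. (f has_derivative (\<lambda>v. v *\<^sub>R f' t)) (at t)" "Ck_on n S f'"
    unfolding has_vector_derivative_def by auto
  then show "Ck_on (Suc n) S f"
    by (auto intro!: exI[of _ "\<lambda>t v. v *\<^sub>R f' t"] Ck_on_scaleR_const)
qed

lemma Ck_on_vector_derivative:
  fixes f :: "real \<Rightarrow> 'b::real_normed_vector"
  assumes "Ck_on (Suc n) S f" "t \<in> S"
  shows "(f has_vector_derivative vector_derivative f (at t)) (at t)"
proof -
  obtain f' where "(f has_vector_derivative f' t) (at t)"
    using assms unfolding Ck_on_Suc_real by blast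
  then show ?thesis using vector_derivative_at by metis
qed

lemma Ck_on_SucI:
  fixes f :: "real \<Rightarrow> 'b::real_normed_vector"
  assumes "\<And>t. t \<in> S \<Longrightarrow> (f has_vector_derivative f' t) (at t)" "Ck_on n S f'"
  shows "Ck_on (Suc n) S f"
  unfolding Ck_on_Suc_real using assms by auto

lemma Ck_on_deriv:
  fixes f :: "real \<Rightarrow> 'b::real_normed_vector"
  assumes "Ck_on (Suc n) S f" "open S" "\<And>t. t \<in> S \<Longrightarrow> (f has_vector_derivative f' t) (at t)"
  shows "Ck_on n S f'"
proof -
  obtain g where g: "\<forall>t\<in>S. (f has_vector_derivative g t) (at t)" "Ck_on n S g"
    using assms(1) unfolding Ck_on_Suc_real by auto
  have "g t = f' t" if "t \<in> S" for t
    using g(1) assms(3) that vector_derivative_unique_at by blast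
  then show ?thesis using Ck_on_cong[OF assms(2)] g(2) by blast
qed

lemma Ck_on_SucD: "Ck_on (Suc n) S f \<Longrightarrow> Ck_on n S f"
proof (induction n arbitrary: f)
  case 0
  then obtain D where "\<forall>t\<in>S. (f has_derivative D t) (at t)" by auto
  then have "\<forall>t\<in>S. isCont f t" using has_derivative_continuous by blast
  then show ?case by (simp add: continuous_at_imp_continuous_on)
next
  case (Suc n)
  from Suc.prems obtain D where "\<forall>t\<in>S. (f has_derivative D t) (at t)" "\<forall>v. Ck_on (Suc n) S (\<lambda>x. D x v)"
    unfolding Ck_on.simps(2)[of "Suc n"] by blast
  then show ?case using Suc.IH unfolding Ck_on.simps(2)[of n] by blast
qed

lemma Ck_on_mono:
  assumes "Ck_on n S f" "m \<le> n"
  shows "Ck_on m S f"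
  using assms(2,1) by (induction rule: dec_induct) (auto dest: Ck_on_SucD simp del: Ck_on.simps(2))

lemma Ck_on_continuous:
  assumes "Ck_on n S f"
  shows "continuous_on S f"
  using Ck_on_mono[OF assms, of 0] by simp

lemma Ck_on_const [intro]: "Ck_on n S (\<lambda>x::real. c :: 'b::real_normed_vector)"
proof (induction n arbitrary: c)
  case (Suc n)
  have "((\<lambda>x. c) has_vector_derivative 0) (at t)" for t :: real
    by (auto intro!: derivative_eq_intros)
  then show ?case using Ck_on_SucI[where f' = "\<lambda>x. 0", OF _ Suc] by blast
qed simp

lemma Ck_on_ident [intro]: "Ck_on n S (\<lambda>x::real. x)"
proof (cases n)
  case (Suc m)
  show ?thesis unfolding Suc
    by (rule Ck_on_SucI[where f' = "\<lambda>x. 1", OF has_vector_derivative_id Ck_on_const])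
qed simp

lemma Ck_on_add:
  fixes f g :: "real \<Rightarrow> 'b::real_normed_vector"
  shows "Ck_on n S f \<Longrightarrow> Ck_on n S g \<Longrightarrow> Ck_on n S (\<lambda>x. f x + g x)"
proof (induction n arbitrary: f g)
  case 0
  then show ?case by (auto intro: continuous_intros)
next
  case (Suc n)
  obtain f' g' where "\<forall>t\<in>S. (f has_vector_derivative f' t) (at t)" "Ck_on n S f'"
     "\<forall>t\<in>S. (g has_vector_derivative g' t) (at t)" "Ck_on n S g'"
    using Suc.prems unfolding Ck_on_Suc_real by auto
  then show ?case
    using Suc.IH[of f' g'] by (intro Ck_on_SucI[where f' = "\<lambda>x. f' x + g' x"] has_vector_derivative_add) auto
qed

lemma Ck_on_bilinear:
  fixes f :: "real \<Rightarrow> 'b::real_normed_vector" and g :: "real \<Rightarrow> 'c::real_normed_vector"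
    and prod :: "'b \<Rightarrow> 'c \<Rightarrow> 'd::real_normed_vector"
  assumes "bounded_bilinear prod"
  shows "Ck_on n S f \<Longrightarrow> Ck_on n S g \<Longrightarrow> Ck_on n S (\<lambda>x. prod (f x) (g x))"
proof (induction n arbitrary: f g)
  case 0
  then show ?case using bounded_bilinear.continuous_on[OF assms] by auto
next
  case (Suc n)
  obtain f' g' where d: "\<forall>t\<in>S. (f has_vector_derivative f' t) (at t)" "Ck_on n S f'"
     "\<forall>t\<in>S. (g has_vector_derivative g' t) (at t)" "Ck_on n S g'"
    using Suc.prems unfolding Ck_on_Suc_real by auto
  have "((\<lambda>x. prod (f x) (g x)) has_vector_derivative prod (f t) (g' t) + prod (f' t) (g t)) (at t)"
    if "t \<in> S" for t
    using d that bounded_bilinear.has_vector_derivative[OF assms] by blast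
  moreover have "Ck_on n S (\<lambda>t. prod (f t) (g' t) + prod (f' t) (g t))"
    using d Suc.prems by (intro Ck_on_add Suc.IH) (auto dest: Ck_on_SucD simp del: Ck_on.simps(2))
  ultimately show ?case by (rule Ck_on_SucI)
qed

lemma bounded_bilinear_cross3: "bounded_bilinear cross3"
  using bilinear_conv_bounded_bilinear bilinear_cross by blast

lemmas Ck_on_mult = Ck_on_bilinear[OF bounded_bilinear_mult]
  and Ck_on_scaleR = Ck_on_bilinear[OF bounded_bilinear_scaleR]
  and Ck_on_inner = Ck_on_bilinear[OF bounded_bilinear_inner]
  and Ck_on_cross3 = Ck_on_bilinear[OF bounded_bilinear_cross3]

lemma Ck_on_minus:
  fixes f :: "real \<Rightarrow> 'b::real_normed_vector"
  shows "Ck_on n S f \<Longrightarrow> Ck_on n S (\<lambda>x. - f x)"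
  using Ck_on_scaleR_const[of n S f "-1"] by simp

lemma Ck_on_diff:
  fixes f g :: "real \<Rightarrow> 'b::real_normed_vector"
  shows "Ck_on n S f \<Longrightarrow> Ck_on n S g \<Longrightarrow> Ck_on n S (\<lambda>x. f x - g x)"
  using Ck_on_add[of n S f "\<lambda>x. - g x"] Ck_on_minus[of n S g] by simp

lemma Ck_on_sum:
  fixes f :: "'i \<Rightarrow> real \<Rightarrow> 'b::real_normed_vector"
  shows "(\<And>i. i \<in> I \<Longrightarrow> Ck_on n S (f i)) \<Longrightarrow> Ck_on n S (\<lambda>x. \<Sum>i\<in>I. f i x)"
  by (induction I rule: infinite_finite_induct) (auto intro: Ck_on_add)

lemma Ck_on_compose:
  fixes f :: "real \<Rightarrow> 'b::real_normed_vector" and \<tau> :: "real \<Rightarrow> real"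
  shows "Ck_on n T f \<Longrightarrow> Ck_on n S \<tau> \<Longrightarrow> \<tau> ` S \<subseteq> T \<Longrightarrow> Ck_on n S (\<lambda>x. f (\<tau> x))"
proof (induction n arbitrary: f)
  case 0
  then show ?case using continuous_on_compose2 by auto
next
  case (Suc n)
  obtain f' \<tau>' where d: "\<forall>t\<in>T. (f has_vector_derivative f' t) (at t)" "Ck_on n T f'"
     "\<forall>t\<in>S. (\<tau> has_vector_derivative \<tau>' t) (at t)" "Ck_on n S \<tau>'"
    using Suc.prems unfolding Ck_on_Suc_real by auto
  have "((\<lambda>x. f (\<tau> x)) has_vector_derivative \<tau>' t *\<^sub>R f' (\<tau> t)) (at t)" if "t \<in> S" for t
    using vector_diff_chain_at[of \<tau> "\<tau>' t" t f "f' (\<tau> t)"] d that Suc.prems by (auto simp: o_def)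
  moreover have "Ck_on n S (\<lambda>t. \<tau>' t *\<^sub>R f' (\<tau> t))"
    using d Suc.prems by (intro Ck_on_scaleR Suc.IH) (auto dest: Ck_on_SucD simp del: Ck_on.simps(2))
  ultimately show ?case by (rule Ck_on_SucI)
qed

lemma Ck_on_powr:
  fixes f :: "real \<Rightarrow> real"
  assumes "\<And>t. t \<in> S \<Longrightarrow> f t > 0"
  shows "Ck_on n S f \<Longrightarrow> Ck_on n S (\<lambda>x. f x powr c)"
proof (induction n arbitrary: c)
  case 0
  then show ?case using assms by (fastforce intro!: continuous_intros)
next
  case (Suc n)
  obtain f' where d: "\<forall>t\<in>S. (f has_vector_derivative f' t) (at t)" "Ck_on n S f'"
    using Suc.prems unfolding Ck_on_Suc_real by auto
  have "((\<lambda>x. f x powr c) has_vector_derivative c * f t powr (c - 1) * f' t) (at t)" if "t \<in> S" for t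
  proof -
    have "(f has_real_derivative f' t) (at t)"
      using d that by (simp add: real_vd_iff)
    then have "((\<lambda>x. f x powr c) has_real_derivative c * f t powr (c - 1) * f' t) (at t)"
      using assms[OF that] by (auto intro!: derivative_eq_intros simp: powr_diff field_simps)
    then show ?thesis by (simp add: real_vd_iff)
  qed
  moreover have "Ck_on n S (\<lambda>t. c * f t powr (c - 1) * f' t)"
    using d Suc by (intro Ck_on_mult Ck_on_const) (auto dest: Ck_on_SucD simp del: Ck_on.simps(2))
  ultimately show ?case by (rule Ck_on_SucI)
qed

lemma Ck_on_inverse:
  fixes f :: "real \<Rightarrow> real"
  assumes "\<And>t. t \<in> S \<Longrightarrow> f t \<noteq> 0"
  shows "Ck_on n S f \<Longrightarrow> Ck_on n S (\<lambda>x. inverse (f x))"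
proof (induction n)
  case 0
  then show ?case using assms by (auto intro!: continuous_intros)
next
  case (Suc n)
  obtain f' where d: "\<forall>t\<in>S. (f has_vector_derivative f' t) (at t)" "Ck_on n S f'"
    using Suc.prems unfolding Ck_on_Suc_real by auto
  have "((\<lambda>x. inverse (f x)) has_vector_derivative - (inverse (f t) * f' t * inverse (f t))) (at t)" if "t \<in> S" for t
    using d that assms[OF that] DERIV_inverse'[of f "f' t" t UNIV]
    by (simp add: real_vd_iff[symmetric])
  moreover have "Ck_on n S (\<lambda>t. - (inverse (f t) * f' t * inverse (f t)))"
    using d Suc by (intro Ck_on_mult Ck_on_minus) (auto dest: Ck_on_SucD simp del: Ck_on.simps(2))
  ultimately show ?case by (rule Ck_on_SucI)
qed

lemma Ck_on_divide:
  fixes f g :: "real \<Rightarrow> real"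
  assumes "Ck_on n S f" "Ck_on n S g" "\<And>t. t \<in> S \<Longrightarrow> g t \<noteq> 0"
  shows "Ck_on n S (\<lambda>x. f x / g x)"
  unfolding divide_inverse using assms by (intro Ck_on_mult Ck_on_inverse) auto

lemma Ck_on_sin_cos: "Ck_on n S (sin :: real \<Rightarrow> real) \<and> Ck_on n S (cos :: real \<Rightarrow> real)"
proof (induction n)
  case 0
  then show ?case by (auto intro: continuous_intros)
next
  case (Suc n)
  have "(sin has_vector_derivative cos t) (at t)" "(cos has_vector_derivative - sin t) (at t)" for t :: real
    by (auto simp: real_vd_iff[symmetric] intro!: derivative_eq_intros)
  then show ?case using Suc Ck_on_minus[of n S sin]
    by (intro conjI Ck_on_SucI[of S sin cos] Ck_on_SucI[of S cos "\<lambda>x. - sin x"]) auto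
qed

lemma Ck_on_local:
  fixes f :: "real \<Rightarrow> 'b::real_normed_vector"
  assumes "\<And>t. t \<in> S \<Longrightarrow> \<exists>T. open T \<and> t \<in> T \<and> Ck_on n T f"
  shows "Ck_on n S f"
  using assms
proof (induction n arbitrary: f)
  case 0
  have "isCont f t" if t: "t \<in> S" for t
  proof -
    obtain T where "open T" "t \<in> T" "continuous_on T f"
      using 0[OF t] by auto
    then show ?thesis using continuous_on_eq_continuous_at by blast
  qed
  then show ?case by (simp add: continuous_at_imp_continuous_on)
next
  case (Suc n)
  \<comment> \<open>A canonical choice of derivative, so that the local derivatives agree on
    overlaps and glue.\<close>
  define f' where "f' t = vector_derivative f (at t)" for t
  have loc: "\<exists>T. open T \<and> t \<in> T \<and> (\<forall>s\<in>T. (f has_vector_derivative f' s) (at s)) \<and> Ck_on n T f'"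
    if t: "t \<in> S" for t
  proof -
    obtain T where T: "open T" "t \<in> T" "Ck_on (Suc n) T f"
      using Suc.prems[OF t] by blast
    then obtain g where g: "\<forall>s\<in>T. (f has_vector_derivative g s) (at s)" "Ck_on n T g"
      unfolding Ck_on_Suc_real by auto
    then have "\<forall>s\<in>T. (f has_vector_derivative f' s) (at s)"
      unfolding f'_def using vector_derivative_at by fastforce
    moreover from this have "Ck_on n T f'" using Ck_on_deriv[OF T(3,1), of f'] by simp
    ultimately show ?thesis using T(1,2) by auto
  qed
  show ?case
  proof (rule Ck_on_SucI[where f' = f'])
    show "(f has_vector_derivative f' t) (at t)" if "t \<in> S" for t using loc[OF that] by blast
    show "Ck_on n S f'" using Suc.IH[of f'] loc by blast
  qed
qed

text \<open>In several variables \<open>Ck_on\<close> controls derivatives only in fixed directions.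
  Expanding the velocity of the curve in \<open>Basis\<close> writes the chain rule as a sum of such
  terms, to which the induction applies.\<close>

lemma Ck_on_compose_curve:
  fixes h :: "'a::euclidean_space \<Rightarrow> real" and Y :: "real \<Rightarrow> 'a"
  shows "Ck_on n U h \<Longrightarrow> Ck_on n S Y \<Longrightarrow> Y ` S \<subseteq> U \<Longrightarrow> Ck_on n S (\<lambda>t. h (Y t))"
proof (induction n arbitrary: h)
  case 0
  then show ?case using continuous_on_compose2 by auto
next
  case (Suc n)
  obtain D where D: "\<forall>x\<in>U. (h has_derivative D x) (at x)" "\<forall>v. Ck_on n U (\<lambda>x. D x v)"
    using Suc.prems(1) by auto
  obtain Y' where Y': "\<forall>t\<in>S. (Y has_vector_derivative Y' t) (at t)" "Ck_on n S Y'"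
    using Suc.prems(2) unfolding Ck_on_Suc_real by auto
  have "((\<lambda>t. h (Y t)) has_vector_derivative (\<Sum>b\<in>Basis. (Y' t \<bullet> b) * D (Y t) b)) (at t)"
    if t: "t \<in> S" for t
  proof -
    have "Y t \<in> U" using t Suc.prems(3) by auto
    then have l: "linear (D (Y t))" and hd: "(h has_derivative D (Y t)) (at (Y t))"
      using D(1) has_derivative_linear by blast+
    have "((\<lambda>t. h (Y t)) has_vector_derivative D (Y t) (Y' t)) (at t)"
      using vector_derivative_diff_chain_within[of Y "Y' t" t UNIV h "D (Y t)"] Y'(1) t hd
      by (auto simp: o_def intro: has_derivative_at_withinI)
    also have "D (Y t) (Y' t) = D (Y t) (\<Sum>b\<in>Basis. (Y' t \<bullet> b) *\<^sub>R b)"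
      by (simp add: euclidean_representation)
    also have "\<dots> = (\<Sum>b\<in>Basis. (Y' t \<bullet> b) * D (Y t) b)"
      using l by (simp add: linear_sum linear_scale)
    finally show ?thesis .
  qed
  moreover have "Ck_on n S (\<lambda>t. \<Sum>b\<in>Basis. (Y' t \<bullet> b) * D (Y t) b)"
    using Y'(2) D(2) Suc.prems Ck_on_SucD
    by (intro Ck_on_sum Ck_on_mult Ck_on_inner Ck_on_const Suc.IH) (auto simp del: Ck_on.simps)
  ultimately show ?case by (rule Ck_on_SucI)
qed

text \<open>In the autonomous equation each degree of smoothness of \<open>\<sigma>\<close> passes
  through \<open>h\<close> to its derivative. The inverse of a change of parameter gets its
  regularity in this way.\<close>

lemma Ck_on_inverse_function:
  fixes \<sigma> h :: "real \<Rightarrow> real"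
  assumes d: "\<And>s. (\<sigma> has_vector_derivative h (\<sigma> s)) (at s)"
  shows "Ck_on n UNIV h \<Longrightarrow> Ck_on (Suc n) UNIV \<sigma>"
proof (induction n)
  case 0
  have "continuous_on UNIV \<sigma>"
    using d has_vector_derivative_continuous continuous_at_imp_continuous_on by blast
  then show ?case using Ck_on_SucI[where S = UNIV and n = 0, OF d] Ck_on_compose[of 0 UNIV h UNIV \<sigma>] 0
    by (simp del: Ck_on.simps(2))
next
  case (Suc n)
  then have "Ck_on (Suc n) UNIV \<sigma>" using Ck_on_SucD by blast
  then show ?case using Ck_on_SucI[where S = UNIV and n = "Suc n", OF d] Ck_on_compose[of "Suc n" UNIV h UNIV \<sigma>] Suc.prems
    by (simp del: Ck_on.simps(2))
qed

section \<open>Existence for linear second-order equations\<close>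

text \<open>An antiderivative chosen on the whole line at once, which avoids oriented integrals for
  negative arguments.\<close>

definition primitive :: "(real \<Rightarrow> real) \<Rightarrow> real \<Rightarrow> real" where
  "primitive g = (SOME G. G 0 = 0 \<and> (\<forall>t. (G has_real_derivative g t) (at t)))"

lemma
  assumes "continuous_on UNIV g"
  shows primitive_0 [simp]: "primitive g 0 = 0"
    and primitive_deriv: "(primitive g has_real_derivative g t) (at t)"
proof -
  have "\<exists>F. \<forall>x::real. -\<infinity> < ereal x \<longrightarrow> ereal x < \<infinity> \<longrightarrow> (F has_vector_derivative g x) (at x)"
    using assms by (intro einterval_antiderivative) (auto simp: continuous_on_eq_continuous_at)
  then obtain F where "\<forall>x. (F has_real_derivative g x) (at x)"
    by (auto simp: real_vd_iff)
  then have "\<exists>G. G 0 = 0 \<and> (\<forall>t. (G has_real_derivative g t) (at t))"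
    by (intro exI[of _ "\<lambda>t. F t - F 0"]) (auto intro!: derivative_eq_intros)
  from someI_ex[OF this] show "primitive g 0 = 0" "(primitive g has_real_derivative g t) (at t)"
    unfolding primitive_def by auto
qed

lemma continuous_on_primitive:
  assumes "continuous_on UNIV g"
  shows "continuous_on UNIV (primitive g)"
  using primitive_deriv[OF assms] DERIV_isCont continuous_at_imp_continuous_on by blast

lemma primitive_unique:
  assumes "continuous_on UNIV g" "G 0 = 0" "\<And>t. (G has_real_derivative g t) (at t)"
  shows "primitive g t = G t"
proof -
  have "((\<lambda>t. primitive g t - G t) has_real_derivative 0) (at t)" for t
    using primitive_deriv[OF assms(1)] assms(3) by (auto intro!: derivative_eq_intros)
  from DERIV_isconst_all[of "\<lambda>t. primitive g t - G t" t 0] this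
  have "primitive g t - G t = primitive g 0 - G 0" by blast
  then show ?thesis using assms by simp
qed

lemma primitive_diff:
  assumes "continuous_on UNIV f" "continuous_on UNIV g"
  shows "primitive (\<lambda>t. f t - g t) = (\<lambda>t. primitive f t - primitive g t)"
proof -
  have "continuous_on UNIV (\<lambda>t. f t - g t)" using assms by (intro continuous_intros)
  moreover have "((\<lambda>t. primitive f t - primitive g t) has_real_derivative f t - g t) (at t)" for t
    using primitive_deriv[OF assms(1)] primitive_deriv[OF assms(2)] by (intro DERIV_diff)
  ultimately have "primitive (\<lambda>t. f t - g t) t = primitive f t - primitive g t" for t
    using assms by (intro primitive_unique) auto
  then show ?thesis by blast
qed

text \<open>Compare with the antiderivative of the bound and use |sinh| \<le> cosh. The weight is
  even and reproduces itself, and each integration gains a factor \<open>1 / l\<close>; this gain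
  produces the contraction below.\<close>

lemma primitive_cosh_bound:
  assumes g: "continuous_on UNIV g" "\<And>t. \<bar>g t\<bar> \<le> M * cosh (l * t)" and l: "l > 0"
  shows "\<bar>primitive g t\<bar> \<le> M / l * cosh (l * t)"
proof -
  have M: "M \<ge> 0" using g(2)[of 0] by simp
  define S where "S t = M / l * sinh (l * t)" for t
  have S: "(S has_real_derivative M * cosh (l * t)) (at t)" for t
    unfolding S_def using l by (auto intro!: derivative_eq_intros)
  have 1: "S s - primitive g s \<le> S t - primitive g t" if "s \<le> t" for s t
    using that
  proof (rule DERIV_nonneg_imp_nondecreasing)
    fix x
    show "\<exists>y. ((\<lambda>a. S a - primitive g a) has_real_derivative y) (at x) \<and> 0 \<le> y"
      using primitive_deriv[OF g(1), of x] S[of x] g(2)[of x]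
      by (intro exI[of _ "M * cosh (l * x) - g x"]) (auto intro!: derivative_eq_intros)
  qed
  have 2: "S s + primitive g s \<le> S t + primitive g t" if "s \<le> t" for s t
    using that
  proof (rule DERIV_nonneg_imp_nondecreasing)
    fix x
    show "\<exists>y. ((\<lambda>a. S a + primitive g a) has_real_derivative y) (at x) \<and> 0 \<le> y"
      using primitive_deriv[OF g(1), of x] S[of x] g(2)[of x]
      by (intro exI[of _ "M * cosh (l * x) + g x"]) (auto intro!: derivative_eq_intros)
  qed
  have S0: "S 0 = 0" by (simp add: S_def)
  have "\<bar>primitive g t\<bar> \<le> \<bar>S t\<bar>"
    using 1[of 0 t] 2[of 0 t] 1[of t 0] 2[of t 0] S0 primitive_0[OF g(1)] by (cases "t \<ge> 0") auto
  also have "\<dots> \<le> M / l * cosh (l * t)"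
  proof -
    have "\<bar>sinh (l * t)\<bar> \<le> cosh (l * t)"
      by (simp add: sinh_def cosh_def abs_le_iff)
    then show ?thesis unfolding S_def abs_mult using M l by (intro mult_mono) auto
  qed
  finally show ?thesis .
qed

text \<open>Picard iteration on the whole line in one step: writing \<open>z = w * \<phi>\<close>
  with the weight \<open>w = cosh (l t)\<close> and \<open>\<phi>\<close> bounded and continuous
  turns the integral equation into a contraction in the sup norm, so no continuation of local
  solutions is involved.\<close>

lemma linear_second_order_ode_exists:
  fixes q :: "real \<Rightarrow> real"
  assumes q: "continuous_on UNIV q" "\<And>t. \<bar>q t\<bar> \<le> A"
  obtains z z1 where "\<And>t. (z has_real_derivative z1 t) (at t)"
    "\<And>t. (z1 has_real_derivative - q t * z t) (at t)" "z 0 = x0" "z1 0 = x1"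
proof -
  \<comment> \<open>This choice gives 2 A \<le> l^2, so two integrations of \<open>q * z\<close>
    contract by the factor 1/2.\<close>
  define l where "l = 1 + A"
  have A: "A \<ge> 0" using q(2)[of 0] by linarith
  then have l: "l > 0" "l \<ge> 1" by (auto simp: l_def)
  define w where "w t = cosh (l * t)" for t
  have w: "w t \<ge> 1" "w t > 0" for t using cosh_real_ge_1[of "l*t"] by (auto simp: w_def less_le_trans[OF zero_less_one])
  have cw: "continuous_on UNIV w" unfolding w_def by (intro continuous_intros)
  \<comment> \<open>The sine replaces the linear term x1 t of the initial data because it is
    bounded; its second derivative is compensated by the extra summand in \<open>F\<close>.\<close>
  define B where "B t = x0 + x1 * sin t" for t
  define F where "F z t = - q t * z t + x1 * sin t" for z t
  have cF: "continuous_on UNIV (F z)" if "continuous_on UNIV z" for z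
    unfolding F_def using that q(1) by (intro continuous_intros)
  define Q where "Q z = primitive (primitive (F z))" for z
  have cQ: "continuous_on UNIV (Q z)" if "continuous_on UNIV z" for z
    unfolding Q_def using that by (intro continuous_on_primitive cF)
  have pp: "\<bar>primitive (primitive g) t\<bar> \<le> M / l / l * w t"
    if "continuous_on UNIV g" "\<And>t. \<bar>g t\<bar> \<le> M * w t" for g M t
    unfolding w_def using that l(1)
    by (intro primitive_cosh_bound continuous_on_primitive) (auto simp: w_def)
  define T where "T \<phi> t = (B t + Q (\<lambda>s. w s * apply_bcontfun \<phi> s) t) / w t" for \<phi> t
  have cphi: "continuous_on UNIV (\<lambda>s. w s * apply_bcontfun \<phi> s)" for \<phi> :: "real \<Rightarrow>\<^sub>C real"
    using cw by (intro continuous_intros) auto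
  have Tb: "T \<phi> \<in> bcontfun" for \<phi> :: "real \<Rightarrow>\<^sub>C real"
  proof (rule bcontfun_normI)
    show "continuous_on UNIV (T \<phi>)"
      unfolding T_def B_def using cQ[OF cphi[of \<phi>]] cw w(2)
      by (intro continuous_intros) (auto simp: less_imp_neq[THEN not_sym])
    fix t
    let ?M = "A * norm \<phi> + \<bar>x1\<bar>"
    have "\<bar>F (\<lambda>s. w s * apply_bcontfun \<phi> s) t\<bar> \<le> ?M * w t" for t
    proof -
      have a: "\<bar>q t * (w t * apply_bcontfun \<phi> t)\<bar> \<le> A * (w t * norm \<phi>)"
        unfolding abs_mult using q(2)[of t] A w(2)[of t] norm_bounded[of \<phi> t]
        by (intro mult_mono) auto
      have b: "\<bar>x1 * sin t\<bar> \<le> \<bar>x1\<bar> * w t"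
        unfolding abs_mult using w(1)[of t] by (intro mult_left_mono order.trans[OF abs_sin_le_one]) auto
      show ?thesis unfolding F_def using a b by (simp add: algebra_simps abs_le_iff)
    qed
    from pp[OF cF[OF cphi] this, of t]
    have "\<bar>Q (\<lambda>s. w s * apply_bcontfun \<phi> s) t\<bar> \<le> ?M / l / l * w t" by (simp add: Q_def)
    moreover have "\<bar>B t\<bar> \<le> (\<bar>x0\<bar> + \<bar>x1\<bar>) * w t"
    proof -
      have "\<bar>B t\<bar> \<le> \<bar>x0\<bar> + \<bar>x1\<bar> * \<bar>sin t\<bar>" unfolding B_def by (metis abs_mult abs_triangle_ineq)
      also have "\<dots> \<le> (\<bar>x0\<bar> + \<bar>x1\<bar>) * 1"
        using mult_left_mono[OF abs_sin_le_one[of t], of "\<bar>x1\<bar>"] by simp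
      also have "\<dots> \<le> (\<bar>x0\<bar> + \<bar>x1\<bar>) * w t" using w(1)[of t] by (intro mult_left_mono) auto
      finally show ?thesis .
    qed
    ultimately have "\<bar>B t + Q (\<lambda>s. w s * apply_bcontfun \<phi> s) t\<bar> \<le> (\<bar>x0\<bar> + \<bar>x1\<bar> + ?M / l / l) * w t"
      by (simp add: distrib_right)
    then show "norm (T \<phi> t) \<le> \<bar>x0\<bar> + \<bar>x1\<bar> + ?M / l / l"
      unfolding T_def using w(2)[of t] by (simp add: divide_le_eq)
  qed
  have lip: "dist (Bcontfun (T \<phi>)) (Bcontfun (T \<psi>)) \<le> 1/2 * dist \<phi> \<psi>" for \<phi> \<psi>
  proof (rule dist_bound)
    fix t
    let ?f = "\<lambda>s. w s * apply_bcontfun \<phi> s" and ?g = "\<lambda>s. w s * apply_bcontfun \<psi> s"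
    let ?d = "\<lambda>s. F ?f s - F ?g s"
    have cd: "continuous_on UNIV ?d" using cF[OF cphi] by (intro continuous_intros) auto
    have "\<bar>?d s\<bar> \<le> A * dist \<phi> \<psi> * w s" for s
    proof -
      have "?d s = - q s * w s * (apply_bcontfun \<phi> s - apply_bcontfun \<psi> s)"
        by (simp add: F_def algebra_simps)
      then have "\<bar>?d s\<bar> = \<bar>q s\<bar> * w s * dist (apply_bcontfun \<phi> s) (apply_bcontfun \<psi> s)"
        using w(2)[of s] by (simp add: abs_mult dist_real_def)
      also have "\<dots> \<le> A * w s * dist \<phi> \<psi>"
        using q(2)[of s] w(2)[of s] A dist_bounded[of \<phi> s \<psi>] by (intro mult_mono) auto
      finally show ?thesis by (simp add: mult_ac)
    qed
    from pp[OF cd this, of t]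
    have "\<bar>Q ?f t - Q ?g t\<bar> \<le> A * dist \<phi> \<psi> / l / l * w t"
      unfolding Q_def using primitive_diff[OF cF[OF cphi] cF[OF cphi], of \<phi> \<psi>]
        primitive_diff[OF continuous_on_primitive[OF cF[OF cphi]] continuous_on_primitive[OF cF[OF cphi]], of \<phi> \<psi>]
      by simp
    also have "A * dist \<phi> \<psi> / l / l \<le> 1/2 * dist \<phi> \<psi>"
    proof -
      have "2 * A \<le> l * l" unfolding l_def by (simp add: algebra_simps)
      then have "2 * A / (l * l) \<le> 1" using l by simp
      then have "A / l / l \<le> 1/2" by (simp add: mult.commute)
      from mult_right_mono[OF this, of "dist \<phi> \<psi>"] show ?thesis by simp
    qed
    finally have "\<bar>Q ?f t - Q ?g t\<bar> \<le> 1/2 * dist \<phi> \<psi> * w t"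
      using w(2)[of t] by (simp add: mult_right_mono)
    moreover have "T \<phi> t - T \<psi> t = (Q ?f t - Q ?g t) / w t"
      by (simp add: T_def diff_divide_distrib add_divide_distrib)
    ultimately have "\<bar>T \<phi> t - T \<psi> t\<bar> \<le> 1/2 * dist \<phi> \<psi>"
      using w(2)[of t] by (simp add: divide_le_eq abs_divide)
    then show "dist (apply_bcontfun (Bcontfun (T \<phi>)) t) (apply_bcontfun (Bcontfun (T \<psi>)) t) \<le> 1/2 * dist \<phi> \<psi>"
      by (simp add: Bcontfun_inverse[OF Tb] dist_real_def)
  qed
  have "\<exists>!\<phi>. Bcontfun (T \<phi>) = \<phi>"
    using lip by (intro banach_fix_type[of "1/2"]) (auto simp del: dist_commute)
  then obtain \<phi> where "Bcontfun (T \<phi>) = \<phi>" by blast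
  then have phi: "apply_bcontfun \<phi> = T \<phi>" using Bcontfun_inverse[OF Tb] by metis
  define z where "z t = w t * apply_bcontfun \<phi> t" for t
  have cz: "continuous_on UNIV z" using cphi unfolding z_def by simp
  have zeq: "z t = B t + primitive (primitive (F z)) t" for t
  proof -
    have "z t = w t * T \<phi> t" using phi by (simp add: z_def)
    also have "\<dots> = B t + Q z t"
      unfolding T_def z_def[symmetric] using w(2)[of t] by (simp add: z_def[abs_def])
    finally show ?thesis by (simp add: Q_def)
  qed
  define z1 where "z1 t = x1 * cos t + primitive (F z) t" for t
  show thesis
  proof (rule that[of z z1])
    fix t
    have "((\<lambda>t. B t + primitive (primitive (F z)) t) has_real_derivative z1 t) (at t)"
      unfolding B_def z1_def using primitive_deriv[OF continuous_on_primitive[OF cF[OF cz]]]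
      by (auto intro!: derivative_eq_intros)
    then show "(z has_real_derivative z1 t) (at t)" unfolding zeq[symmetric] .
    show "(z1 has_real_derivative - q t * z t) (at t)"
      unfolding z1_def using primitive_deriv[OF cF[OF cz]]
      by (auto intro!: derivative_eq_intros simp: F_def)
    show "z 0 = x0" using zeq[of 0] primitive_0[OF continuous_on_primitive[OF cF[OF cz]]] by (simp add: B_def)
    show "z1 0 = x1" unfolding z1_def using primitive_0[OF cF[OF cz]] by simp
  qed
qed

section \<open>Hill comparison along a unimodular curve\<close>

lemma periodic_int_shift:
  fixes f :: "real \<Rightarrow> 'a"
  assumes "\<And>t. f (t + p) = f t"
  shows "f (t + of_int n * p) = f t"
proof -
  have nat: "f (t + of_nat n * p) = f t" for n t
  proof (induction n)
    case (Suc n)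
    then show ?case using assms[of "t + of_nat n * p"] by (simp add: algebra_simps)
  qed simp
  show ?thesis
  proof (cases "n \<ge> 0")
    case True
    then show ?thesis using nat[of t "nat n"] by simp
  next
    case False
    then show ?thesis using nat[of "t + of_int n * p" "nat (-n)"] by (simp add: algebra_simps)
  qed
qed

lemma period_representative:
  fixes t a p :: real
  assumes "p > 0"
  obtains n :: int where "a \<le> t + of_int n * p" "t + of_int n * p < a + p"
proof -
  let ?n = "- \<lfloor>(t - a) / p\<rfloor>"
  have "of_int \<lfloor>(t - a) / p\<rfloor> * p \<le> t - a" "t - a < (of_int \<lfloor>(t - a) / p\<rfloor> + 1) * p"
    using assms by (rule floor_divide_lower, rule floor_divide_upper)
  then show thesis using that[of ?n] by (simp add: algebra_simps)
qed

lemma vector_derivative_periodic: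
  assumes "\<And>t. (f has_vector_derivative f' t) (at t)" "\<And>t. f (t + p) = f t"
  shows "f' (t + p) = f' t"
proof -
  have "((\<lambda>t. t + p) has_vector_derivative 1) (at t)" by (auto intro!: derivative_eq_intros)
  from vector_diff_chain_at[OF this assms(1)[of "t + p"]]
  have "((\<lambda>t. f (t + p)) has_vector_derivative f' (t + p)) (at t)" by (simp add: o_def)
  then show ?thesis unfolding assms(2) using assms(1) vector_derivative_unique_at by blast
qed

lemma periodic_attains_bounds:
  fixes f :: "real \<Rightarrow> real"
  assumes "\<And>t. f (t + p) = f t" "continuous_on UNIV f" "p > 0"
  obtains lo hi where "\<And>t. f lo \<le> f t" "\<And>t. f t \<le> f hi"
proof -
  have c: "continuous_on {0..p} f" using assms(2) continuous_on_subset by blast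
  have ne: "{0..p} \<noteq> {}" using assms(3) by auto
  obtain lo hi where lh: "\<forall>t\<in>{0..p}. f lo \<le> f t" "\<forall>t\<in>{0..p}. f t \<le> f hi"
    using continuous_attains_inf[OF compact_Icc ne c] continuous_attains_sup[OF compact_Icc ne c] by blast
  have "f lo \<le> f t \<and> f t \<le> f hi" for t
  proof -
    obtain n :: int where "0 \<le> t + of_int n * p" "t + of_int n * p < 0 + p"
      using period_representative[OF assms(3)] by blast
    then show ?thesis using lh periodic_int_shift[of f p t n, OF assms(1)] by (metis add_0 atLeastAtMost_iff less_imp_le)
  qed
  then show thesis using that by blast
qed

lemma Ck_on_second_order_ode:
  fixes q z z1 :: "real \<Rightarrow> real"
  assumes "\<And>t. (z has_real_derivative z1 t) (at t)" "\<And>t. (z1 has_real_derivative q t * z t) (at t)"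
  shows "Ck_on m UNIV q \<Longrightarrow> Ck_on (m + 2) UNIV z"
proof (induction m)
  case 0
  have "continuous_on UNIV z"
    using assms(1) DERIV_isCont continuous_at_imp_continuous_on by blast
  then have "Ck_on 0 UNIV (\<lambda>t. q t * z t)" using 0 by (auto intro!: continuous_intros)
  then have "Ck_on (Suc 0) UNIV z1"
    using assms(2) by (intro Ck_on_SucI[where f = z1 and f' = "\<lambda>t. q t * z t"]) (auto simp: real_vd_iff)
  then have "Ck_on (Suc (Suc 0)) UNIV z"
    using assms(1) by (intro Ck_on_SucI[where f = z and f' = z1]) (auto simp: real_vd_iff simp del: Ck_on.simps)
  then show ?case by (simp add: numeral_2_eq_2 del: Ck_on.simps)
next
  case (Suc m)
  have "Ck_on (m + 2) UNIV z" using Suc Ck_on_SucD by blast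
  then have "Ck_on (Suc m) UNIV z" using Ck_on_mono[of "m + 2" UNIV z "Suc m"] by simp
  then have "Ck_on (Suc m) UNIV (\<lambda>t. q t * z t)" using Suc.prems by (intro Ck_on_mult)
  then have "Ck_on (Suc (Suc m)) UNIV z1"
    using assms(2) by (intro Ck_on_SucI[where f = z1 and f' = "\<lambda>t. q t * z t"]) (auto simp: real_vd_iff simp del: Ck_on.simps)
  then have "Ck_on (Suc (Suc (Suc m))) UNIV z"
    using assms(1) by (intro Ck_on_SucI[where f = z and f' = z1]) (auto simp: real_vd_iff simp del: Ck_on.simps)
  then show ?case by (simp del: Ck_on.simps)
qed

text \<open>Near a double zero, u'/u behaves like 2/(t - c), and the zero of \<open>f\<close>
  absorbs this pole. It supplies the end-point limits of the comparison Wronskian.\<close>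

lemma tendsto_log_derivative_double_zero:
  fixes u u1 f :: "real \<Rightarrow> real"
  assumes u: "\<And>t. (u has_real_derivative u1 t) (at t)" "(u1 has_real_derivative u2) (at c)"
    and 0: "u c = 0" "u1 c = 0" "u2 \<noteq> 0" "f c = 0"
    and f: "(f has_real_derivative f1) (at c)"
  shows "((\<lambda>t. f t * (u1 t / u t)) \<longlongrightarrow> 2 * f1) (at c)"
proof -
  have l1: "((\<lambda>t. u1 t / (t - c)) \<longlongrightarrow> u2) (at c)"
    using u(2) 0 by (simp add: has_field_derivative_iff)
  have l2: "((\<lambda>t. f t / (t - c)) \<longlongrightarrow> f1) (at c)"
    using f 0 by (simp add: has_field_derivative_iff)
  have ne: "eventually (\<lambda>t. t \<noteq> c) (at c)" by (simp add: eventually_at_filter)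
  have l3: "((\<lambda>t. u t / (t - c)\<^sup>2) \<longlongrightarrow> u2 / 2) (at c)"
  proof (rule lhopital[where f' = u1 and g' = "\<lambda>t. 2 * (t - c)"])
    show "(u \<longlongrightarrow> 0) (at c)" using DERIV_isCont[OF u(1)] 0 by (metis isCont_def)
    have "((\<lambda>x. (x - c)\<^sup>2) \<longlongrightarrow> (c - c)\<^sup>2) (at c)" by (intro tendsto_intros)
    then show "((\<lambda>x. (x - c)\<^sup>2) \<longlongrightarrow> 0) (at c)" by simp
    show "\<forall>\<^sub>F x in at c. (x - c)\<^sup>2 \<noteq> 0" using ne by eventually_elim auto
    show "\<forall>\<^sub>F x in at c. 2 * (x - c) \<noteq> 0" using ne by eventually_elim auto
    show "\<forall>\<^sub>F x in at c. (u has_real_derivative u1 x) (at x)" using u(1) by simp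
    show "\<forall>\<^sub>F x in at c. ((\<lambda>x. (x - c)\<^sup>2) has_real_derivative 2 * (x - c)) (at x)"
      by (intro always_eventually allI) (auto intro!: derivative_eq_intros)
    have "((\<lambda>x. u1 x / (x - c) * (1/2)) \<longlongrightarrow> u2 * (1/2)) (at c)" using l1 by (intro tendsto_intros)
    then show "((\<lambda>x. u1 x / (2 * (x - c))) \<longlongrightarrow> u2 / 2) (at c)" by (simp add: mult.commute)
  qed
  have "((\<lambda>t. (f t / (t - c)) * (u1 t / (t - c)) / (u t / (t - c)\<^sup>2)) \<longlongrightarrow> f1 * u2 / (u2 / 2)) (at c)"
    using 0 by (intro tendsto_intros l1 l2 l3) auto
  moreover have "\<forall>\<^sub>F t in at c. (f t / (t - c)) * (u1 t / (t - c)) / (u t / (t - c)\<^sup>2) = f t * (u1 t / u t)"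
    using ne by eventually_elim (auto simp: power2_eq_square)
  ultimately have "((\<lambda>t. f t * (u1 t / u t)) \<longlongrightarrow> f1 * u2 / (u2 / 2)) (at c)"
    by (rule Lim_transform_eventually)
  moreover have "f1 * u2 / (u2 / 2) = 2 * f1" using 0 by simp
  ultimately show ?thesis by simp
qed

lemma inner_deriv_left:
  assumes "(f has_vector_derivative f') (at t)"
  shows "((\<lambda>t. f t \<bullet> c) has_real_derivative f' \<bullet> c) (at t)"
  using bounded_linear.has_vector_derivative[OF bounded_linear_inner_left assms]
  by (simp add: real_vd_iff)

text \<open>Cramer's rule expands \<open>x\<close> in the frame \<open>a\<close>, \<open>b\<close>,
  \<open>c\<close>; pairing the expansion with \<open>p\<close> gives the identity.\<close>

lemma cramer_dual:
  fixes x p a b c :: "real^3"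
  shows "(x \<bullet> cross3 b c) * (p \<bullet> a) - (x \<bullet> cross3 a c) * (p \<bullet> b) + (x \<bullet> cross3 a b) * (p \<bullet> c)
     = (a \<bullet> cross3 b c) * (x \<bullet> p)"
  by (simp add: cross3_def inner_vec_def sum_3 vector_def algebra_simps)

text \<open>Here \<open>b\<close> stands for the whole coefficient \<alpha>' + \<beta> of
  \<open>y\<close>. The assumption \<open>pos\<close> is global strict convexity: during one period
  the curve stays strictly on one side of its tangent plane at \<open>a\<close>.\<close>

locale unimodular_curve =
  fixes y y1 y2 y3 :: "real \<Rightarrow> real^3" and al al1 b :: "real \<Rightarrow> real" and w :: "real^3"
  assumes dy: "(y has_vector_derivative y1 t) (at t)"
    and dy1: "(y1 has_vector_derivative y2 t) (at t)"
    and dy2: "(y2 has_vector_derivative y3 t) (at t)"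
    and det1: "y2 t \<bullet> cross3 (y1 t) (y t) = 1"
    and ode: "y3 t = - (2 * al t) *\<^sub>R y1 t - b t *\<^sub>R y t"
    and dal: "(al has_real_derivative al1 t) (at t)"
    and cal1: "continuous_on UNIV al1" and cb: "continuous_on UNIV b"
    and per: "y (t + 2 * pi) = y t" "al (t + 2 * pi) = al t" "b (t + 2 * pi) = b t"
    and pos: "a < t \<Longrightarrow> t < a + 2 * pi \<Longrightarrow> y t \<bullet> cross3 (y1 a) (y a) > 0"
    and wpos: "w \<bullet> y t > 0"
begin

text \<open>The dual curve, that is, the covector of the tangent plane along \<open>y t\<close>. The
  next two definitions are its first two derivatives; in the second, y''' is already eliminated by
  the equation.\<close>

definition "P t = cross3 (y1 t) (y t)"
definition "P1 t = cross3 (y2 t) (y t)"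
definition "P2 t = cross3 (y2 t) (y1 t) - (2 * al t) *\<^sub>R P t"

lemma dP: "(P has_vector_derivative P1 t) (at t)"
  unfolding P_def P1_def
  using bounded_bilinear.has_vector_derivative[OF bounded_bilinear_cross3 dy1[of t] dy[of t]]
  by simp

lemma dP1: "(P1 has_vector_derivative P2 t) (at t)"
proof -
  have "cross3 (y2 t) (y1 t) + cross3 (y3 t) (y t) = P2 t"
    unfolding P2_def P_def ode by (simp add: cross3_simps)
  then show ?thesis
    using bounded_bilinear.has_vector_derivative[OF bounded_bilinear_cross3 dy2[of t] dy[of t]]
    unfolding P1_def by simp
qed

lemma y1_per: "y1 (t + 2 * pi) = y1 t"
  using vector_derivative_periodic[OF dy per(1)] .

lemma y2_per: "y2 (t + 2 * pi) = y2 t"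
  using vector_derivative_periodic[OF dy1 y1_per] .

lemma al1_per: "al1 (t + 2 * pi) = al1 t"
  using vector_derivative_periodic[OF dal[unfolded real_vd_iff] per(2)] .

section \<open>Pairings of points with tangent planes and Sturm comparison\<close>

definition "u a t = y t \<bullet> P a"
definition "u1 a t = y1 t \<bullet> P a"
definition "u2 a t = y2 t \<bullet> P a"
definition "u3 a t = y3 t \<bullet> P a"
definition "v a t = y a \<bullet> P t"
definition "v1 a t = y a \<bullet> P1 t"
definition "v2 a t = y a \<bullet> P2 t"

lemma du: "(u a has_real_derivative u1 a t) (at t)"
  and du1: "(u1 a has_real_derivative u2 a t) (at t)"
  and du2: "(u2 a has_real_derivative u3 a t) (at t)"
  unfolding u_def[abs_def] u1_def[abs_def] u2_def[abs_def] u3_def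
  using dy dy1 dy2 by (auto intro: inner_deriv_left)

lemma dv: "(v a has_real_derivative v1 a t) (at t)"
  and dv1: "(v1 a has_real_derivative v2 a t) (at t)"
  unfolding v_def[abs_def] v1_def[abs_def] v2_def
  using inner_deriv_left[OF dP, of "y a" t] inner_deriv_left[OF dP1, of "y a" t] by (simp_all add: inner_commute)

lemma u3_eq: "u3 a t = - 2 * al t * u1 a t - b t * u a t"
  by (simp add: u3_def u1_def u_def ode inner_diff_left)

lemma upos: "a < t \<Longrightarrow> t < a + 2 * pi \<Longrightarrow> u a t > 0"
  unfolding u_def P_def by (rule pos)

lemma vpos: "a < t \<Longrightarrow> t < a + 2 * pi \<Longrightarrow> v a t > 0"
  using pos[of t "a + 2 * pi"] unfolding v_def P_def per by simp

text \<open>This is the incidence of the point \<open>y a\<close> with its tangent line, written in the moving frame at \<open>t\<close>.\<close>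
lemma uv_identity: "v a t * u2 a t + u a t * v2 a t - u1 a t * v1 a t + 2 * al t * u a t * v a t = 0"
proof -
  have v2: "v2 a t = y a \<bullet> cross3 (y2 t) (y1 t) - 2 * al t * v a t"
    unfolding v2_def v_def P2_def by (simp add: inner_diff_right)
  have "y a \<bullet> P a = 0" unfolding P_def by (simp add: dot_cross_self)
  then have "v a t * u2 a t - v1 a t * u1 a t + (y a \<bullet> cross3 (y2 t) (y1 t)) * u a t = 0"
    using cramer_dual[of "y a" "y1 t" "y t" "P a" "y2 t"] det1[of t]
    unfolding u_def u1_def u2_def v1_def v_def P1_def P_def by (simp add: inner_commute)
  then show ?thesis unfolding v2 by (simp add: algebra_simps)
qed

text \<open>The factor 1/2 is the one for which products of two solutions satisfy
  \<open>g''' + 2 al g' + al1 g = 0\<close>, the equation of a conic.\<close>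

definition hill :: "(real \<Rightarrow> real) \<Rightarrow> (real \<Rightarrow> real) \<Rightarrow> bool" where
  "hill f f1 \<longleftrightarrow> (\<forall>t. (f has_real_derivative f1 t) (at t) \<and> (f1 has_real_derivative - (al t / 2) * f t) (at t))"

text \<open>With \<open>V = (u v) powr (1/4)\<close>, this is the Wronskian \<open>f' V - f V'\<close>; the identity above makes \<open>V\<close>
  a supersolution of Hill's equation.\<close>
definition W where
  "W a f f1 t = (u a t * v a t) powr (1/4) * (f1 t - f t * ((u1 a t / u a t + v1 a t / v a t) / 4))"

lemma W_deriv:
  assumes h: "hill f f1" and p: "u a t > 0" "v a t > 0"
  shows "(W a f f1 has_real_derivative
    (u a t * v a t) powr (1/4) * f t * (3/16 * (u1 a t / u a t - v1 a t / v a t)\<^sup>2)) (at t)"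
proof -
  let ?R = "\<lambda>t. (u1 a t / u a t + v1 a t / v a t) / 4"
  let ?V = "\<lambda>t. (u a t * v a t) powr (1/4)"
  let ?r = "(u2 a t / u a t - (u1 a t / u a t)\<^sup>2 + v2 a t / v a t - (v1 a t / v a t)\<^sup>2) / 4"
  have R: "(?R has_real_derivative ?r) (at t)"
    using p du[of a t] du1[of a t] dv[of a t] dv1[of a t]
    by (auto intro!: derivative_eq_intros simp: field_simps power2_eq_square)
  have V: "(?V has_real_derivative ?V t * ?R t) (at t)"
  proof -
    have "((\<lambda>t. u a t * v a t) has_real_derivative u1 a t * v a t + u a t * v1 a t) (at t)"
      using du[of a t] dv[of a t] by (auto intro!: derivative_eq_intros)
    from DERIV_chain2[where f = "\<lambda>z. z powr (1/4)" and g = "\<lambda>t. u a t * v a t", OF has_real_derivative_powr this] p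
    have "(?V has_real_derivative 1/4 * (u a t * v a t) powr (1/4 - 1) * (u1 a t * v a t + u a t * v1 a t)) (at t)"
      by simp
    moreover have "1/4 * (u a t * v a t) powr (1/4 - 1) * (u1 a t * v a t + u a t * v1 a t) = ?V t * ?R t"
      unfolding powr_diff using p by (simp add: field_simps)
    ultimately show ?thesis by simp
  qed
  \<comment> \<open>Since V' = V R, the quantity R' + R^2 is V''/V. Dividing the incidence identity
    by \<open>u v\<close> replaces u''/u + v''/v by first-order terms, and the remainder is a
    perfect square.\<close>
  have req: "?r = - (al t / 2) - (?R t)\<^sup>2 - 3/16 * (u1 a t / u a t - v1 a t / v a t)\<^sup>2"
  proof -
    have "u2 a t / u a t + v2 a t / v a t - (u1 a t / u a t) * (v1 a t / v a t) + 2 * al t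
      = (v a t * u2 a t + u a t * v2 a t - u1 a t * v1 a t + 2 * al t * u a t * v a t) / (u a t * v a t)"
      using p by (simp add: field_simps)
    also have "\<dots> = 0" unfolding uv_identity by simp
    finally have "u2 a t / u a t + v2 a t / v a t - (u1 a t / u a t) * (v1 a t / v a t) + 2 * al t = 0" .
    then have "u2 a t / u a t + v2 a t / v a t = (u1 a t / u a t) * (v1 a t / v a t) - 2 * al t" by simp
    moreover have "(p - r\<^sup>2 + q - s\<^sup>2) / 4 = - (k / 2) - ((r + s) / 4)\<^sup>2 - 3/16 * (r - s)\<^sup>2"
      if "p + q = r * s - 2 * k" for p q r s k :: real
    proof -
      have "p = r * s - 2 * k - q" using that by simp
      then show ?thesis by (simp add: field_simps power2_eq_square)
    qed
    ultimately show ?thesis by blast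
  qed
  have f: "(f has_real_derivative f1 t) (at t)" "(f1 has_real_derivative - (al t / 2) * f t) (at t)"
    using h unfolding hill_def by auto
  have "((\<lambda>t. f1 t - f t * ?R t) has_real_derivative (- (al t / 2) * f t - (f1 t * ?R t + f t * ?r))) (at t)"
    by (rule derivative_eq_intros R f refl)+ simp
  from DERIV_mult[OF V this]
  have "((\<lambda>t. ?V t * (f1 t - f t * ?R t)) has_real_derivative
     ?V t * ?R t * (f1 t - f t * ?R t) + (- (al t / 2) * f t - (f1 t * ?R t + f t * ?r)) * ?V t) (at t)" .
  moreover have "?V t * ?R t * (f1 t - f t * ?R t) + (- (al t / 2) * f t - (f1 t * ?R t + f t * ?r)) * ?V t
     = ?V t * f t * (3/16 * (u1 a t / u a t - v1 a t / v a t)\<^sup>2)"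
  proof -
    have *: "V * R * (g1 - g * R) + (- k * g - (g1 * R + g * (- k - R\<^sup>2 - X))) * V = V * g * X" for V R g1 g k X :: real
      by (simp add: algebra_simps power2_eq_square)
    show ?thesis unfolding req by (rule *)
  qed
  ultimately show ?thesis unfolding W_def[abs_def] by metis
qed

lemma W_mono:
  assumes h: "hill f f1" and st: "a < s" "s \<le> t" "t < a + 2 * pi" and f: "\<And>x. s \<le> x \<Longrightarrow> x \<le> t \<Longrightarrow> f x \<ge> 0"
  shows "W a f f1 s \<le> W a f f1 t"
  using st(2)
proof (rule DERIV_nonneg_imp_nondecreasing)
  fix x assume x: "s \<le> x" "x \<le> t"
  then have "u a x > 0" "v a x > 0" using st upos vpos by auto
  note W_deriv[OF h this]
  moreover have "(u a x * v a x) powr (1/4) * f x * (3/16 * (u1 a x / u a x - v1 a x / v a x)\<^sup>2) \<ge> 0"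
    using f[OF x] by simp
  ultimately show "\<exists>y. (W a f f1 has_real_derivative y) (at x) \<and> 0 \<le> y" by blast
qed

text \<open>At a first zero \<open>b\<close> inside the period the Wronskian \<open>W\<close> would
  be at most 0, while it is positive at \<open>a\<close> and cannot decrease as long as
  \<open>f\<close> stays nonnegative.\<close>

lemma hill_pos:
  assumes h: "hill f f1" and a: "f a = 0" "f1 a > 0" and t: "a < t" "t < a + 2 * pi"
  shows "f t > 0"
proof (rule ccontr)
  assume n: "\<not> f t > 0"
  have df: "(f has_real_derivative f1 x) (at x)" for x using h unfolding hill_def by auto
  have cf: "continuous_on S f" for S
    using df DERIV_isCont continuous_at_imp_continuous_on by blast
  obtain d where d: "d > 0" "\<And>h. 0 < h \<Longrightarrow> h < d \<Longrightarrow> f (a + h) > 0"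
    using DERIV_pos_inc_right[OF df a(2)] a(1) by auto
  define c where "c = a + min (d/2) ((t - a)/2)"
  have c: "a < c" "c < t" "c - a < d" using d t by (auto simp: c_def min_def field_simps)
  let ?Z = "{x \<in> {c..t}. f x = 0}"
  have "f c > 0" using d(2)[of "c - a"] c by simp
  then have "?Z \<noteq> {}" using IVT2'[of f t 0 c] n c cf by force
  moreover have "compact ?Z"
  proof -
    have "closed ({c..t} \<inter> f -` {0})" by (intro continuous_closed_preimage cf) auto
    moreover have "?Z = {c..t} \<inter> ({c..t} \<inter> f -` {0})" by auto
    ultimately show ?thesis by (metis compact_Icc compact_Int_closed)
  qed
  ultimately obtain b where b: "b \<in> ?Z" "\<And>x. x \<in> ?Z \<Longrightarrow> b \<le> x"
    using compact_attains_inf[of ?Z] by blast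
  have fb: "f b = 0" and ab: "a < b" "b \<le> t" using b c by auto
  have fp: "f x > 0" if "a < x" "x < b" for x
  proof (cases "x \<le> c")
    case True
    then show ?thesis using d(2)[of "x - a"] c that by simp
  next
    case False
    show ?thesis
    proof (rule ccontr)
      assume "\<not> f x > 0"
      then obtain x' where "c \<le> x'" "x' \<le> x" "f x' = 0"
        using IVT2'[of f x 0 c] \<open>f c > 0\<close> False cf by force
      then show False using b(2)[of x'] that ab by auto
    qed
  qed
  \<comment> \<open>With base point \<open>a\<close> the comparison function degenerates at
    \<open>a\<close>. As b - a < 2 pi, a period centred at the midpoint of \<open>a\<close> and
    \<open>b\<close> contains both in its interior, where \<open>V\<close> is positive.\<close>
  define a' where "a' = (a + b - 2 * pi) / 2"
  have a': "a' < a" "b < a' + 2 * pi" using ab t by (auto simp: a'_def field_simps)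
  have up: "u a' x * v a' x > 0" if "a \<le> x" "x \<le> b" for x
    using upos[of a' x] vpos[of a' x] a' that by auto
  have "W a' f f1 a \<le> W a' f f1 b"
    using fp fb a a' ab by (intro W_mono[OF h]) (auto simp: order_le_less)
  moreover have "(u a' a * v a' a) powr (1/4) > 0" using up[of a] ab by (metis less_imp_le less_irrefl order_refl powr_gt_zero)
  then have "W a' f f1 a > 0" using a unfolding W_def by simp
  moreover have "f1 b \<le> 0"
  proof (rule ccontr)
    assume "\<not> f1 b \<le> 0"
    then obtain d where d: "d > 0" "\<And>h. 0 < h \<Longrightarrow> h < d \<Longrightarrow> f (b - h) < 0"
      using DERIV_pos_inc_left[OF df, of b] fb by auto
    have "f (b - min (d/2) ((b - a)/2)) < 0" using d ab by (intro d(2)) auto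
    moreover have "f (b - min (d/2) ((b - a)/2)) > 0" using d ab by (intro fp) (auto simp: min_def field_simps)
    ultimately show False by simp
  qed
  then have "W a' f f1 b \<le> 0" unfolding W_def fb by (simp add: mult_nonneg_nonpos)
  ultimately show False by simp
qed

text \<open>At both ends of the period \<open>u\<close> and \<open>v\<close> have double zeros, so
  the power factor tends to 0. The bracket stays bounded, indeed its limit is f' - (2 f' + 2 f')/4 =
  0, because the zero of \<open>f\<close> absorbs the poles.\<close>

lemma W_tendsto_0:
  assumes h: "hill f f1" and c: "c = a \<or> c = a + 2 * pi" and fc: "f c = 0"
  shows "(W a f f1 \<longlongrightarrow> 0) (at c within {a<..<a + 2 * pi})"
proof -
  have df: "(f has_real_derivative f1 x) (at x)" "(f1 has_real_derivative - (al x / 2) * f x) (at x)" for x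
    using h unfolding hill_def by auto
  have ya: "y c = y a" "y1 c = y1 a" "y2 c = y2 a" using c per y1_per y2_per by auto
  have u0: "u a c = 0" "u1 a c = 0" "u2 a c = 1" "v a c = 0" "v1 a c = 0" "v2 a c = 1"
    using det1[of a] dot_cross_self unfolding u_def u1_def u2_def v_def v1_def v2_def P_def P1_def P2_def ya
    by (auto simp: inner_diff_right) (simp add: cross3_simps)
  have l: "((\<lambda>t. f t * (u1 a t / u a t)) \<longlongrightarrow> 2 * f1 c) (at c)" "((\<lambda>t. f t * (v1 a t / v a t)) \<longlongrightarrow> 2 * f1 c) (at c)"
    using tendsto_log_derivative_double_zero[OF du du1 u0(1,2) _ fc df(1)]
          tendsto_log_derivative_double_zero[OF dv dv1 u0(4,5) _ fc df(1)] u0 by auto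
  have f1: "(f1 \<longlongrightarrow> f1 c) (at c)" using DERIV_isCont[OF df(2)] by (simp add: isCont_def)
  have "((\<lambda>t. u a t * v a t) \<longlongrightarrow> u a c * v a c) (at c within {a<..<a + 2 * pi})"
    using DERIV_isCont[OF du] DERIV_isCont[OF dv]
    by (intro tendsto_mult tendsto_within_subset[where S = UNIV and T = "{a<..<a + 2 * pi}"]) (auto simp: isCont_def)
  then have "((\<lambda>t. (u a t * v a t) powr (1/4)) \<longlongrightarrow> (u a c * v a c) powr (1/4)) (at c within {a<..<a + 2 * pi})"
  proof (rule tendsto_powr')
    show "u a c * v a c \<noteq> 0 \<or> 0 < (1/4::real) \<and> (\<forall>\<^sub>F t in at c within {a<..<a + 2 * pi}. 0 \<le> u a t * v a t)"
      using upos vpos by (auto simp: eventually_at_filter less_imp_le)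
  qed auto
  then have V: "((\<lambda>t. (u a t * v a t) powr (1/4)) \<longlongrightarrow> 0) (at c within {a<..<a + 2 * pi})"
    using u0 by simp
  have "((\<lambda>t. f1 t - (f t * (u1 a t / u a t) + f t * (v1 a t / v a t)) / 4) \<longlongrightarrow> f1 c - (2 * f1 c + 2 * f1 c) / 4) (at c)"
    by (intro tendsto_intros f1 l) simp
  then have "((\<lambda>t. f1 t - (f t * (u1 a t / u a t) + f t * (v1 a t / v a t)) / 4) \<longlongrightarrow> f1 c - (2 * f1 c + 2 * f1 c) / 4)
     (at c within {a<..<a + 2 * pi})" by (rule tendsto_within_subset) simp
  from tendsto_mult[OF V this] show ?thesis unfolding W_def[abs_def] by (simp add: algebra_simps)
qed

text \<open>Equality in the comparison forces the curve to be a conic.\<close>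
lemma b_eq_al1_if_hill_two_zeros:
  assumes h: "hill f f1" and a: "f a = 0" "f1 a > 0" "f (a + 2 * pi) = 0"
  shows "b t = al1 t"
proof -
  let ?I = "{a<..<a + 2 * pi}"
  have fp: "f x > 0" if "x \<in> ?I" for x using hill_pos[OF h a(1,2)] that by auto
  have mono: "W a f f1 s \<le> W a f f1 t" if "s \<in> ?I" "t \<in> ?I" "s \<le> t" for s t
    using that fp by (intro W_mono[OF h]) (auto simp: less_imp_le)
  have nt: "at a within ?I \<noteq> bot" "at (a + 2 * pi) within ?I \<noteq> bot"
    by (auto simp: trivial_limit_within islimpt_greaterThanLessThan1 islimpt_greaterThanLessThan2)
  \<comment> \<open>A nondecreasing function with limit 0 at both ends of an interval vanishes on
    it.\<close>
  have W0: "W a f f1 t = 0" if t: "t \<in> ?I" for t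
  proof (rule antisym)
    have "\<forall>\<^sub>F x in at (a + 2 * pi) within ?I. W a f f1 t \<le> W a f f1 x"
      unfolding eventually_at using t mono
      by (intro exI[of _ "a + 2 * pi - t"]) (auto simp: dist_real_def)
    from tendsto_lowerbound[OF W_tendsto_0[OF h _ a(3)] this nt(2)] show "W a f f1 t \<le> 0" by simp
    have "\<forall>\<^sub>F x in at a within ?I. W a f f1 x \<le> W a f f1 t"
      unfolding eventually_at using t mono
      by (intro exI[of _ "t - a"]) (auto simp: dist_real_def)
    from tendsto_upperbound[OF W_tendsto_0[OF h _ a(1)] this nt(1)] show "0 \<le> W a f f1 t" by simp
  qed
  have zero_deriv: "g' = 0" if "(g has_real_derivative g') (at t)" "t \<in> ?I" "\<And>x. x \<in> ?I \<Longrightarrow> g x = 0" for g g' t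
  proof -
    have "((\<lambda>x. 0) has_real_derivative g') (at t)"
      using has_field_derivative_transform_within_open[of g g' t ?I "\<lambda>x. 0"] that by auto
    then show ?thesis using DERIV_unique DERIV_const by blast
  qed
  \<comment> \<open>As \<open>W\<close> vanishes identically, so does the square in its derivative:
    \<open>u\<close> and \<open>v\<close> have the same logarithmic derivative.\<close>
  have X: "v1 a t * u a t - u1 a t * v a t = 0" if t: "t \<in> ?I" for t
  proof -
    have p: "u a t > 0" "v a t > 0" using upos vpos t by auto
    have "(u a t * v a t) powr (1/4) * f t * (3/16 * (u1 a t / u a t - v1 a t / v a t)\<^sup>2) = 0"
      using zero_deriv[OF W_deriv[OF h p] t W0] .
    then have "u1 a t / u a t - v1 a t / v a t = 0" using p fp[OF t] by simp
    then show ?thesis using p by (simp add: field_simps)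
  qed
  have X': "v2 a t * u a t - u2 a t * v a t = 0" if t: "t \<in> ?I" for t
  proof -
    have "((\<lambda>t. v1 a t * u a t - u1 a t * v a t) has_real_derivative
        (v2 a t * u a t + u1 a t * v1 a t) - (u2 a t * v a t + v1 a t * u1 a t)) (at t)"
      by (intro DERIV_diff DERIV_mult dv1 du dv du1)
    from zero_deriv[OF this t X] show ?thesis by simp
  qed
  \<comment> \<open>Substituting proportional \<open>u\<close> and \<open>v\<close> into the
    incidence identity leaves an equation for \<open>u\<close> alone. Its derivative is 2 u times
    the conic equation, and comparison with the equation of the curve yields
    \<open>b\<close>.\<close>
  have E: "2 * u a t * u2 a t - (u1 a t)\<^sup>2 + 2 * al t * (u a t)\<^sup>2 = 0" if t: "t \<in> ?I" for t
  proof -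
    have p: "u a t > 0" "v a t > 0" using upos vpos t by auto
    have "u a t * (v a t * u2 a t + u a t * v2 a t - u1 a t * v1 a t + 2 * al t * u a t * v a t) = 0"
      using uv_identity by simp
    then have "v a t * (2 * u a t * u2 a t - (u1 a t)\<^sup>2 + 2 * al t * (u a t)\<^sup>2) = 0"
      using X[OF t] X'[OF t] by algebra
    then show ?thesis using p by simp
  qed
  have eq: "b t = al1 t" if t: "t \<in> ?I" for t
  proof -
    have p: "u a t > 0" using upos t by auto
    have "((\<lambda>t. 2 * u a t * u2 a t - (u1 a t)\<^sup>2 + 2 * al t * (u a t)\<^sup>2) has_real_derivative
       2 * u a t * (u3 a t + 2 * al t * u1 a t + al1 t * u a t)) (at t)"
      using du[of a t] du1[of a t] du2[of a t] dal[of t]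
      by (auto intro!: derivative_eq_intros simp: algebra_simps power2_eq_square)
    from zero_deriv[OF this t E] have "u3 a t + 2 * al t * u1 a t + al1 t * u a t = 0" using p by simp
    then have "(al1 t - b t) * u a t = 0" unfolding u3_eq by (simp add: algebra_simps)
    then show ?thesis using p by simp
  qed
  have cl: "closed {t. b t = al1 t}"
    using cb cal1 by (intro closed_Collect_eq)
  have "closure ?I \<subseteq> {t. b t = al1 t}" using eq cl by (intro closure_minimal) auto
  moreover have "t \<in> closure ?I" if "a \<le> t" "t < a + 2 * pi" for t using that by simp
  ultimately have eq2: "b t = al1 t" if "a \<le> t" "t < a + 2 * pi" for t using that by blast
  obtain n :: int where "a \<le> t + of_int n * (2 * pi)" "t + of_int n * (2 * pi) < a + 2 * pi"
    using period_representative[of "2 * pi" a t] by auto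
  then show ?thesis using eq2 periodic_int_shift[of b "2 * pi" t n, OF per(3)]
      periodic_int_shift[of al1 "2 * pi" t n, OF al1_per] by metis
qed

section \<open>Monodromy of Hill's equation and the periodic normalizer\<close>

lemma hill_wronskian_const:
  assumes "hill f f1" "hill g g1"
  shows "f t * g1 t - f1 t * g t = f s * g1 s - f1 s * g s"
proof -
  have "((\<lambda>t. f t * g1 t - f1 t * g t) has_real_derivative 0) (at t)" for t
  proof -
    have "(f has_real_derivative f1 t) (at t)" "(f1 has_real_derivative - (al t / 2) * f t) (at t)"
      "(g has_real_derivative g1 t) (at t)" "(g1 has_real_derivative - (al t / 2) * g t) (at t)"
      using assms unfolding hill_def by auto
    then show ?thesis by (auto intro!: derivative_eq_intros simp: algebra_simps)
  qed
  then show ?thesis using DERIV_isconst_all[of "\<lambda>t. f t * g1 t - f1 t * g t" t s] by blast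
qed

text \<open>Let T be the monodromy matrix of Hill's equation. Then \<open>N t\<close> is the signed
  area spanned by the vector (z t, z' t) and its image under T. Hence it is a quadratic form in
  \<open>z\<close> and \<open>z'\<close>, and it is periodic because T has determinant 1.\<close>

lemma exists_periodic_normalizer:
  assumes Ck: "Ck_on m UNIV al" "Ck_on (m + 2) UNIV y"
  obtains N N1 N2 C where "\<And>t. N t > 0" "\<And>t. N (t + 2 * pi) = N t"
    "\<And>t. (N has_real_derivative N1 t) (at t)" "\<And>t. (N1 has_real_derivative N2 t) (at t)"
    "\<And>t. N t * N2 t - (N1 t)\<^sup>2 / 2 + al t * (N t)\<^sup>2 = C" "Ck_on (m + 2) UNIV N"
proof -
  have cal: "continuous_on UNIV al" using dal DERIV_isCont continuous_at_imp_continuous_on by blast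
  obtain lo hi where lh: "\<And>t. al lo \<le> al t" "\<And>t. al t \<le> al hi"
    using periodic_attains_bounds[of al "2 * pi"] per(2) cal by auto
  define A where "A = \<bar>al lo\<bar> + \<bar>al hi\<bar>"
  have A: "\<bar>al t / 2\<bar> \<le> A" for t using lh[of t] unfolding A_def by linarith
  have cal2: "continuous_on UNIV (\<lambda>t. al t / 2)" using cal by (intro continuous_intros) auto
  obtain z p where z: "hill z p" "z 0 = 1" "p 0 = 0"
    using linear_second_order_ode_exists[OF cal2 A, of 1 0] unfolding hill_def by metis
  obtain z' p' where z': "hill z' p'" "z' 0 = 0" "p' 0 = 1"
    using linear_second_order_ode_exists[OF cal2 A, of 0 1] unfolding hill_def by metis
  have wr: "z t * p' t - p t * z' t = 1" for t
    using hill_wronskian_const[OF z(1) z'(1), of t 0] z z' by simp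
  have shift: "hill (\<lambda>t. f (t + 2 * pi)) (\<lambda>t. f1 (t + 2 * pi))" if "hill f f1" for f f1
    unfolding hill_def
  proof (intro allI conjI)
    fix t
    have "(f has_real_derivative f1 (t + 2 * pi)) (at (t + 2 * pi))"
      "(f1 has_real_derivative - (al t / 2) * f (t + 2 * pi)) (at (t + 2 * pi))"
      using that per(2)[of t] unfolding hill_def by metis+
    then show "((\<lambda>t. f (t + 2 * pi)) has_real_derivative f1 (t + 2 * pi)) (at t)"
      "((\<lambda>t. f1 (t + 2 * pi)) has_real_derivative - (al t / 2) * f (t + 2 * pi)) (at t)"
      by (simp_all add: DERIV_shift)
  qed
  have repr: "\<exists>c d. \<forall>t. f t = c * z t + d * z' t" if "hill f f1" for f f1
  proof -
    have "f t = (f 0 * p' 0 - f1 0 * z' 0) * z t + - (f 0 * p 0 - f1 0 * z 0) * z' t" for t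
    proof -
      have "f t = (f t * p' t - f1 t * z' t) * z t + - (f t * p t - f1 t * z t) * z' t"
        using wr[of t] by algebra
      then show ?thesis
        using hill_wronskian_const[OF that z(1), of t 0] hill_wronskian_const[OF that z'(1), of t 0] by simp
    qed
    then show ?thesis by blast
  qed
  obtain ca cb where abq: "\<And>t. z (t + 2 * pi) = ca * z t + cb * z' t" using repr[OF shift[OF z(1)]] by auto
  obtain cc cd where cdq: "\<And>t. z' (t + 2 * pi) = cc * z t + cd * z' t" using repr[OF shift[OF z'(1)]] by auto
  define N where "N t = z t * z' (t + 2 * pi) - z (t + 2 * pi) * z' t" for t
  have f: "hill (\<lambda>t. z s * z' t - z' s * z t) (\<lambda>t. z s * p' t - z' s * p t)" for s
    using z(1) z'(1) unfolding hill_def by (auto intro!: derivative_eq_intros simp: algebra_simps)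
  have fs: "z s * p' s - z' s * p s > 0" for s using wr[of s] by (simp add: algebra_simps)
  \<comment> \<open>Positivity holds strictly before one full period; at the end point itself only
    the closed inequality passes to the limit.\<close>
  have Nnn: "N s \<ge> 0" for s
  proof -
    let ?f = "\<lambda>t. z s * z' t - z' s * z t"
    have fp: "?f t > 0" if "s < t" "t < s + 2 * pi" for t
      using hill_pos[OF f _ fs that] by simp
    have "continuous_on UNIV ?f"
      using f[of s] DERIV_isCont unfolding hill_def by (intro continuous_at_imp_continuous_on ballI) blast
    then have "closed {t. 0 \<le> ?f t}" by (intro closed_Collect_le) (auto intro: continuous_intros)
    then have "closure {s<..<s + 2 * pi} \<subseteq> {t. 0 \<le> ?f t}"
      using fp by (intro closure_minimal) (auto simp: less_imp_le)
    moreover have "s + 2 * pi \<in> closure {s<..<s + 2 * pi}" by simp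
    ultimately have "?f (s + 2 * pi) \<ge> 0" by blast
    then show ?thesis by (simp add: N_def algebra_simps)
  qed
  show thesis
  proof (cases "\<exists>s. N s = 0")
    case True
    then obtain s where "N s = 0" by blast
    then have "z s * z' (s + 2 * pi) - z' s * z (s + 2 * pi) = 0" by (simp add: N_def algebra_simps)
    from b_eq_al1_if_hill_two_zeros[OF f _ fs this] have beq: "b t = al1 t" for t by simp
    \<comment> \<open>With h = y \<bullet> w, the derivative of this expression is h (h''' + 2 al h'
      + al1 h), which vanishes because the curve now satisfies the conic equation.\<close>
    let ?E = "\<lambda>t. (y t \<bullet> w) * (y2 t \<bullet> w) - (y1 t \<bullet> w)\<^sup>2 / 2 + al t * (y t \<bullet> w)\<^sup>2"
    have "(?E has_real_derivative 0) (at t)" for t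
    proof -
      have y3: "y3 t \<bullet> w = - (2 * al t) * (y1 t \<bullet> w) - al1 t * (y t \<bullet> w)"
        unfolding ode beq by (simp add: inner_diff_left)
      show ?thesis
        using inner_deriv_left[OF dy[of t], of w] inner_deriv_left[OF dy1[of t], of w]
          inner_deriv_left[OF dy2[of t], of w] dal[of t] y3
        by (auto intro!: derivative_eq_intros simp: algebra_simps power2_eq_square)
    qed
    then have E: "?E t = ?E 0" for t using DERIV_isconst_all[of ?E t 0] by blast
    show thesis
    proof (rule that[of "\<lambda>t. y t \<bullet> w" "\<lambda>t. y1 t \<bullet> w" "\<lambda>t. y2 t \<bullet> w" "?E 0"])
      show "Ck_on (m + 2) UNIV (\<lambda>t. y t \<bullet> w)" using Ck by (intro Ck_on_inner Ck_on_const)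
    qed (use wpos per(1) inner_deriv_left[OF dy] inner_deriv_left[OF dy1] E in \<open>auto simp: inner_commute\<close>)
  next
    case False
    then have Np: "N t > 0" for t using Nnn[of t] by (metis order_le_less)
    have dz: "(z has_real_derivative p t) (at t)" "(p has_real_derivative - (al t / 2) * z t) (at t)"
      "(z' has_real_derivative p' t) (at t)" "(p' has_real_derivative - (al t / 2) * z' t) (at t)" for t
      using z(1) z'(1) unfolding hill_def by auto
    have Neq: "N = (\<lambda>t. cc * (z t)\<^sup>2 + (cd - ca) * z t * z' t - cb * (z' t)\<^sup>2)"
      unfolding N_def[abs_def] abq cdq by (rule ext) (simp add: algebra_simps power2_eq_square)
    \<comment> \<open>The determinant of the monodromy matrix is the Wronskian after one period,
      which equals its initial value 1.\<close>
    have det: "ca * cd - cb * cc = 1"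
    proof -
      have "((\<lambda>t. z (t + 2 * pi)) has_real_derivative p (0 + 2 * pi)) (at 0)"
        "((\<lambda>t. z' (t + 2 * pi)) has_real_derivative p' (0 + 2 * pi)) (at 0)"
        using shift[OF z(1)] shift[OF z'(1)] unfolding hill_def by blast+
      moreover have "((\<lambda>t. ca * z t + cb * z' t) has_real_derivative ca * p 0 + cb * p' 0) (at 0)"
        "((\<lambda>t. cc * z t + cd * z' t) has_real_derivative cc * p 0 + cd * p' 0) (at 0)"
        using dz[of 0] by (auto intro!: derivative_eq_intros)
      ultimately have "p (2 * pi) = cb" "p' (2 * pi) = cd"
        unfolding abq cdq using z z' DERIV_unique by fastforce+
      then show ?thesis using abq[of 0] cdq[of 0] wr[of "2 * pi"] z z' by simp
    qed
    have Ckz: "Ck_on (m + 2) UNIV z" "Ck_on (m + 2) UNIV z'"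
    proof -
      have "Ck_on m UNIV (\<lambda>t. - (al t / 2))"
        using Ck(1) by (intro Ck_on_minus Ck_on_divide Ck_on_const) auto
      then show "Ck_on (m + 2) UNIV z" "Ck_on (m + 2) UNIV z'"
        using Ck_on_second_order_ode[of z p "\<lambda>t. - (al t / 2)", OF dz(1,2)]
          Ck_on_second_order_ode[of z' p' "\<lambda>t. - (al t / 2)", OF dz(3,4)] by auto
    qed
    define N1 where "N1 t = 2 * cc * z t * p t + (cd - ca) * (p t * z' t + z t * p' t) - 2 * cb * z' t * p' t" for t
    define N2 where "N2 t = 2 * cc * ((p t)\<^sup>2 - al t / 2 * (z t)\<^sup>2) + (cd - ca) * (2 * p t * p' t - al t * z t * z' t)
             - 2 * cb * ((p' t)\<^sup>2 - al t / 2 * (z' t)\<^sup>2)" for t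
    show thesis
    \<comment> \<open>For a quadratic form in two Hill solutions the first integral is minus half
      its discriminant times the squared Wronskian. In terms of the monodromy trace tr this constant
      is 2 - tr^2 / 2.\<close>
    proof (rule that[of N N1 N2 "- 2 * cb * cc - (cd - ca)\<^sup>2 / 2"])
      fix t
      show "N t > 0" by (rule Np)
      show "N (t + 2 * pi) = N t" unfolding Neq abq cdq using det by algebra
      show "(N has_real_derivative N1 t) (at t)"
        unfolding Neq N1_def using dz[of t] by (auto intro!: derivative_eq_intros simp: algebra_simps power2_eq_square)
      show "(N1 has_real_derivative N2 t) (at t)"
        unfolding N1_def[abs_def] N2_def using dz[of t]
        by (auto intro!: derivative_eq_intros simp: algebra_simps power2_eq_square)
      show "N t * N2 t - (N1 t)\<^sup>2 / 2 + al t * (N t)\<^sup>2 = - 2 * cb * cc - (cd - ca)\<^sup>2 / 2"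
      proof -
        have "(k * x\<^sup>2 + l * x * x' - m * x'\<^sup>2) * (2 * k * (p\<^sup>2 - r / 2 * x\<^sup>2) + l * (2 * p * p' - r * x * x') - 2 * m * (p'\<^sup>2 - r / 2 * x'\<^sup>2))
          - (2 * k * x * p + l * (p * x' + x * p') - 2 * m * x' * p')\<^sup>2 / 2 + r * (k * x\<^sup>2 + l * x * x' - m * x'\<^sup>2)\<^sup>2
          = (- 2 * m * k - l\<^sup>2 / 2) * (x * p' - p * x')\<^sup>2" for k l m x x' p p' r :: real
          by (simp add: field_simps power2_eq_square)
        then have "N t * N2 t - (N1 t)\<^sup>2 / 2 + al t * (N t)\<^sup>2
          = (- 2 * cb * cc - (cd - ca)\<^sup>2 / 2) * (z t * p' t - p t * z' t)\<^sup>2"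
          unfolding Neq N1_def N2_def by blast
        then show ?thesis using wr[of t] by simp
      qed
      show "Ck_on (m + 2) UNIV N"
        unfolding Neq power2_eq_square by (intro Ck_on_add Ck_on_diff Ck_on_mult Ck_on_const Ckz)
    qed
  qed
qed

end

section \<open>Polar parametrization of the boundary of a cone\<close>

text \<open>Implicit differentiation under weak hypotheses: \<open>g\<close> is differentiable at
  one point only, and \<open>r\<close> is known in advance to be continuous there. A slope function
  in the sense of Caratheodory takes the place of continuous differentiability.\<close>

lemma implicit_ray_derivative:
  fixes g :: "'a::euclidean_space \<Rightarrow> real"
  assumes g: "(g has_derivative g') (at (e + r t *\<^sub>R d t))" and r: "isCont r t"
    and d: "(d has_vector_derivative d') (at t)"
    and ev: "\<forall>\<^sub>F s in at t. g (e + r s *\<^sub>R d s) = g (e + r t *\<^sub>R d t)"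
    and nz: "g' (d t) \<noteq> 0"
  shows "(r has_real_derivative - (r t * g' d' / g' (d t))) (at t)"
proof -
  define x0 where "x0 = e + r t *\<^sub>R d t"
  define n where "n = (\<Sum>b\<in>Basis. g' b *\<^sub>R b)"
  have lin: "linear g'" using g has_derivative_linear by blast
  have n: "g' v = n \<bullet> v" for v
  proof -
    have "g' v = g' (\<Sum>b\<in>Basis. (v \<bullet> b) *\<^sub>R b)" by (simp add: euclidean_representation)
    also have "\<dots> = (\<Sum>b\<in>Basis. (v \<bullet> b) * g' b)" using lin by (simp add: linear_sum linear_scale)
    also have "\<dots> = n \<bullet> v" unfolding n_def by (auto simp: inner_sum_left inner_commute[of v] mult.commute intro!: sum.cong)
    finally show ?thesis .
  qed
  \<comment> \<open>The gradient \<open>n\<close> is corrected along x - x0 so that the increment of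
    \<open>g\<close> becomes exactly an inner product; differentiability of \<open>g\<close> says
    that the correction tends to 0.\<close>
  define \<psi> where "\<psi> x = n + ((g x - g x0 - g' (x - x0)) / (norm (x - x0))\<^sup>2) *\<^sub>R (x - x0)" for x
  have psi: "g x - g x0 = \<psi> x \<bullet> (x - x0)" for x
    by (cases "x = x0") (simp_all add: \<psi>_def inner_add_left n dot_square_norm)
  have "((\<lambda>x. norm ((g x - g x0 - g' (x - x0)) /\<^sub>R norm (x - x0))) \<longlongrightarrow> 0) (at x0)"
    using g unfolding x0_def[symmetric] has_derivative_at_within by (intro tendsto_norm_zero) simp
  moreover have "norm ((g x - g x0 - g' (x - x0)) /\<^sub>R norm (x - x0)) = norm (\<psi> x - n)" for x
    by (cases "x = x0") (simp_all add: \<psi>_def power2_eq_square abs_mult divide_inverse mult.commute)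
  ultimately have "((\<lambda>x. norm (\<psi> x - n)) \<longlongrightarrow> 0) (at x0)" by simp
  then have "(\<psi> \<longlongrightarrow> n) (at x0)" using LIM_zero_cancel tendsto_norm_zero_iff by blast
  then have cpsi: "isCont \<psi> x0" unfolding isCont_def by (simp add: \<psi>_def)
  have cd: "isCont d t" using d has_vector_derivative_continuous by blast
  let ?\<psi> = "\<lambda>s. \<psi> (e + r s *\<^sub>R d s)"
  have "isCont (\<lambda>s. e + r s *\<^sub>R d s) t" using r cd by (intro continuous_intros)
  then have "isCont (\<lambda>s. ?\<psi> s) t"
    using cpsi unfolding x0_def by (rule isCont_o2)
  then have l1: "((\<lambda>s. ?\<psi> s) \<longlongrightarrow> n) (at t)"
    unfolding isCont_def x0_def[symmetric] by (simp add: \<psi>_def)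
  have l2: "((\<lambda>s. (d s - d t) /\<^sub>R (s - t)) \<longlongrightarrow> d') (at t)"
  proof -
    have "((\<lambda>s. norm (d s - d t - (s - t) *\<^sub>R d') / norm (s - t)) \<longlongrightarrow> 0) (at t)"
      using d unfolding has_vector_derivative_def has_derivative_iff_norm by simp
    moreover have "\<forall>\<^sub>F s in at t. norm (d s - d t - (s - t) *\<^sub>R d') / norm (s - t) = norm ((d s - d t) /\<^sub>R (s - t) - d')"
    proof -
      have "norm (d s - d t - (s - t) *\<^sub>R d') / norm (s - t) = norm ((d s - d t) /\<^sub>R (s - t) - d')" if "s \<noteq> t" for s
      proof -
        have "(d s - d t) /\<^sub>R (s - t) - d' = (d s - d t - (s - t) *\<^sub>R d') /\<^sub>R (s - t)"
          using that by (simp add: scaleR_diff_right)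
        then show ?thesis by (simp add: divide_inverse_commute)
      qed
      then show ?thesis by (simp add: eventually_at_filter)
    qed
    ultimately have "((\<lambda>s. norm ((d s - d t) /\<^sub>R (s - t) - d')) \<longlongrightarrow> 0) (at t)"
      by (rule Lim_transform_eventually)
    then show ?thesis using LIM_zero_cancel tendsto_norm_zero_iff by blast
  qed
  have l3: "(d \<longlongrightarrow> d t) (at t)" using cd by (simp add: isCont_def)
  have l4: "((\<lambda>s. ?\<psi> s \<bullet> d s) \<longlongrightarrow> n \<bullet> d t) (at t)" by (intro tendsto_intros l1 l3)
  \<comment> \<open>The difference quotient of \<open>r\<close>, solved from the vanishing increment
    of \<open>g\<close> along (r s - r t) d s + r t (d s - d t).\<close>
  let ?q = "\<lambda>s. - (r t * (?\<psi> s \<bullet> ((d s - d t) /\<^sub>R (s - t))) / (?\<psi> s \<bullet> d s))"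
  have "(?q
     \<longlongrightarrow> - (r t * (n \<bullet> d') / (n \<bullet> d t))) (at t)"
    using nz by (intro tendsto_intros l1 l2 l4) (simp add: n)
  moreover have "\<forall>\<^sub>F s in at t. ?q s
     = (r s - r t) / (s - t)"
  proof -
    have "\<forall>\<^sub>F s in at t. ?\<psi> s \<bullet> d s \<noteq> 0"
      using tendsto_imp_eventually_ne[OF l4] nz by (simp add: n)
    moreover have "\<forall>\<^sub>F s in at t. s \<noteq> t" by (simp add: eventually_at_filter)
    ultimately show ?thesis using ev
    proof eventually_elim
      case (elim s)
      let ?p = "?\<psi> s"
      have "0 = ?p \<bullet> (e + r s *\<^sub>R d s - x0)" using psi[of "e + r s *\<^sub>R d s"] elim(3) by (simp add: x0_def)
      also have "e + r s *\<^sub>R d s - x0 = (r s - r t) *\<^sub>R d s + r t *\<^sub>R (d s - d t)"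
        by (simp add: x0_def algebra_simps)
      finally have "(r s - r t) * (?p \<bullet> d s) = - (r t * (?p \<bullet> (d s - d t)))"
        by (simp add: inner_add_right)
      moreover have "?p \<bullet> ((d s - d t) /\<^sub>R (s - t)) = (?p \<bullet> (d s - d t)) / (s - t)"
        by (simp add: divide_inverse_commute)
      moreover have "- (a * (B / q) / A) = (b - a) / q" if "(b - a) * A = - (a * B)" "A \<noteq> 0" "q \<noteq> 0" for a b A B q :: real
      proof -
        have "- (a * (B / q) / A) = - (a * B) / (A * q)" by simp
        also have "\<dots> = (b - a) / q" unfolding that(1)[symmetric] using that(2) by simp
        finally show ?thesis .
      qed
      ultimately show ?case using elim by simp
    qed
  qed
  ultimately show ?thesis unfolding n has_field_derivative_iff by (rule Lim_transform_eventually)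
qed

text \<open>\<open>H v\<close> is given only as a derivative for each fixed \<open>v\<close>.
  Expansion in a basis reduces the moving argument \<open>V s\<close> to finitely many fixed ones
  and shows at the same time that \<open>H\<close> is linear in \<open>v\<close>.\<close>

lemma derivative_pairing:
  fixes c V :: "real \<Rightarrow> 'a::euclidean_space" and D H :: "'a \<Rightarrow> 'a \<Rightarrow> real"
  assumes U: "open U" "c t \<in> U" and lin: "\<And>x. x \<in> U \<Longrightarrow> linear (D x)"
    and H: "\<And>v. ((\<lambda>x. D x v) has_derivative H v) (at (c t))"
    and c: "(c has_vector_derivative c1) (at t)" and V: "(V has_vector_derivative V1) (at t)"
  shows "((\<lambda>s. D (c s) (V s)) has_real_derivative H (V t) c1 + D (c t) V1) (at t)"
proof -
  have expand: "D x v = (\<Sum>b\<in>Basis. (v \<bullet> b) * D x b)" if "x \<in> U" for x v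
  proof -
    have "D x v = D x (\<Sum>b\<in>Basis. (v \<bullet> b) *\<^sub>R b)" by (simp add: euclidean_representation)
    then show ?thesis using lin[OF that] by (simp add: linear_sum linear_scale)
  qed
  have HV: "H v w = (\<Sum>b\<in>Basis. (v \<bullet> b) * H b w)" for v w
  proof -
    have "((\<lambda>x. \<Sum>b\<in>Basis. (v \<bullet> b) * D x b) has_derivative (\<lambda>w. \<Sum>b\<in>Basis. (v \<bullet> b) * H b w)) (at (c t))"
      by (intro has_derivative_sum has_derivative_mult_right H)
    then have "((\<lambda>x. D x v) has_derivative (\<lambda>w. \<Sum>b\<in>Basis. (v \<bullet> b) * H b w)) (at (c t))"
      using has_derivative_transform_within_open[of _ _ _ UNIV U "\<lambda>x. D x v"] U expand by auto
    then show ?thesis using has_derivative_unique[OF H[of v]] by metis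
  qed
  have b: "((\<lambda>s. (V s \<bullet> b) * D (c s) b) has_real_derivative (V t \<bullet> b) * H b c1 + (V1 \<bullet> b) * D (c t) b) (at t)" for b
  proof -
    have "((\<lambda>s. V s \<bullet> b) has_real_derivative V1 \<bullet> b) (at t)"
      using bounded_linear.has_vector_derivative[OF bounded_linear_inner_left V]
      by (simp add: real_vd_iff)
    moreover have "((\<lambda>s. D (c s) b) has_real_derivative H b c1) (at t)"
      using vector_derivative_diff_chain_within[of c c1 t UNIV "\<lambda>x. D x b" "H b"] c H
      by (auto simp: o_def real_vd_iff intro: has_derivative_at_withinI)
    ultimately show ?thesis by (auto intro!: derivative_eq_intros)
  qed
  have "((\<lambda>s. \<Sum>b\<in>Basis. (V s \<bullet> b) * D (c s) b) has_real_derivative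
     (\<Sum>b\<in>Basis. (V t \<bullet> b) * H b c1 + (V1 \<bullet> b) * D (c t) b)) (at t)"
    by (intro DERIV_sum b)
  also have "(\<Sum>b\<in>Basis. (V t \<bullet> b) * H b c1 + (V1 \<bullet> b) * D (c t) b) = H (V t) c1 + D (c t) V1"
    using expand[OF U(2), of V1] HV[of "V t" c1] by (simp add: sum.distrib)
  finally have s: "((\<lambda>s. \<Sum>b\<in>Basis. (V s \<bullet> b) * D (c s) b) has_real_derivative H (V t) c1 + D (c t) V1) (at t)" .
  have "\<forall>\<^sub>F s in nhds t. c s \<in> U"
  proof -
    have "isCont c t" using c has_vector_derivative_continuous by blast
    then show ?thesis using U topological_tendstoD[of c "c t" "nhds t" U] by (simp add: isCont_def tendsto_at_iff_tendsto_nhds)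
  qed
  then have "\<forall>\<^sub>F s in nhds t. (\<Sum>b\<in>Basis. (V s \<bullet> b) * D (c s) b) = D (c s) (V s)"
    by eventually_elim (rule expand[symmetric])
  from DERIV_cong_ev[OF refl this refl] s show ?thesis by blast
qed

lemma cramer3:
  fixes v a b c :: "real^3"
  shows "(a \<bullet> cross3 b c) *\<^sub>R v = (v \<bullet> cross3 b c) *\<^sub>R a + (a \<bullet> cross3 v c) *\<^sub>R b + (a \<bullet> cross3 b v) *\<^sub>R c"
  by (simp add: cross3_def inner_vec_def sum_3 vector_def vec_eq_iff forall_3 algebra_simps)

text \<open>The last conclusion fixes the orientation: going round with increasing angle from
  \<open>e1\<close> to \<open>e2\<close> must give det(Y'', Y', Y) a positive sign.\<close>

lemma orthonormal_completion3:
  fixes w :: "real^3"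
  assumes "w \<noteq> 0"
  obtains e1 e2 where "norm e1 = 1" "norm e2 = 1" "e1 \<bullet> e2 = 0" "w \<bullet> e1 = 0" "w \<bullet> e2 = 0"
    "\<And>v. w \<bullet> v = 0 \<Longrightarrow> v = (v \<bullet> e1) *\<^sub>R e1 + (v \<bullet> e2) *\<^sub>R e2"
    "cross3 e2 e1 = (1 / norm w) *\<^sub>R w"
proof -
  obtain f where f: "f \<noteq> 0" "orthogonal w f"
    using cross_basis_nonzero[OF assms] unfolding orthogonal_def by (metis dot_cross_self(1))
  define e1 where "e1 = (1 / norm f) *\<^sub>R f"
  define n where "n = (1 / norm w) *\<^sub>R w"
  define e2 where "e2 = cross3 e1 n"
  have nn: "norm n = 1" "norm e1 = 1" using f assms by (auto simp: n_def e1_def)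
  have o: "n \<bullet> e1 = 0" using f by (simp add: n_def e1_def orthogonal_def)
  have e2: "norm e2 = 1"
    using norm_cross_dot[of e1 n] nn o norm_ge_zero[of "cross3 e1 n"]
    by (auto simp: e2_def inner_commute power2_eq_1_iff simp del: norm_ge_zero)
  have o2: "e1 \<bullet> e2 = 0" "n \<bullet> e2 = 0" by (auto simp: e2_def dot_cross_self)
  have "cross3 e2 e1 = (e1 \<bullet> e1) *\<^sub>R n - (n \<bullet> e1) *\<^sub>R e1"
    unfolding e2_def by (simp add: cross3_simps forall_3)
  then have cr: "cross3 e2 e1 = n" using o nn by (simp add: dot_square_norm)
  have rep: "v = (v \<bullet> e1) *\<^sub>R e1 + (v \<bullet> e2) *\<^sub>R e2" if v: "w \<bullet> v = 0" for v
  proof -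
    define z where "z = v - (v \<bullet> e1) *\<^sub>R e1 - (v \<bullet> e2) *\<^sub>R e2"
    have nv: "n \<bullet> v = 0" using v by (simp add: n_def)
    have z: "z \<bullet> e1 = 0" "z \<bullet> e2 = 0" "z \<bullet> n = 0"
    proof -
      have "e1 \<bullet> e1 = 1" "e2 \<bullet> e2 = 1" using nn e2 by (simp_all add: dot_square_norm)
      moreover have "e2 \<bullet> e1 = 0" "e1 \<bullet> n = 0" "e2 \<bullet> n = 0" "v \<bullet> n = 0" using o o2 nv by (simp_all add: inner_commute)
      ultimately show "z \<bullet> e1 = 0" "z \<bullet> e2 = 0" "z \<bullet> n = 0" using o2 by (simp_all add: z_def inner_diff_left)
    qed
    have "cross3 z e2 = (z \<bullet> n) *\<^sub>R e1 - (z \<bullet> e1) *\<^sub>R n"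
      unfolding e2_def by (simp add: cross3_simps forall_3)
    then have "(norm (cross3 z e2))\<^sup>2 + (z \<bullet> e2)\<^sup>2 = 0" using z by simp
    then have "norm z = 0" using norm_cross_dot[of z e2] e2 by simp
    then show ?thesis by (simp add: z_def algebra_simps)
  qed
  show thesis
    using that[of e1 e2] nn e2 o o2 rep cr assms by (simp add: n_def)
qed

lemma cone_interior_scale:
  fixes K :: "'a::real_normed_vector set"
  assumes "cone K" "x \<in> interior K" "c > 0"
  shows "c *\<^sub>R x \<in> interior K"
proof (rule interiorI)
  show "open ((*\<^sub>R) c ` interior K)" using assms by (intro open_scaling) auto
  show "c *\<^sub>R x \<in> (*\<^sub>R) c ` interior K" using assms by auto
  show "(*\<^sub>R) c ` interior K \<subseteq> K"
    using assms interior_subset[of K] by (auto simp: cone_def)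
qed

text \<open>Since \<open>K\<close> contains no line, 0 is not a convex combination of unit vectors
  of \<open>K\<close>. Separating 0 from their compact convex hull gives the bound on unit vectors,
  and homogeneity does the rest.\<close>

lemma regular_convex_cone_functional:
  assumes "regular_convex_cone K"
  obtains w c where "c > 0" "\<And>x. x \<in> K \<Longrightarrow> c * norm x \<le> w \<bullet> x"
proof -
  have K: "closed K" "convex K" "cone K" using assms by (auto simp: regular_convex_cone_def)
  have line: False if "x \<in> K" "- x \<in> K" "x \<noteq> 0" for x
  proof -
    have "0 + s *\<^sub>R x \<in> K" for s
    proof (cases "s \<ge> 0")
      case True
      then show ?thesis using K(3) that by (simp add: cone_def)
    next
      case False
      then have "(- s) *\<^sub>R (- x) \<in> K" using K(3) that unfolding cone_def by (metis neg_0_le_iff_le linear)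
      then show ?thesis by simp
    qed
    then show False using assms that unfolding regular_convex_cone_def by metis
  qed
  \<comment> \<open>A nontrivial convex combination equal to 0 would put a nonzero vector and its
    opposite into \<open>K\<close>, hence a line.\<close>
  have "convex (K - {0})"
    unfolding convex_def
  proof (intro ballI allI impI)
    fix x y and u v :: real
    assume x: "x \<in> K - {0}" and y: "y \<in> K - {0}" and uv: "0 \<le> u" "0 \<le> v" "u + v = 1"
    have in_K: "u *\<^sub>R x + v *\<^sub>R y \<in> K" using K(2) x y uv unfolding convex_def by auto
    have "u *\<^sub>R x + v *\<^sub>R y \<noteq> 0"
    proof
      assume s: "u *\<^sub>R x + v *\<^sub>R y = 0"
      then have "u *\<^sub>R x = - (v *\<^sub>R y)" by (simp add: add_eq_0_iff2)
      moreover have "u *\<^sub>R x \<in> K" "v *\<^sub>R y \<in> K" using K(3) x y uv by (auto simp: cone_def)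
      ultimately have "v *\<^sub>R y = 0" using line[of "v *\<^sub>R y"] by auto
      then have "v = 0" using y by simp
      then show False using s uv x by simp
    qed
    then show "u *\<^sub>R x + v *\<^sub>R y \<in> K - {0}" using in_K by simp
  qed
  moreover have "K \<inter> sphere 0 1 \<subseteq> K - {0}" by auto
  ultimately have "convex hull (K \<inter> sphere 0 1) \<subseteq> K - {0}" by (rule hull_minimal[rotated])
  then have "0 \<notin> convex hull (K \<inter> sphere 0 1)" by auto
  moreover have "compact (convex hull (K \<inter> sphere 0 1))"
    using K(1) by (intro compact_convex_hull closed_Int_compact) auto
  ultimately obtain w c where wc: "0 < c" "\<forall>x \<in> convex hull (K \<inter> sphere 0 1). w \<bullet> x > c"
    using separating_hyperplane_closed_0[of "convex hull (K \<inter> sphere 0 1)"] compact_imp_closed convex_convex_hull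
    by (metis (no_types, lifting))
  show thesis
  proof (rule that[OF wc(1)])
    fix x assume x: "x \<in> K"
    show "c * norm x \<le> w \<bullet> x"
    proof (cases "x = 0")
      case False
      have "(1 / norm x) *\<^sub>R x \<in> K" using x K(3) by (simp add: cone_def)
      then have "(1 / norm x) *\<^sub>R x \<in> convex hull (K \<inter> sphere 0 1)"
        using False by (intro hull_inc) auto
      then have "w \<bullet> ((1 / norm x) *\<^sub>R x) > c" using wc by blast
      then show ?thesis using False by (simp add: field_simps)
    qed simp
  qed
qed

text \<open>The affine plane \<open>w \<bullet> x = 1\<close> cuts \<open>K\<close> in a convex
  section that is bounded by \<open>cbound\<close>; \<open>e\<close> is the pole of polar
  coordinates in it and \<open>e1\<close>, \<open>e2\<close> span its directions.\<close>

locale cone_chart =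
  fixes K :: "(real^3) set" and k :: nat and w e e1 e2 :: "real^3" and c :: real
  assumes closedK: "closed K" and convexK: "convex K" and coneK: "cone K"
    and bdry: "boundary_Ck_pos_curved k K" and k2: "k \<ge> 2"
    and eint: "e \<in> interior K" and we: "w \<bullet> e = 1"
    and cpos: "c > 0" and cbound: "x \<in> K \<Longrightarrow> c * norm x \<le> w \<bullet> x"
    and onb: "norm e1 = 1" "norm e2 = 1" "e1 \<bullet> e2 = 0" "w \<bullet> e1 = 0" "w \<bullet> e2 = 0"
    and span: "w \<bullet> v = 0 \<Longrightarrow> v = (v \<bullet> e1) *\<^sub>R e1 + (v \<bullet> e2) *\<^sub>R e2"
    and orient: "e \<bullet> cross3 e2 e1 > 0"
begin

section \<open>Radial parametrization in the affine chart\<close>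

definition "d t = cos t *\<^sub>R e1 + sin t *\<^sub>R e2"
definition "d1 t = - sin t *\<^sub>R e1 + cos t *\<^sub>R e2"
definition "rad t = Sup {r. 0 \<le> r \<and> e + r *\<^sub>R d t \<in> K}"
definition "Y t = e + rad t *\<^sub>R d t"

lemma d_deriv: "(d has_vector_derivative d1 t) (at t)"
proof -
  have "((\<lambda>t. cos t *\<^sub>R e1 + sin t *\<^sub>R e2) has_vector_derivative (cos t *\<^sub>R 0 + (- sin t) *\<^sub>R e1) + (sin t *\<^sub>R 0 + cos t *\<^sub>R e2)) (at t)"
    by (intro has_vector_derivative_add has_vector_derivative_scaleR has_vector_derivative_const DERIV_cos DERIV_sin)
  then show ?thesis by (simp add: d_def[abs_def] d1_def)
qed

lemma d_cont: "continuous_on UNIV d" "isCont d t"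
  using d_deriv has_vector_derivative_continuous continuous_at_imp_continuous_on by blast+

lemma d_inner: "d t \<bullet> e1 = cos t" "d t \<bullet> e2 = sin t" "w \<bullet> d t = 0"
  using onb by (simp_all add: d_def inner_add_left inner_add_right dot_square_norm inner_commute)

lemma norm_d: "norm (d t) = 1"
proof -
  have "d t \<bullet> d t = cos t * (d t \<bullet> e1) + sin t * (d t \<bullet> e2)"
    by (metis d_def inner_add_right inner_scaleR_right)
  also have "\<dots> = 1" using d_inner by (simp add: power2_eq_square[symmetric])
  finally show ?thesis by (simp add: norm_eq_sqrt_inner)
qed

lemma rad_bdd: "bdd_above {r. 0 \<le> r \<and> e + r *\<^sub>R d t \<in> K}"
proof (rule bdd_aboveI)
  fix r assume "r \<in> {r. 0 \<le> r \<and> e + r *\<^sub>R d t \<in> K}"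
  then have r: "0 \<le> r" "e + r *\<^sub>R d t \<in> K" by auto
  have "c * norm (e + r *\<^sub>R d t) \<le> 1" using cbound[OF r(2)] we d_inner by (simp add: inner_add_right)
  then have "norm (e + r *\<^sub>R d t) \<le> 1 / c" using cpos by (simp add: field_simps)
  moreover have "norm (r *\<^sub>R d t) - norm e \<le> norm (e + r *\<^sub>R d t)"
    using norm_diff_ineq[of "r *\<^sub>R d t" e] by (simp add: add.commute)
  ultimately show "r \<le> 1 / c + norm e" using r norm_d by simp
qed

lemma rad_pos: "rad t > 0"
proof -
  obtain \<epsilon> where eps: "\<epsilon> > 0" "ball e \<epsilon> \<subseteq> K" using eint mem_interior by blast
  have "e + (\<epsilon>/2) *\<^sub>R d t \<in> ball e \<epsilon>" using eps norm_d by (simp add: dist_norm)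
  then have "\<epsilon>/2 \<in> {r. 0 \<le> r \<and> e + r *\<^sub>R d t \<in> K}" using eps by auto
  from cSup_upper[OF this rad_bdd] show ?thesis using eps unfolding rad_def by linarith
qed

lemma Y_in_K: "Y t \<in> K"
proof -
  let ?A = "{r. 0 \<le> r \<and> e + r *\<^sub>R d t \<in> K}"
  have "?A = {0..} \<inter> (\<lambda>r. e + r *\<^sub>R d t) -` K" by auto
  moreover have "closed ({0..} \<inter> (\<lambda>r. e + r *\<^sub>R d t) -` K)"
    using closedK by (intro continuous_closed_preimage continuous_intros) auto
  ultimately have "closed ?A" by simp
  moreover have "?A \<noteq> {}" using eint interior_subset[of K] by (auto intro!: exI[of _ 0])
  ultimately have "Sup ?A \<in> ?A" by (intro closed_contains_Sup rad_bdd)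
  then show ?thesis unfolding Y_def rad_def by auto
qed

lemma interior_below_rad:
  assumes "0 \<le> r" "r < rad t"
  shows "e + r *\<^sub>R d t \<in> interior K"
proof -
  have "Y t - (1 - r / rad t) *\<^sub>R (Y t - e) \<in> interior K"
    using assms rad_pos[of t] by (intro mem_interior_convex_shrink convexK eint Y_in_K) auto
  also have "Y t - (1 - r / rad t) *\<^sub>R (Y t - e) = e + r *\<^sub>R d t"
    using rad_pos[of t] by (simp add: Y_def algebra_simps)
  finally show ?thesis .
qed

lemma in_K_iff_le_rad:
  assumes "0 \<le> r"
  shows "e + r *\<^sub>R d t \<in> K \<longleftrightarrow> r \<le> rad t"
proof
  assume "e + r *\<^sub>R d t \<in> K"
  then show "r \<le> rad t" unfolding rad_def using assms by (intro cSup_upper rad_bdd) auto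
next
  assume "r \<le> rad t"
  then show "e + r *\<^sub>R d t \<in> K"
    using interior_below_rad[OF assms] interior_subset[of K] Y_in_K[of t] unfolding Y_def
    by (metis order_le_less subsetD)
qed

lemma Y_frontier: "Y t \<in> frontier K"
proof -
  have "Y t \<notin> interior K"
  proof
    assume "Y t \<in> interior K"
    then obtain \<epsilon> where eps: "\<epsilon> > 0" "ball (Y t) \<epsilon> \<subseteq> K" using mem_interior by blast
    have "Y t + (\<epsilon>/2) *\<^sub>R d t \<in> ball (Y t) \<epsilon>" using eps norm_d by (simp add: dist_norm)
    then have "e + (rad t + \<epsilon>/2) *\<^sub>R d t \<in> K" using eps by (auto simp: Y_def algebra_simps)
    then show False using in_K_iff_le_rad[of "rad t + \<epsilon>/2" t] rad_pos[of t] eps by simp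
  qed
  then show ?thesis using Y_in_K closedK by (simp add: frontier_def)
qed

lemma frontier_ray_eq_Y:
  assumes "0 \<le> r" "e + r *\<^sub>R d t \<in> frontier K"
  shows "e + r *\<^sub>R d t = Y t"
proof -
  have "e + r *\<^sub>R d t \<in> K" "e + r *\<^sub>R d t \<notin> interior K"
    using assms(2) closedK by (auto simp: frontier_def)
  then have "r = rad t" using in_K_iff_le_rad[OF assms(1), of t] interior_below_rad[OF assms(1), of t] by force
  then show ?thesis by (simp add: Y_def)
qed

lemma w_Y: "w \<bullet> Y t = 1"
  by (simp add: Y_def inner_add_right we d_inner)

lemma Y_periodic: "Y (t + 2 * pi) = Y t"
proof -
  have "d (t + 2 * pi) = d t" by (simp add: d_def)
  then show ?thesis by (simp add: Y_def rad_def)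
qed

lemma Y_inj:
  assumes "Y s = Y t"
  shows "\<exists>n::int. s = t + of_int n * (2 * pi)"
proof -
  have eq: "rad s *\<^sub>R d s = rad t *\<^sub>R d t" using assms by (simp add: Y_def)
  then have "norm (rad s *\<^sub>R d s) = norm (rad t *\<^sub>R d t)" by simp
  then have "rad s = rad t" using norm_d rad_pos[of s] rad_pos[of t] by simp
  then have "d s = d t" using eq rad_pos[of t] by simp
  then have "cos s = cos t" "sin s = sin t" using d_inner by metis+
  then have "sin s = sin t \<and> cos s = cos t" by simp
  then show ?thesis unfolding sin_cos_eq_iff by (metis mult.commute mult.assoc)
qed

lemma frontier_pos:
  assumes "x \<in> frontier K - {0}"
  shows "w \<bullet> x > 0"
proof -
  have "x \<in> K" using assms closedK by (auto simp: frontier_def)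
  from cbound[OF this] show ?thesis using cpos assms by (metis DiffD2 insertCI less_le_trans mult_pos_pos zero_less_norm_iff)
qed

lemma frontier_scale:
  assumes "x \<in> frontier K" "s > 0"
  shows "s *\<^sub>R x \<in> frontier K"
proof -
  have x: "x \<in> K" "x \<notin> interior K" using assms closedK by (auto simp: frontier_def)
  have "s *\<^sub>R x \<in> K" using x coneK assms by (simp add: cone_def)
  moreover have "s *\<^sub>R x \<notin> interior K"
    using cone_interior_scale[OF coneK, of "s *\<^sub>R x" "1/s"] x assms by auto
  ultimately show ?thesis using closedK by (simp add: frontier_def)
qed

lemma polar_form:
  assumes "w \<bullet> x = 1"
  obtains r t where "r \<ge> 0" "x = e + r *\<^sub>R d t"
proof -
  let ?v = "x - e"
  have v: "?v = (?v \<bullet> e1) *\<^sub>R e1 + (?v \<bullet> e2) *\<^sub>R e2"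
    using assms we by (intro span) (simp add: inner_diff_right)
  obtain r t where "r \<ge> 0" "?v \<bullet> e1 = r * cos t" "?v \<bullet> e2 = r * sin t"
  proof -
    define r where "r = sqrt ((?v \<bullet> e1)\<^sup>2 + (?v \<bullet> e2)\<^sup>2)"
    have r2: "r\<^sup>2 = (?v \<bullet> e1)\<^sup>2 + (?v \<bullet> e2)\<^sup>2" by (simp add: r_def)
    show thesis
    proof (cases "r = 0")
      case True
      then have "?v \<bullet> e1 = 0" "?v \<bullet> e2 = 0" using r2 by (simp_all add: sum_power2_eq_zero_iff)
      then show thesis using that[of 0 0] by simp
    next
      case False
      then have "(?v \<bullet> e1 / r)\<^sup>2 + (?v \<bullet> e2 / r)\<^sup>2 = 1"
        unfolding power_divide add_divide_distrib[symmetric] r2[symmetric] by simp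
      then obtain t where "?v \<bullet> e1 / r = cos t" "?v \<bullet> e2 / r = sin t" using sincos_total_2pi by metis
      then have "?v \<bullet> e1 = r * cos t" "?v \<bullet> e2 = r * sin t" using False by (simp_all add: divide_eq_eq mult.commute)
      moreover have "r \<ge> 0" by (simp add: r_def)
      ultimately show thesis using that[of r t] by blast
    qed
  qed
  then have "?v = r *\<^sub>R d t" "r \<ge> 0" using v by (auto simp: d_def scaleR_add_right)
  then show thesis using that[of r t] by (simp add: algebra_simps)
qed

lemma Y_cover:
  assumes "x \<in> frontier K - {0}"
  shows "\<exists>t. x = (w \<bullet> x) *\<^sub>R Y t"
proof -
  have p: "w \<bullet> x > 0" using frontier_pos[OF assms] .
  define z where "z = (1 / (w \<bullet> x)) *\<^sub>R x"
  have z: "z \<in> frontier K" "w \<bullet> z = 1" using assms p frontier_scale by (auto simp: z_def)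
  obtain r t where rt: "r \<ge> 0" "z = e + r *\<^sub>R d t" using polar_form[OF z(2)] .
  then have "z = Y t" using frontier_ray_eq_Y z(1) by simp
  moreover have "x = (w \<bullet> x) *\<^sub>R z" using p by (simp add: z_def)
  ultimately show ?thesis by metis
qed

text \<open>Points of a ray before the boundary lie in the open interior and points beyond it in the
  open complement. Both situations persist for nearby angles, which bounds \<open>rad\<close> from
  below and from above.\<close>

lemma rad_cont: "isCont rad t"
  unfolding isCont_def
proof (rule order_tendstoI)
  fix a assume a: "a < rad t"
  define r where "r = (max a 0 + rad t) / 2"
  have r: "0 \<le> r" "r < rad t" "a < r" using a rad_pos[of t] by (auto simp: r_def)
  have "((\<lambda>s. e + r *\<^sub>R d s) \<longlongrightarrow> e + r *\<^sub>R d t) (at t)"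
    using d_cont(2)[of t] unfolding isCont_def by (intro tendsto_intros)
  from topological_tendstoD[OF this open_interior interior_below_rad[OF r(1,2)]]
  show "\<forall>\<^sub>F s in at t. a < rad s"
  proof eventually_elim
    case (elim s)
    then show ?case using in_K_iff_le_rad[OF r(1), of s] interior_subset[of K] r(3) by auto
  qed
next
  fix a assume a: "a > rad t"
  have a0: "a \<ge> 0" using a rad_pos[of t] by simp
  have "e + a *\<^sub>R d t \<in> - K" using in_K_iff_le_rad[OF a0] a by auto
  moreover have "((\<lambda>s. e + a *\<^sub>R d s) \<longlongrightarrow> e + a *\<^sub>R d t) (at t)"
    using d_cont(2)[of t] unfolding isCont_def by (intro tendsto_intros)
  ultimately have "\<forall>\<^sub>F s in at t. e + a *\<^sub>R d s \<in> - K"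
    using closedK by (intro topological_tendstoD) auto
  then show "\<forall>\<^sub>F s in at t. rad s < a"
    by eventually_elim (use in_K_iff_le_rad[OF a0] in auto)
qed

section \<open>Local defining functions and supporting planes\<close>

definition chart where
  "chart U g D H p \<longleftrightarrow> open U \<and> p \<in> U \<and> Ck_on k U (g :: real^3 \<Rightarrow> real) \<and>
     (\<forall>x\<in>U. (g has_derivative D x) (at x) \<and> D x \<noteq> (\<lambda>_. 0)) \<and> K \<inter> U = {x \<in> U. g x \<le> 0} \<and>
     (\<forall>v. ((\<lambda>x. D x v) has_derivative (\<lambda>w. H v w)) (at p)) \<and> (\<exists>v. D p v = 0 \<and> H v v > 0)"

lemma chart_exists: "p \<in> frontier K - {0} \<Longrightarrow> \<exists>U g D H. chart U g D H p"
  using bdry unfolding boundary_Ck_pos_curved_def chart_def by blast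

context
  fixes U g D H p
  assumes ch: "chart U g D H p"
begin

lemma chart_facts: "open U" "p \<in> U" "Ck_on k U g" "x \<in> U \<Longrightarrow> (g has_derivative D x) (at x)"
    "x \<in> U \<Longrightarrow> D x \<noteq> (\<lambda>_. 0)" "x \<in> U \<Longrightarrow> x \<in> K \<longleftrightarrow> g x \<le> 0"
    "((\<lambda>x. D x v) has_derivative (\<lambda>w. H v w)) (at p)" "\<exists>v. D p v = 0 \<and> H v v > 0"
  using ch unfolding chart_def by blast+

lemma D_linear: "x \<in> U \<Longrightarrow> linear (D x)"
  using chart_facts(4) has_derivative_linear by blast

lemma frontier_zero:
  assumes "x \<in> frontier K" "x \<in> U"
  shows "g x = 0"
proof (rule ccontr)
  assume "g x \<noteq> 0"
  have x: "x \<in> K" "x \<notin> interior K" using assms closedK by (auto simp: frontier_def)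
  then have "g x < 0" using chart_facts(6)[OF assms(2)] \<open>g x \<noteq> 0\<close> by simp
  have "continuous_on U g"
    using chart_facts(4) has_derivative_continuous continuous_at_imp_continuous_on by blast
  then have "open (U \<inter> g -` {..<0})" using chart_facts(1) by (intro continuous_open_preimage) auto
  moreover have "U \<inter> g -` {..<0} \<subseteq> K" using chart_facts(6) by auto
  ultimately have "x \<in> interior K" using \<open>g x < 0\<close> assms(2) by (auto intro: interiorI)
  then show False using x by simp
qed

text \<open>Otherwise \<open>g\<close> would become positive at once on the segment from
  \<open>x\<close> to \<open>z\<close>, although convexity keeps this segment in
  \<open>K\<close>.\<close>

lemma support:
  assumes x: "x \<in> frontier K" "x \<in> U" and z: "z \<in> K"
  shows "D x (z - x) \<le> 0"
proof (rule ccontr)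
  assume "\<not> D x (z - x) \<le> 0"
  then have p: "D x (z - x) > 0" by simp
  let ?f = "\<lambda>s::real. x + s *\<^sub>R (z - x)"
  have f: "(?f has_vector_derivative (z - x)) (at 0)"
    by (auto intro!: derivative_eq_intros)
  have "((\<lambda>s. g (?f s)) has_real_derivative D x (z - x)) (at 0)"
    using vector_derivative_diff_chain_within[of ?f "z - x" 0 UNIV g "D x"] f chart_facts(4)[OF x(2)]
    by (auto simp: o_def real_vd_iff intro: has_derivative_at_withinI)
  from DERIV_pos_inc_right[OF this p] obtain \<delta> where del: "\<delta> > 0" "\<And>h. 0 < h \<Longrightarrow> h < \<delta> \<Longrightarrow> g (?f h) > g x"
    by auto
  have "isCont ?f 0" by (intro continuous_intros)
  then have "(?f \<longlongrightarrow> x) (at_right 0)" unfolding isCont_def using filterlim_at_split[of ?f] by simp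
  from topological_tendstoD[OF this chart_facts(1) x(2)] have "\<forall>\<^sub>F h in at_right 0. ?f h \<in> U" .
  moreover have "\<forall>\<^sub>F h in at_right 0. h < min \<delta> 1" using del by (intro eventually_at_right_less[THEN eventually_mono] eventually_at_rightI[of 0 "min \<delta> 1"]) auto
  moreover have "\<forall>\<^sub>F h::real in at_right 0. h > 0" by (simp add: eventually_at_right_less)
  ultimately have "\<forall>\<^sub>F h::real in at_right 0. False"
  proof eventually_elim
    case (elim h)
    have "?f h = (1 - h) *\<^sub>R x + h *\<^sub>R z" by (simp add: algebra_simps)
    also have "\<dots> \<in> K" using convexK x(1) z elim closedK
      by (intro convexD) (auto simp: frontier_def)
    finally have "g (?f h) \<le> 0" using chart_facts(6) elim by blast
    then show False using del(2)[of h] elim frontier_zero[OF x] by auto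
  qed
  then show False by simp
qed

text \<open>In case of equality a small ball around \<open>z\<close> would make \<open>D x\<close>
  nonpositive in every direction, hence zero, against the nonvanishing gradient.\<close>

lemma support_strict:
  assumes x: "x \<in> frontier K" "x \<in> U" and z: "z \<in> interior K"
  shows "D x (z - x) < 0"
proof (rule ccontr)
  assume n: "\<not> D x (z - x) < 0"
  have "z \<in> K" using z interior_subset by auto
  then have z0: "D x (z - x) = 0" using support[OF x] n by fastforce
  obtain \<epsilon> where eps: "\<epsilon> > 0" "ball z \<epsilon> \<subseteq> K" using z mem_interior by blast
  have le: "D x v \<le> 0" for v
  proof (cases "v = 0")
    case False
    define s where "s = \<epsilon> / 2 / norm v"
    have s: "s > 0" using eps False by (simp add: s_def)
    have "z + s *\<^sub>R v \<in> ball z \<epsilon>" using eps False by (simp add: dist_norm s_def)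
    then have "D x ((z - x) + s *\<^sub>R v) \<le> 0" using support[OF x, of "z + s *\<^sub>R v"] eps by (auto simp: algebra_simps)
    then have "s * D x v \<le> 0" using z0 D_linear[OF x(2)] by (simp add: linear_add linear_scale)
    then show ?thesis using s by (simp add: mult_le_0_iff)
  qed (use D_linear[OF x(2)] in \<open>simp add: linear_0\<close>)
  have "D x v = 0" for v
    using le[of v] le[of "- v"] D_linear[OF x(2)] by (simp add: linear_neg)
  then show False using chart_facts(5)[OF x(2)] by blast
qed

text \<open>The cone contains both \<open>2 x\<close> and 0, so the supporting inequality applies
  along \<open>x\<close> in both directions.\<close>

lemma D_radial:
  assumes x: "x \<in> frontier K" "x \<in> U"
  shows "D x x = 0"
proof -
  have "x \<in> K" using x closedK by (auto simp: frontier_def)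
  then have "2 *\<^sub>R x \<in> K" "0 *\<^sub>R x \<in> K" using coneK unfolding cone_def by fastforce+
  from support[OF x this(1)] support[OF x this(2)] show ?thesis
    using D_linear[OF x(2)] by (simp add: linear_neg scaleR_2)
qed

lemma D_d_pos:
  assumes "Y t \<in> U"
  shows "D (Y t) (d t) > 0"
proof -
  have "D (Y t) (e - Y t) < 0" using support_strict[OF Y_frontier assms eint] .
  also have "e - Y t = (- rad t) *\<^sub>R d t" by (simp add: Y_def)
  also have "D (Y t) ((- rad t) *\<^sub>R d t) = - (rad t * D (Y t) (d t))"
    using D_linear[OF assms] linear_scale[of "D (Y t)" "- rad t"] by simp
  finally show ?thesis using rad_pos[of t] by (simp add: zero_less_mult_iff)
qed

lemma rad_deriv:
  assumes "Y t \<in> U"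
  shows "(rad has_real_derivative - (rad t * D (Y t) (d1 t) / D (Y t) (d t))) (at t)"
proof (rule implicit_ray_derivative[where e = e and d = d and g = g])
  show "(g has_derivative D (Y t)) (at (e + rad t *\<^sub>R d t))"
    using chart_facts(4)[OF assms] by (simp add: Y_def)
  have "isCont Y t" unfolding Y_def[abs_def] using rad_cont d_cont by (intro continuous_intros)
  then have "\<forall>\<^sub>F s in at t. Y s \<in> U"
    unfolding isCont_def using chart_facts(1) assms by (rule topological_tendstoD)
  then show "\<forall>\<^sub>F s in at t. g (e + rad s *\<^sub>R d s) = g (e + rad t *\<^sub>R d t)"
    by eventually_elim (use frontier_zero[OF Y_frontier] assms in \<open>simp add: Y_def[symmetric]\<close>)
  show "D (Y t) (d t) \<noteq> 0" using D_d_pos[OF assms] by simp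
qed (rule rad_cont d_deriv)+

lemma D_Ck: "Ck_on (k - 1) U (\<lambda>x. D x v)"
proof -
  obtain k' where k': "k = Suc k'" using k2 by (cases k) auto
  then obtain D' where D': "\<forall>x\<in>U. (g has_derivative D' x) (at x)" "\<forall>v. Ck_on k' U (\<lambda>x. D' x v)"
    using chart_facts(3) by auto
  have "D' x = D x" if "x \<in> U" for x
    using D'(1) chart_facts(4) that has_derivative_unique by blast
  then have "Ck_on k' U (\<lambda>x. D x v) \<longleftrightarrow> Ck_on k' U (\<lambda>x. D' x v)"
    using chart_facts(1) by (intro Ck_on_cong) auto
  then show ?thesis using D'(2) k' by simp
qed

text \<open>Bootstrapping in the formula for rad': its right-hand side involves only
  \<open>rad\<close>, sine, cosine and first derivatives of \<open>g\<close> along \<open>Y\<close>.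
  These derivatives are of class C^(k-1), so the induction reaches \<open>k\<close>.\<close>

lemma rad_Ck_chart: "n \<le> k \<Longrightarrow> Ck_on n {t. Y t \<in> U} rad"
proof (induction n)
  case 0
  show ?case using rad_cont by (simp add: continuous_at_imp_continuous_on)
next
  case (Suc n)
  define S where "S = {t. Y t \<in> U}"
  have r: "Ck_on n S rad" using Suc by (simp add: S_def)
  have sc: "Ck_on n S sin" "Ck_on n S cos" using Ck_on_sin_cos by auto
  have Yn: "Ck_on n S Y" unfolding Y_def[abs_def] d_def
    by (intro Ck_on_add Ck_on_const Ck_on_scaleR r sc)
  have Dn: "Ck_on n S (\<lambda>t. D (Y t) v)" for v
    using Suc.prems by (intro Ck_on_compose_curve[where U = U] Yn Ck_on_mono[OF D_Ck]) (auto simp: S_def)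
  have D1: "D (Y t) (d1 t) = - sin t * D (Y t) e1 + cos t * D (Y t) e2"
    "D (Y t) (d t) = cos t * D (Y t) e1 + sin t * D (Y t) e2" if "t \<in> S" for t
    using D_linear[of "Y t"] that unfolding S_def d_def d1_def by (simp_all add: linear_add linear_scale linear_diff linear_neg)
  have "Ck_on (Suc n) S rad"
  proof (rule Ck_on_SucI)
    fix t assume t: "t \<in> S"
    show "(rad has_vector_derivative - (rad t * (- sin t * D (Y t) e1 + cos t * D (Y t) e2) / (cos t * D (Y t) e1 + sin t * D (Y t) e2))) (at t)"
      using rad_deriv[of t] t[unfolded S_def] D1[OF t] by (simp add: real_vd_iff)
  next
    have "cos t * D (Y t) e1 + sin t * D (Y t) e2 \<noteq> 0" if "t \<in> S" for t
      using D_d_pos[of t] that[unfolded S_def] D1[OF that] by simp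
    then show "Ck_on n S (\<lambda>t. - (rad t * (- sin t * D (Y t) e1 + cos t * D (Y t) e2) / (cos t * D (Y t) e1 + sin t * D (Y t) e2)))"
      by (intro Ck_on_minus Ck_on_divide Ck_on_mult Ck_on_add r sc Dn) auto
  qed
  then show ?case by (simp only: S_def)
qed

end

lemma Y_cont: "isCont Y t"
  unfolding Y_def[abs_def] using rad_cont d_cont by (intro continuous_intros)

lemma Y_nonzero: "Y t \<noteq> 0"
  using w_Y[of t] by auto

lemma rad_Ck: "Ck_on k UNIV rad"
proof (rule Ck_on_local)
  fix t
  obtain U g D H where ch: "chart U g D H (Y t)" using chart_exists[of "Y t"] Y_frontier Y_nonzero by auto
  have "open {t. Y t \<in> U}"
    using continuous_open_vimage[of U Y] chart_facts(1)[OF ch] Y_cont by (simp add: vimage_def)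
  then show "\<exists>T. open T \<and> t \<in> T \<and> Ck_on k T rad"
    using rad_Ck_chart[OF ch order_refl] chart_facts(2)[OF ch] by (intro exI[of _ "{t. Y t \<in> U}"]) auto
qed

lemma Y_Ck: "Ck_on k UNIV Y"
  unfolding Y_def[abs_def] d_def using Ck_on_sin_cos[of k UNIV]
  by (intro Ck_on_add Ck_on_const Ck_on_scaleR rad_Ck) auto

section \<open>Orientation, curvature and global convexity of the boundary curve\<close>

definition "Y1 t = vector_derivative Y (at t)"
definition "Y2 t = vector_derivative Y1 (at t)"

lemma Y_deriv: "(Y has_vector_derivative Y1 t) (at t)"
  using Ck_on_vector_derivative[of "k - 1" UNIV Y t] Y_Ck k2 by (simp add: Y1_def del: Ck_on.simps)

lemma Y1_Ck: "Ck_on (k - 1) UNIV Y1"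
  using Ck_on_deriv[of "k - 1" UNIV Y Y1] Y_Ck k2 Y_deriv by (simp del: Ck_on.simps)

lemma Y1_deriv: "(Y1 has_vector_derivative Y2 t) (at t)"
  using Ck_on_vector_derivative[of "k - 2" UNIV Y1 t] Y1_Ck k2
  by (simp add: Y2_def Suc_diff_Suc numeral_2_eq_2 del: Ck_on.simps)

lemma Y2_Ck: "Ck_on (k - 2) UNIV Y2"
  using Ck_on_deriv[of "k - 2" UNIV Y1 Y2] Y1_Ck k2 Y1_deriv
  by (simp add: Suc_diff_Suc numeral_2_eq_2 del: Ck_on.simps)

text \<open>The radial part of \<open>Y1\<close> drops out; what remains is the area swept by the
  ray, with the sign fixed by \<open>orient\<close>.\<close>

lemma e_det: "e \<bullet> cross3 (Y1 t) (Y t) > 0"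
proof -
  obtain r1 where "(rad has_vector_derivative r1) (at t)"
    using Ck_on_vector_derivative[of "k - 1" UNIV rad t] rad_Ck k2 by (auto simp del: Ck_on.simps)
  then have "(rad has_real_derivative r1) (at t)" by (simp add: real_vd_iff)
  from has_vector_derivative_add[OF has_vector_derivative_const[of e] has_vector_derivative_scaleR[OF this d_deriv]]
  have "(Y has_vector_derivative rad t *\<^sub>R d1 t + r1 *\<^sub>R d t) (at t)" by (simp add: Y_def[abs_def])
  then have Y1: "Y1 t = rad t *\<^sub>R d1 t + r1 *\<^sub>R d t" using Y_deriv vector_derivative_unique_at by blast
  have "e \<bullet> cross3 (Y1 t) (Y t) = (rad t)\<^sup>2 * (e \<bullet> cross3 (d1 t) (d t))"
    unfolding Y1 Y_def by (simp add: cross3_def inner_vec_def sum_3 vector_def algebra_simps power2_eq_square)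
  also have "cross3 (d1 t) (d t) = ((sin t)\<^sup>2 + (cos t)\<^sup>2) *\<^sub>R cross3 e2 e1"
  proof -
    have "cross3 (- a *\<^sub>R e1 + b *\<^sub>R e2) (b *\<^sub>R e1 + a *\<^sub>R e2) = (a\<^sup>2 + b\<^sup>2) *\<^sub>R cross3 e2 e1" for a b
      by (simp add: cross3_def vector_def vec_eq_iff forall_3 algebra_simps power2_eq_square)
    then show ?thesis unfolding d_def d1_def .
  qed
  finally show ?thesis using orient rad_pos[of t] by simp
qed

context
  fixes U g D H t
  assumes ch: "chart U g D H (Y t)"
begin

text \<open>Both the gradient of \<open>g\<close> and the covector Y' \<times> Y annihilate
  \<open>Y\<close> and Y', so they are proportional; evaluation at \<open>e\<close> gives the
  factor. This translates between the arbitrary local \<open>g\<close> and the determinants of the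
  curve.\<close>

lemma D_vs_det: "(e \<bullet> cross3 (Y1 t) (Y t)) * D (Y t) v = (v \<bullet> cross3 (Y1 t) (Y t)) * D (Y t) e"
  and D_e_neg: "D (Y t) e < 0"
proof -
  note cf = chart_facts[OF ch]
  have lin: "linear (D (Y t))" using D_linear[OF ch cf(2)] .
  have rad0: "D (Y t) (Y t) = 0" using D_radial[OF ch Y_frontier cf(2)] .
  have "((\<lambda>s. g (Y s)) has_vector_derivative D (Y t) (Y1 t)) (at t)"
    using vector_derivative_diff_chain_within[of Y "Y1 t" t UNIV g "D (Y t)"] Y_deriv cf(4)[OF cf(2)]
    by (auto simp: o_def intro: has_derivative_at_withinI)
  moreover have "((\<lambda>s. g (Y s)) has_vector_derivative 0) (at t)"
  proof (rule has_vector_derivative_transform_within_open[where S = "{s. Y s \<in> U}" and f = "\<lambda>s. 0"])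
    show "open {s. Y s \<in> U}" using continuous_open_vimage[of U Y] cf(1) Y_cont by (simp add: vimage_def)
  qed (use cf(2) frontier_zero[OF ch Y_frontier] in auto)
  ultimately have D1: "D (Y t) (Y1 t) = 0" using vector_derivative_unique_at by blast
  have "D (Y t) ((e \<bullet> cross3 (Y1 t) (Y t)) *\<^sub>R v) = (v \<bullet> cross3 (Y1 t) (Y t)) * D (Y t) e"
    unfolding cramer3[of e "Y1 t" "Y t" v] using lin D1 rad0 by (simp add: linear_add linear_scale)
  then show "(e \<bullet> cross3 (Y1 t) (Y t)) * D (Y t) v = (v \<bullet> cross3 (Y1 t) (Y t)) * D (Y t) e"
    using lin by (simp add: linear_scale)
  show "D (Y t) e < 0"
    using support_strict[OF ch Y_frontier cf(2) eint] lin rad0 by (simp add: linear_diff)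
qed

lemma det_pos_iff_D_neg: "v \<bullet> cross3 (Y1 t) (Y t) > 0 \<longleftrightarrow> D (Y t) v < 0"
  using D_vs_det[of v] D_e_neg e_det[of t]
  by (smt (verit) mult_less_cancel_right2 mult_neg_neg mult_pos_neg mult_pos_pos mult_eq_0_iff mult_neg_pos)

lemma tangent_repr:
  assumes "D (Y t) v = 0"
  shows "\<exists>a b. v = a *\<^sub>R Y1 t + b *\<^sub>R Y t"
proof -
  let ?\<Delta> = "e \<bullet> cross3 (Y1 t) (Y t)"
  have "v \<bullet> cross3 (Y1 t) (Y t) = 0" using D_vs_det[of v] D_e_neg assms by simp
  then have "?\<Delta> *\<^sub>R v = (e \<bullet> cross3 v (Y t)) *\<^sub>R Y1 t + (e \<bullet> cross3 (Y1 t) v) *\<^sub>R Y t"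
    using cramer3[of e "Y1 t" "Y t" v] by simp
  then have "v = (1 / ?\<Delta>) *\<^sub>R ((e \<bullet> cross3 v (Y t)) *\<^sub>R Y1 t + (e \<bullet> cross3 (Y1 t) v) *\<^sub>R Y t)"
    using e_det[of t] by (metis (no_types, lifting) divide_self_if less_irrefl scaleR_one scaleR_scaleR times_divide_eq_left mult_1)
  then show ?thesis by (metis scaleR_add_right scaleR_scaleR)
qed

text \<open>Differentiate \<open>g = 0\<close> twice along a boundary curve with the given initial
  velocity. Its acceleration is 2 a b Y' + a^2 Y'', and the gradient annihilates Y'.\<close>

lemma hessian_tangent: "H (a *\<^sub>R Y1 t + b *\<^sub>R Y t) (a *\<^sub>R Y1 t + b *\<^sub>R Y t) = - a\<^sup>2 * D (Y t) (Y2 t)"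
proof -
  note cf = chart_facts[OF ch]
  define q where "q s = (1 + b * s) *\<^sub>R Y (t + a * s)" for s
  define q1 where "q1 s = (1 + b * s) *\<^sub>R (a *\<^sub>R Y1 (t + a * s)) + b *\<^sub>R Y (t + a * s)" for s
  have aff: "((\<lambda>s. t + a * s) has_vector_derivative a) (at s)" for s
    by (auto intro!: derivative_eq_intros simp: real_vd_iff[symmetric])
  have bff: "((\<lambda>s. 1 + b * s) has_real_derivative b) (at s)" for s
    by (auto intro!: derivative_eq_intros)
  have Ya: "((\<lambda>s. Y (t + a * s)) has_vector_derivative a *\<^sub>R Y1 (t + a * s)) (at s)" for s
    using vector_diff_chain_at[OF aff Y_deriv] by (simp add: o_def)
  have Y1a: "((\<lambda>s. Y1 (t + a * s)) has_vector_derivative a *\<^sub>R Y2 (t + a * s)) (at s)" for s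
    using vector_diff_chain_at[OF aff Y1_deriv] by (simp add: o_def)
  have dq: "(q has_vector_derivative q1 s) (at s)" for s
    unfolding q_def[abs_def] q1_def by (rule has_vector_derivative_scaleR[OF bff Ya])
  have dq1: "(q1 has_vector_derivative (2 * a * b) *\<^sub>R Y1 t + a\<^sup>2 *\<^sub>R Y2 t) (at 0)"
  proof -
    have "((\<lambda>s. a *\<^sub>R Y1 (t + a * s)) has_vector_derivative a *\<^sub>R (a *\<^sub>R Y2 (t + a * 0))) (at 0)"
      using bounded_linear.has_vector_derivative[OF bounded_linear_scaleR_right Y1a] .
    from has_vector_derivative_add[OF has_vector_derivative_scaleR[OF bff[of 0] this]
        bounded_linear.has_vector_derivative[OF bounded_linear_scaleR_right[of b] Ya[of 0]]]
    show ?thesis unfolding q1_def[abs_def]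
      by (simp add: power2_eq_square mult.commute scaleR_add_left[symmetric] add.assoc)
        (simp add: algebra_simps scaleR_2[symmetric])
  qed
  \<comment> \<open>A positive factor keeps \<open>q s\<close> on the boundary of the cone, so that
    \<open>g\<close> vanishes along \<open>q\<close> near 0.\<close>
  define O' where "O' = {s. 1 + b * s > 0} \<inter> {s. q s \<in> U}"
  have "isCont q s" for s using dq has_vector_derivative_continuous by blast
  then have "open {s. q s \<in> U}" using continuous_open_vimage[of U q] cf(1) by (simp add: vimage_def)
  moreover have "open {s. 1 + b * s > 0}" by (intro open_Collect_less continuous_intros)
  ultimately have oO: "open O'" unfolding O'_def by blast
  have q0: "q 0 = Y t" "q1 0 = a *\<^sub>R Y1 t + b *\<^sub>R Y t" by (auto simp: q_def q1_def)
  have zO: "0 \<in> O'" using cf(2) by (simp add: O'_def q0)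
  have gz: "g (q s) = 0" if "s \<in> O'" for s
    using that frontier_scale[OF Y_frontier, of "1 + b * s" "t + a * s"] by (intro frontier_zero[OF ch]) (auto simp: O'_def q_def)
  have Dz: "D (q s) (q1 s) = 0" if s: "s \<in> O'" for s
  proof -
    have "((\<lambda>s. g (q s)) has_vector_derivative D (q s) (q1 s)) (at s)"
      using vector_derivative_diff_chain_within[of q "q1 s" s UNIV g "D (q s)"] dq cf(4)[of "q s"] s
      by (auto simp: o_def O'_def intro: has_derivative_at_withinI)
    moreover have "((\<lambda>s. g (q s)) has_vector_derivative 0) (at s)"
      by (rule has_vector_derivative_transform_within_open[where S = O' and f = "\<lambda>s. 0"]) (use oO s gz in auto)
    ultimately show ?thesis using vector_derivative_unique_at by blast
  qed
  have "((\<lambda>s. D (q s) (q1 s)) has_real_derivative H (q1 0) (q1 0) + D (q 0) ((2 * a * b) *\<^sub>R Y1 t + a\<^sup>2 *\<^sub>R Y2 t)) (at 0)"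
    using cf(1,2,7) D_linear[OF ch] dq[of 0] dq1 q0 by (intro derivative_pairing[where U = U]) auto
  moreover have "((\<lambda>s. D (q s) (q1 s)) has_real_derivative 0) (at 0)"
    by (rule has_field_derivative_transform_within_open[where S = O' and f = "\<lambda>s. 0"]) (use oO zO Dz in auto)
  ultimately have "H (q1 0) (q1 0) + D (Y t) ((2 * a * b) *\<^sub>R Y1 t + a\<^sup>2 *\<^sub>R Y2 t) = 0"
    using DERIV_unique q0 by metis
  moreover have "D (Y t) (Y1 t) = 0"
    using D_vs_det[of "Y1 t"] e_det[of t] dot_cross_self(1)[of "Y1 t" "Y t"] by simp
  ultimately show ?thesis
    using D_linear[OF ch cf(2)] q0 by (simp add: linear_add linear_scale)
qed

text \<open>The curvature hypothesis provides a tangent vector with positive Hessian. Its component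
  along the ray contributes nothing, so positivity must come from the factor of a^2.\<close>

lemma D_Y2_neg: "D (Y t) (Y2 t) < 0"
proof -
  obtain v where v: "D (Y t) v = 0" "H v v > 0" using chart_facts(8)[OF ch] by blast
  obtain a b where "v = a *\<^sub>R Y1 t + b *\<^sub>R Y t" using tangent_repr[OF v(1)] by blast
  then have "- a\<^sup>2 * D (Y t) (Y2 t) > 0" using hessian_tangent v(2) by simp
  then show ?thesis by (simp add: mult_less_0_iff)
qed

text \<open>Equality would place the segment from \<open>Y t\<close> to \<open>Y s\<close> in the
  boundary and make the Hessian vanish along it. By strict curvature the segment then points along
  the ray of \<open>Y t\<close>, which is impossible inside the affine plane.\<close>

lemma D_neg_off_point:
  assumes "Y s \<noteq> Y t"
  shows "D (Y t) (Y s) < 0"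
proof (rule ccontr)
  note cf = chart_facts[OF ch]
  assume n: "\<not> D (Y t) (Y s) < 0"
  have lin: "linear (D (Y t))" using D_linear[OF ch cf(2)] .
  have rad0: "D (Y t) (Y t) = 0" using D_radial[OF ch Y_frontier cf(2)] .
  define v where "v = Y s - Y t"
  have v0: "D (Y t) v = 0"
    using n support[OF ch Y_frontier cf(2) Y_in_K, of s] lin rad0 unfolding v_def by (simp add: linear_diff)
  obtain a b where ab: "v = a *\<^sub>R Y1 t + b *\<^sub>R Y t" using tangent_repr[OF v0] by blast
  define q where "q h = Y t + h *\<^sub>R v" for h
  have dq: "(q has_vector_derivative v) (at h)" for h
    unfolding q_def[abs_def] by (auto intro!: derivative_eq_intros)
  have cq: "isCont q h" for h using dq has_vector_derivative_continuous by blast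
  define O' where "O' = {0<..<1} \<inter> {h. q h \<in> U}"
  have oO: "open O'" using continuous_open_vimage[of U q] cf(1) cq by (auto simp: vimage_def O'_def)
  have fr: "q h \<in> frontier K" if "0 < h" "h < 1" for h
  proof -
    have "q h = (1 - h) *\<^sub>R Y t + h *\<^sub>R Y s" by (simp add: q_def v_def algebra_simps)
    also have "\<dots> \<in> K" using convexK Y_in_K that by (intro convexD) auto
    finally have "q h \<in> K" .
    moreover have "q h \<notin> interior K"
      using support_strict[OF ch Y_frontier cf(2), of "q h"] v0 lin by (auto simp: q_def linear_scale)
    ultimately show ?thesis using closedK by (simp add: frontier_def)
  qed
  have Dz: "D (q h) v = 0" if h: "h \<in> O'" for h
  proof -
    have "((\<lambda>s. g (q s)) has_vector_derivative D (q h) v) (at h)"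
      using vector_derivative_diff_chain_within[of q v h UNIV g "D (q h)"] dq cf(4)[of "q h"] h
      by (auto simp: o_def O'_def intro: has_derivative_at_withinI)
    moreover have "((\<lambda>s. g (q s)) has_vector_derivative 0) (at h)"
      by (rule has_vector_derivative_transform_within_open[where S = O' and f = "\<lambda>s. 0"])
        (use oO h frontier_zero[OF ch fr] in \<open>auto simp: O'_def\<close>)
    ultimately show ?thesis using vector_derivative_unique_at by blast
  qed
  have "((\<lambda>h. D (q h) v) has_vector_derivative H v v) (at 0)"
    using vector_derivative_diff_chain_within[of q v 0 UNIV "\<lambda>x. D x v" "H v"] dq[of 0] cf(7)[of v]
    by (auto simp: o_def q_def intro: has_derivative_at_withinI)
  then have "((\<lambda>h. (D (q h) v - D (q 0) v) / (h - 0)) \<longlongrightarrow> H v v) (at 0)"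
    by (simp add: real_vd_iff[symmetric] has_field_derivative_iff)
  \<comment> \<open>One-sided, because the segment is known to lie in the boundary only for positive
    \<open>h\<close>.\<close>
  then have lim: "((\<lambda>h. (D (q h) v - D (q 0) v) / (h - 0)) \<longlongrightarrow> H v v) (at_right 0)"
    by (rule tendsto_within_subset) simp
  have "\<forall>\<^sub>F h in at_right 0. q h \<in> U"
  proof -
    have "(q \<longlongrightarrow> q 0) (at 0)" using cq by (simp add: isCont_def)
    then have "(q \<longlongrightarrow> q 0) (at_right 0)" by (rule tendsto_within_subset) simp
    moreover have "q 0 = Y t" by (simp add: q_def)
    ultimately show ?thesis using cf(1,2) by (metis topological_tendstoD)
  qed
  moreover have "\<forall>\<^sub>F h::real in at_right 0. h \<in> {0<..<1}" by (intro eventually_at_rightI[of 0 1]) auto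
  ultimately have "\<forall>\<^sub>F h in at_right 0. (D (q h) v - D (q 0) v) / (h - 0) = 0"
  proof eventually_elim
    case (elim h)
    then have "h \<in> O'" by (simp add: O'_def)
    then show ?case using Dz v0 by (simp add: q_def)
  qed
  from tendsto_cong[OF this] lim have "((\<lambda>h::real. 0) \<longlongrightarrow> H v v) (at_right 0)" by blast
  then have "H v v = 0" using tendsto_unique[OF trivial_limit_at_right_real _ tendsto_const] by metis
  then have "a = 0" using hessian_tangent[of a b] ab D_Y2_neg by simp
  then have "w \<bullet> v = b" using ab w_Y by simp
  moreover have "w \<bullet> v = 0" unfolding v_def using w_Y by (simp add: inner_diff_right)
  ultimately have "b = 0" by linarith
  then have "v = 0" using ab \<open>a = 0\<close> by simp
  then show False using assms by (simp add: v_def)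
qed

end

lemma Y_det_pos: "Y2 t \<bullet> cross3 (Y1 t) (Y t) > 0"
proof -
  obtain U g D H where ch: "chart U g D H (Y t)" using chart_exists[of "Y t"] Y_frontier Y_nonzero by auto
  show ?thesis using det_pos_iff_D_neg[OF ch] D_Y2_neg[OF ch] by simp
qed

lemma Y_global_convex:
  assumes "a < t" "t < a + 2 * pi"
  shows "Y t \<bullet> cross3 (Y1 a) (Y a) > 0"
proof -
  obtain U g D H where ch: "chart U g D H (Y a)" using chart_exists[of "Y a"] Y_frontier Y_nonzero by auto
  have "Y t \<noteq> Y a"
  proof
    assume "Y t = Y a"
    then obtain n :: int where n: "t = a + of_int n * (2 * pi)" using Y_inj by blast
    then have "0 < of_int n * (2 * pi)" "of_int n * (2 * pi) < 1 * (2 * pi)" using assms by auto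
    then have "0 < n" "n < 1" by (simp_all add: zero_less_mult_iff)
    then show False by simp
  qed
  then show ?thesis using det_pos_iff_D_neg[OF ch] D_neg_off_point[OF ch] by simp
qed

end

section \<open>Unimodular lift and change of parameter\<close>

lemma Ck_on_UNIV_SucE:
  fixes f :: "real \<Rightarrow> 'b::real_normed_vector"
  assumes "Ck_on (Suc n) UNIV f"
  obtains f' where "\<And>t. (f has_vector_derivative f' t) (at t)" "Ck_on n UNIV f'"
  using assms unfolding Ck_on_Suc_real by auto

text \<open>With k = n + 5, the factor \<open>m\<close> involves Y'' and so \<open>y\<close> is only
  C^(k-2). What needs care is that \<open>al\<close> still comes out of class C^(k-4).\<close>

lemma (in cone_chart) unimodular_lift:
  assumes k: "k = n + 5"
  obtains y y1 y2 y3 al al1 b m where "unimodular_curve y y1 y2 y3 al al1 b w"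
    "Ck_on (Suc n) UNIV al" "Ck_on (n + 3) UNIV y" "\<And>t. y t = m t *\<^sub>R Y t" "\<And>t. m t > 0"
proof -
  define \<Delta> where "\<Delta> t = Y2 t \<bullet> cross3 (Y1 t) (Y t)" for t
  have \<Delta>: "\<Delta> t > 0" for t unfolding \<Delta>_def by (rule Y_det_pos)
  have Ck: "Ck_on (n + 3) UNIV Y" "Ck_on (n + 3) UNIV Y1" "Ck_on (n + 3) UNIV Y2"
    using Ck_on_mono[OF Y_Ck, of "n + 3"] Ck_on_mono[OF Y1_Ck, of "n + 3"] Ck_on_mono[OF Y2_Ck, of "n + 3"] k by auto
  have Ck\<Delta>: "Ck_on (n + 3) UNIV \<Delta>"
    unfolding \<Delta>_def[abs_def] by (intro Ck_on_inner Ck_on_cross3 Ck)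
  \<comment> \<open>The determinant of \<open>m Y\<close> and its first two derivatives is m^3 times
    that of \<open>Y\<close>, since derivatives of \<open>m\<close> only add multiples of earlier
    vectors.\<close>
  define m where "m t = \<Delta> t powr (- 1/3)" for t
  have m: "m t > 0" for t using \<Delta>[of t] by (simp add: m_def)
  have m3: "m t ^ 3 * \<Delta> t = 1" for t
  proof -
    have "m t ^ 3 = \<Delta> t powr (- 1)" using \<Delta>[of t] by (simp add: m_def powr_power)
    then show ?thesis using \<Delta>[of t] by (simp add: powr_minus)
  qed
  have Ckm: "Ck_on (n + 3) UNIV m" unfolding m_def[abs_def] using \<Delta> by (intro Ck_on_powr Ck\<Delta>)
  define y where "y t = m t *\<^sub>R Y t" for t
  have Cky: "Ck_on (n + 3) UNIV y" unfolding y_def[abs_def] by (intro Ck_on_scaleR Ckm Ck)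
  have n3: "n + 3 = Suc (Suc (Suc n))" by simp
  obtain m1 where m1: "\<And>t. (m has_vector_derivative m1 t) (at t)" "Ck_on (Suc (Suc n)) UNIV m1"
    using Ck_on_UNIV_SucE[OF Ckm[unfolded n3]] by blast
  obtain m2 where m2: "\<And>t. (m1 has_vector_derivative m2 t) (at t)"
    using Ck_on_UNIV_SucE[OF m1(2)] by blast
  obtain y1 where y1: "\<And>t. (y has_vector_derivative y1 t) (at t)" "Ck_on (Suc (Suc n)) UNIV y1"
    using Ck_on_UNIV_SucE[OF Cky[unfolded n3]] by blast
  obtain y2 where y2: "\<And>t. (y1 has_vector_derivative y2 t) (at t)" "Ck_on (Suc n) UNIV y2"
    using Ck_on_UNIV_SucE[OF y1(2)] by blast
  obtain y3 where y3: "\<And>t. (y2 has_vector_derivative y3 t) (at t)" "Ck_on n UNIV y3"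
    using Ck_on_UNIV_SucE[OF y2(2)] by blast
  have scal: "((\<lambda>t. a t *\<^sub>R f t) has_vector_derivative a t *\<^sub>R f' t + a' t *\<^sub>R f t) (at t)"
    if "\<And>t. (a has_vector_derivative a' t) (at t)" "\<And>t. (f has_vector_derivative f' t) (at t)"
    for a a' :: "real \<Rightarrow> real" and f f' :: "real \<Rightarrow> real^3" and t
    by (rule has_vector_derivative_scaleR[OF that(1)[unfolded real_vd_iff[symmetric]] that(2)])
  have y1eq: "y1 t = m t *\<^sub>R Y1 t + m1 t *\<^sub>R Y t" for t
    using scal[OF m1(1) Y_deriv] y1(1) vector_derivative_unique_at unfolding y_def[abs_def] by blast
  have y2eq: "y2 t = (m t *\<^sub>R Y2 t + m1 t *\<^sub>R Y1 t) + (m1 t *\<^sub>R Y1 t + m2 t *\<^sub>R Y t)" for t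
    using has_vector_derivative_add[OF scal[OF m1(1) Y1_deriv] scal[OF m2(1) Y_deriv]] y2(1)
      vector_derivative_unique_at unfolding y1eq[abs_def] by blast
  have Peq: "cross3 (y1 t) (y t) = (m t)\<^sup>2 *\<^sub>R cross3 (Y1 t) (Y t)" for t
    unfolding y1eq y_def by (simp add: cross3_simps power2_eq_square forall_3)
  have det1: "y2 t \<bullet> cross3 (y1 t) (y t) = 1" for t
  proof -
    have "y2 t \<bullet> cross3 (y1 t) (y t) = m t ^ 3 * \<Delta> t"
      unfolding Peq y2eq \<Delta>_def inner_add_left inner_scaleR_left inner_scaleR_right dot_cross_self
      by (simp add: power2_eq_square power3_eq_cube)
    then show ?thesis using m3 by simp
  qed
  \<comment> \<open>Since m' cancels in this cross product, \<open>P\<close> is as smooth as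
    \<open>y\<close>. Reading \<open>al\<close> off the second derivative of \<open>P\<close> rather
    than off y''' gains one degree of smoothness.\<close>
  define P where "P t = cross3 (y1 t) (y t)" for t
  have CkP: "Ck_on (n + 3) UNIV P"
    unfolding P_def[abs_def] Peq power2_eq_square by (intro Ck_on_scaleR Ck_on_mult Ckm Ck_on_cross3 Ck)
  have dP: "(P has_vector_derivative cross3 (y2 t) (y t)) (at t)" for t
    unfolding P_def[abs_def]
    using bounded_bilinear.has_vector_derivative[OF bounded_bilinear_cross3 y2(1)[of t] y1(1)[of t]] by simp
  have dP1: "((\<lambda>t. cross3 (y2 t) (y t)) has_vector_derivative cross3 (y2 t) (y1 t) + cross3 (y3 t) (y t)) (at t)" for t
    using bounded_bilinear.has_vector_derivative[OF bounded_bilinear_cross3 y3(1)[of t] y1(1)[of t]] by simp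
  have CkP1: "Ck_on (Suc (Suc n)) UNIV (\<lambda>t. cross3 (y2 t) (y t))"
    using Ck_on_deriv[OF CkP[unfolded n3] _ dP] by simp
  have CkP2: "Ck_on (Suc n) UNIV (\<lambda>t. cross3 (y2 t) (y1 t) + cross3 (y3 t) (y t))"
    using Ck_on_deriv[OF CkP1 _ dP1] by simp
  define al where "al t = - (1/2) * ((cross3 (y2 t) (y1 t) + cross3 (y3 t) (y t)) \<bullet> y2 t)" for t
  have Ckal: "Ck_on (Suc n) UNIV al"
    unfolding al_def[abs_def] by (intro Ck_on_mult Ck_on_const Ck_on_inner CkP2 y2(2))
  have aleq: "- 2 * al t = y2 t \<bullet> cross3 (y3 t) (y t)" for t
    unfolding al_def inner_commute[of _ "y2 t"] by (simp add: inner_add_right dot_cross_self)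
  obtain al1 where al1: "\<And>t. (al has_vector_derivative al1 t) (at t)" "Ck_on n UNIV al1"
    using Ck_on_UNIV_SucE[OF Ckal] by blast
  define b where "b t = - (y2 t \<bullet> cross3 (y1 t) (y3 t))" for t
  have Ckb: "Ck_on n UNIV b"
    unfolding b_def[abs_def]
    using Ck_on_SucD[OF Ck_on_SucD[OF y1(2)]] Ck_on_SucD[OF y2(2)]
    by (intro Ck_on_minus Ck_on_inner Ck_on_cross3 y3(2))
  \<comment> \<open>Differentiating det = 1 shows that y''' has no component along y'', so the
    equation has no second-order term.\<close>
  have y3P: "y3 t \<bullet> P t = 0" for t
  proof -
    have "((\<lambda>t. y2 t \<bullet> P t) has_vector_derivative y2 t \<bullet> cross3 (y2 t) (y t) + y3 t \<bullet> P t) (at t)"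
      using bounded_bilinear.has_vector_derivative[OF bounded_bilinear_inner y3(1)[of t] dP[of t]] .
    moreover have "(\<lambda>t. y2 t \<bullet> P t) = (\<lambda>t. 1)" using det1 by (simp add: P_def)
    ultimately have "y2 t \<bullet> cross3 (y2 t) (y t) + y3 t \<bullet> P t = 0"
      using vector_derivative_unique_at has_vector_derivative_const by metis
    then show ?thesis by (simp add: dot_cross_self)
  qed
  have ode: "y3 t = - (2 * al t) *\<^sub>R y1 t - b t *\<^sub>R y t" for t
  proof -
    have "y3 t = (y2 t \<bullet> cross3 (y3 t) (y t)) *\<^sub>R y1 t + (y2 t \<bullet> cross3 (y1 t) (y3 t)) *\<^sub>R y t"
      using cramer3[of "y2 t" "y1 t" "y t" "y3 t"] det1[of t] y3P[of t] by (simp add: P_def)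
    then show ?thesis unfolding aleq[symmetric] by (simp add: b_def)
  qed
  have perY1: "Y1 (t + 2 * pi) = Y1 t" for t using vector_derivative_periodic[OF Y_deriv Y_periodic] .
  have perY2: "Y2 (t + 2 * pi) = Y2 t" for t using vector_derivative_periodic[OF Y1_deriv perY1] .
  have pery: "y (t + 2 * pi) = y t" for t
    by (simp add: y_def m_def \<Delta>_def perY1 perY2 Y_periodic)
  have pery1: "y1 (t + 2 * pi) = y1 t" for t using vector_derivative_periodic[OF y1(1) pery] .
  have pery2: "y2 (t + 2 * pi) = y2 t" for t using vector_derivative_periodic[OF y2(1) pery1] .
  have pery3: "y3 (t + 2 * pi) = y3 t" for t using vector_derivative_periodic[OF y3(1) pery2] .
  have "unimodular_curve y y1 y2 y3 al al1 b w"
  proof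
    fix t a
    show "continuous_on UNIV al1" "continuous_on UNIV b"
      using Ck_on_continuous[OF al1(2)] Ck_on_continuous[OF Ckb] by auto
    show "al (t + 2 * pi) = al t" "b (t + 2 * pi) = b t"
      by (simp_all add: al_def b_def pery pery1 pery2 pery3)
    show "(al has_real_derivative al1 t) (at t)"
      using al1(1) by (simp add: real_vd_iff)
    show "0 < w \<bullet> y t" using m by (simp add: y_def w_Y)
    show "0 < y t \<bullet> cross3 (y1 a) (y a)" if "a < t" "t < a + 2 * pi"
      unfolding Peq using Y_global_convex[OF that] m[of t] m[of a] by (simp add: y_def)
  qed (rule y1(1) y2(1) y3(1) det1 ode pery)+
  then show thesis using that[of y y1 y2 y3 al al1 b m] Ckal Cky m y_def by blast
qed

text \<open>Integrating the positive periodic density 1/N gives a diffeomorphism of the line that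
  commutes with the period. Both it and its inverse are one degree smoother than
  \<open>N\<close>.\<close>

lemma periodic_change_of_variable:
  fixes N :: "real \<Rightarrow> real"
  assumes N: "\<And>t. N t > 0" "\<And>t. N (t + 2 * pi) = N t" "Ck_on n UNIV N"
  obtains lam \<sigma> \<tau> where "lam > 0" "\<And>t. (\<sigma> has_real_derivative lam / N t) (at t)"
    "\<And>s. (\<tau> has_real_derivative N (\<tau> s) / lam) (at s)"
    "\<And>s. \<sigma> (\<tau> s) = s" "\<And>t. \<tau> (\<sigma> t) = t" "\<And>t. \<sigma> (t + 2 * pi) = \<sigma> t + 2 * pi"
    "\<And>s. \<tau> (s + 2 * pi) = \<tau> s + 2 * pi" "Ck_on (Suc n) UNIV \<sigma>" "Ck_on (Suc n) UNIV \<tau>"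
proof -
  have cN: "continuous_on UNIV N" using Ck_on_continuous[OF N(3)] .
  have Nz: "N t \<noteq> 0" for t using N(1)[of t] by simp
  have cI: "continuous_on UNIV (\<lambda>t. 1 / N t)" using cN Nz by (intro continuous_intros) auto
  define F where "F = primitive (\<lambda>t. 1 / N t)"
  have F: "(F has_real_derivative 1 / N t) (at t)" "F 0 = 0" for t
    unfolding F_def using primitive_deriv[OF cI] primitive_0[OF cI] by auto
  have "F 0 < F (2 * pi)"
    using F(1) N(1) by (intro DERIV_pos_imp_increasing[of 0 "2 * pi" F]) (auto intro!: exI)
  then have F2: "F (2 * pi) > 0" using F(2) by simp
  \<comment> \<open>Normalizes the total length of one period to 2 pi in the new parameter.\<close>
  define lam where "lam = 2 * pi / F (2 * pi)"
  have lam: "lam > 0" using F2 by (simp add: lam_def)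
  define \<sigma> where "\<sigma> t = lam * F t" for t
  have d\<sigma>: "(\<sigma> has_real_derivative lam / N t) (at t)" for t
    unfolding \<sigma>_def[abs_def] using F(1)[of t] by (auto intro!: derivative_eq_intros)
  have c\<sigma>: "isCont \<sigma> t" for t using d\<sigma> DERIV_isCont by blast
  have per\<sigma>: "\<sigma> (t + 2 * pi) = \<sigma> t + 2 * pi" for t
  proof -
    have "((\<lambda>t. \<sigma> (t + 2 * pi) - \<sigma> t) has_real_derivative 0) (at t)" for t
    proof -
      have "((\<lambda>t. \<sigma> (t + 2 * pi)) has_real_derivative lam / N (t + 2 * pi)) (at t)"
        using d\<sigma>[of "t + 2 * pi"] by (simp add: DERIV_shift)
      from DERIV_diff[OF this d\<sigma>[of t]] show ?thesis using N(2) by simp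
    qed
    then have "\<sigma> (t + 2 * pi) - \<sigma> t = \<sigma> (0 + 2 * pi) - \<sigma> 0"
      using DERIV_isconst_all[of "\<lambda>t. \<sigma> (t + 2 * pi) - \<sigma> t" t 0] by blast
    then show ?thesis using F F2 by (simp add: \<sigma>_def lam_def)
  qed
  have mono: "\<sigma> s < \<sigma> t" if "s < t" for s t
    using that d\<sigma> N(1) lam by (intro DERIV_pos_imp_increasing[of s t \<sigma>]) (auto intro!: exI)
  have "\<exists>t. \<sigma> t = s" for s
  proof -
    obtain n :: int where n: "\<sigma> 0 \<le> s + of_int n * (2 * pi)" "s + of_int n * (2 * pi) < \<sigma> 0 + 2 * pi"
      using period_representative[of "2 * pi" "\<sigma> 0" s] by auto
    have "\<sigma> (2 * pi) = \<sigma> 0 + 2 * pi" using per\<sigma>[of 0] by simp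
    then obtain t where t: "\<sigma> t = s + of_int n * (2 * pi)"
    proof -
      have "continuous_on {0..2 * pi} \<sigma>" using c\<sigma> by (simp add: continuous_at_imp_continuous_on)
      from IVT'[OF n(1) _ _ this] that show thesis using n(2) \<open>\<sigma> (2 * pi) = \<sigma> 0 + 2 * pi\<close> by auto
    qed
    have "\<sigma> (t + of_int (- n) * (2 * pi)) - (t + of_int (- n) * (2 * pi)) = \<sigma> t - t"
      using per\<sigma> by (intro periodic_int_shift[of "\<lambda>t. \<sigma> t - t"]) auto
    then show ?thesis using t by (intro exI[of _ "t + of_int (- n) * (2 * pi)"]) simp
  qed
  then obtain \<tau> where \<sigma>\<tau>: "\<And>s. \<sigma> (\<tau> s) = s" by metis
  have inj: "s = t" if "\<sigma> s = \<sigma> t" for s t using mono[of s t] mono[of t s] that by linarith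
  have \<tau>\<sigma>: "\<tau> (\<sigma> t) = t" for t using inj \<sigma>\<tau> by blast
  have c\<tau>: "isCont \<tau> s" for s
    using isCont_inverse_function[of 1 "\<tau> s" \<tau> \<sigma>] \<tau>\<sigma> c\<sigma> \<sigma>\<tau> by simp
  have d\<tau>: "(\<tau> has_real_derivative N (\<tau> s) / lam) (at s)" for s
    using DERIV_inverse_function[of \<sigma> "lam / N (\<tau> s)" \<tau> s "s - 1" "s + 1"] d\<sigma> lam Nz \<sigma>\<tau> c\<tau> by simp
  have per\<tau>: "\<tau> (s + 2 * pi) = \<tau> s + 2 * pi" for s
    using per\<sigma>[of "\<tau> s"] \<sigma>\<tau> \<tau>\<sigma> by metis
  have "Ck_on n UNIV (\<lambda>t. lam / N t)" using Nz by (intro Ck_on_divide Ck_on_const N(3))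
  then have "Ck_on (Suc n) UNIV \<sigma>"
    using d\<sigma> by (intro Ck_on_SucI[where f = \<sigma>]) (auto simp: real_vd_iff)
  moreover have "Ck_on n UNIV (\<lambda>t. N t / lam)" using lam by (intro Ck_on_divide Ck_on_const N(3)) auto
  then have "Ck_on (Suc n) UNIV \<tau>"
    using d\<tau> by (intro Ck_on_inverse_function[where h = "\<lambda>t. N t / lam"]) (simp_all add: real_vd_iff)
  ultimately show thesis using that[of lam \<sigma> \<tau>] lam d\<sigma> d\<tau> \<sigma>\<tau> \<tau>\<sigma> per\<sigma> per\<tau> by blast
qed

text \<open>The weight 1/h keeps the determinant equal to 1: differentiation in the new parameter
  multiplies by \<open>h\<close>, which gives h^3 over the orders 0, 1 and 2, and each of the three
  vectors carries one factor 1/h.\<close>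

lemma (in unimodular_curve) reparametrized_ode:
  assumes h: "\<And>t. h t > 0" "\<And>t. h (t + 2 * pi) = h t"
    and dh: "\<And>t. (h has_real_derivative h1 t) (at t)" "\<And>t. (h1 has_real_derivative h2 t) (at t)"
      "\<And>t. (h2 has_real_derivative h3 t) (at t)"
    and C: "\<And>t. h t * h2 t - (h1 t)\<^sup>2 / 2 + al t * (h t)\<^sup>2 = C"
    and \<tau>: "\<And>s. (\<tau> has_real_derivative h (\<tau> s)) (at s)" "\<And>s. \<tau> (s + 2 * pi) = \<tau> s + 2 * pi"
    and z: "z = (\<lambda>s. (1 / h (\<tau> s)) *\<^sub>R y (\<tau> s))"
  obtains z1 z2 z3 \<beta> where "\<And>s. (z has_vector_derivative z1 s) (at s)" "\<And>s. (z1 has_vector_derivative z2 s) (at s)"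
    "\<And>s. (z2 has_vector_derivative z3 s) (at s)" "\<And>s. z2 s \<bullet> cross3 (z1 s) (z s) = 1"
    "\<And>s. z3 s + (2 * C) *\<^sub>R z1 s + \<beta> s *\<^sub>R z s = 0" "\<And>s. \<beta> (s + 2 * pi) = \<beta> s"
proof -
  have comp: "((\<lambda>s. F (\<tau> s)) has_vector_derivative h (\<tau> s) *\<^sub>R F' (\<tau> s)) (at s)"
    if "\<And>t. (F has_vector_derivative F' t) (at t)" for F F' :: "real \<Rightarrow> real^3" and s
    using vector_diff_chain_at[OF _ that, of \<tau> "h (\<tau> s)" s] \<tau>(1)
    by (simp add: o_def real_vd_iff)
  \<comment> \<open>\<open>F0\<close>, \<open>G1\<close>, \<open>G2\<close>, \<open>G3\<close> are
    \<open>z\<close> and its first three derivatives expressed in the old parameter, where each new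
    derivative is \<open>h\<close> times the old one. \<open>G3\<close> is written directly in the
    target form, and \<open>bb\<close> is the coefficient that makes this correct.\<close>
  define F0 where "F0 t = (1 / h t) *\<^sub>R y t" for t
  define G1 where "G1 t = y1 t - (h1 t / h t) *\<^sub>R y t" for t
  define G2 where "G2 t = h t *\<^sub>R y2 t - h1 t *\<^sub>R y1 t - (h2 t - (h1 t)\<^sup>2 / h t) *\<^sub>R y t" for t
  define bb where "bb t = h t * (h t)\<^sup>2 * b t + (h t)\<^sup>2 * h3 t - 2 * h t * h1 t * h2 t + h1 t ^ 3 + 2 * C * h1 t" for t
  define G3 where "G3 t = - (2 * C) *\<^sub>R G1 t - bb t *\<^sub>R F0 t" for t
  have hz: "h t \<noteq> 0" for t using h(1)[of t] by simp
  have d0: "(F0 has_vector_derivative (1 / h t) *\<^sub>R G1 t) (at t)" for t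
  proof -
    have "((\<lambda>t. 1 / h t) has_real_derivative - h1 t / (h t)\<^sup>2) (at t)"
      using dh(1)[of t] hz[of t] by (auto intro!: derivative_eq_intros simp: power2_eq_square)
    from has_vector_derivative_scaleR[OF this dy[of t]]
    have "(F0 has_vector_derivative (1 / h t) *\<^sub>R y1 t + (- h1 t / (h t)\<^sup>2) *\<^sub>R y t) (at t)"
      by (simp add: F0_def[abs_def])
    moreover have "(1 / h t) *\<^sub>R y1 t + (- h1 t / (h t)\<^sup>2) *\<^sub>R y t = (1 / h t) *\<^sub>R G1 t"
      by (simp add: G1_def algebra_simps power2_eq_square)
    ultimately show ?thesis by simp
  qed
  have d1: "(G1 has_vector_derivative (1 / h t) *\<^sub>R G2 t) (at t)" for t
  proof -
    have "((\<lambda>t. h1 t / h t) has_real_derivative (h2 t * h t - h1 t * h1 t) / (h t * h t)) (at t)"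
      using DERIV_divide[OF dh(2)[of t] dh(1)[of t] hz] .
    from has_vector_derivative_diff[OF dy1[of t] has_vector_derivative_scaleR[OF this dy[of t]]]
    have "(G1 has_vector_derivative y2 t - ((h1 t / h t) *\<^sub>R y1 t + ((h2 t * h t - h1 t * h1 t) / (h t * h t)) *\<^sub>R y t)) (at t)"
      by (simp add: G1_def[abs_def])
    moreover have q: "(h2 t * h t - h1 t * h1 t) / (h t * h t) = (1 / h t) * (h2 t - (h1 t)\<^sup>2 / h t)"
      using hz[of t] by (simp add: field_simps power2_eq_square)
    moreover have "u - ((a / c) *\<^sub>R v + (1 / c * x) *\<^sub>R x') = (1 / c) *\<^sub>R (c *\<^sub>R u - a *\<^sub>R v - x *\<^sub>R x')"
      if "c \<noteq> 0" for u v x' :: "real^3" and a c x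
      using that by (simp add: scaleR_diff_right)
    then have "y2 t - ((h1 t / h t) *\<^sub>R y1 t + ((h2 t * h t - h1 t * h1 t) / (h t * h t)) *\<^sub>R y t) = (1 / h t) *\<^sub>R G2 t"
      unfolding G2_def q using hz[of t] by blast
    ultimately show ?thesis by simp
  qed
  have d2: "(G2 has_vector_derivative (1 / h t) *\<^sub>R G3 t) (at t)" for t
  proof -
    let ?q = "h3 t - (2 * h1 t * h2 t * h t - h1 t ^ 3) / (h t)\<^sup>2"
    let ?l = "(h t *\<^sub>R y3 t + h1 t *\<^sub>R y2 t) - (h1 t *\<^sub>R y2 t + h2 t *\<^sub>R y1 t)
       - ((h2 t - (h1 t)\<^sup>2 / h t) *\<^sub>R y1 t + ?q *\<^sub>R y t)"
    have q: "((\<lambda>t. h2 t - (h1 t)\<^sup>2 / h t) has_real_derivative ?q) (at t)"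
      using dh(1)[of t] dh(2)[of t] dh(3)[of t] hz[of t]
      by (auto intro!: derivative_eq_intros simp: power2_eq_square power3_eq_cube)
    have "(G2 has_vector_derivative ?l) (at t)"
      unfolding G2_def[abs_def]
      by (intro has_vector_derivative_diff has_vector_derivative_scaleR dh q dy dy1 dy2)
    moreover have "?l = (1 / h t) *\<^sub>R G3 t"
    proof -
      have c1: "- (2 * al t * h t + h2 t + (h2 t - (h1 t)\<^sup>2 / h t)) = (1 / h t) * (- (2 * C))"
        unfolding C[of t, symmetric] using hz[of t] by (simp add: field_simps power2_eq_square)
      have c2: "- (b t * h t + ?q) = (1 / h t) * (2 * C * (h1 t / h t) - bb t * (1 / h t))"
        unfolding bb_def using hz[of t] by (simp add: field_simps power2_eq_square power3_eq_cube)
      have "?l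
        = (- (2 * al t * h t + h2 t + (h2 t - (h1 t)\<^sup>2 / h t))) *\<^sub>R y1 t + (- (b t * h t + ?q)) *\<^sub>R y t"
        unfolding ode by (simp add: vec_eq_iff algebra_simps)
      also have "\<dots> = (1 / h t) *\<^sub>R G3 t"
        unfolding c1 c2 G3_def G1_def F0_def by (simp add: vec_eq_iff algebra_simps)
      finally show ?thesis .
    qed
    ultimately show ?thesis by simp
  qed
  have hs: "h t *\<^sub>R (1 / h t) *\<^sub>R v = v" for t and v :: "real^3" using hz[of t] by simp
  have det: "G2 t \<bullet> cross3 (G1 t) (F0 t) = 1" for t
  proof -
    have "cross3 (G1 t) (F0 t) = (1 / h t) *\<^sub>R cross3 (y1 t) (y t)"
      unfolding G1_def F0_def by (simp add: cross3_simps forall_3 diff_divide_distrib)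
    then have "G2 t \<bullet> cross3 (G1 t) (F0 t) = y2 t \<bullet> cross3 (y1 t) (y t)"
      unfolding G2_def using hz[of t] by (simp add: inner_diff_left dot_cross_self)
    then show ?thesis using det1 by simp
  qed
  have per1: "h1 (t + 2 * pi) = h1 t" for t
    using vector_derivative_periodic[OF dh(1)[unfolded real_vd_iff] h(2)] .
  have per2: "h2 (t + 2 * pi) = h2 t" for t
    using vector_derivative_periodic[OF dh(2)[unfolded real_vd_iff] per1] .
  have per3: "h3 (t + 2 * pi) = h3 t" for t
    using vector_derivative_periodic[OF dh(3)[unfolded real_vd_iff] per2] .
  have zF: "z = (\<lambda>s. F0 (\<tau> s))" unfolding z F0_def ..
  show thesis
  proof (rule that[of "\<lambda>s. G1 (\<tau> s)" "\<lambda>s. G2 (\<tau> s)" "\<lambda>s. G3 (\<tau> s)" "\<lambda>s. bb (\<tau> s)"])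
    fix s
    show "(z has_vector_derivative G1 (\<tau> s)) (at s)" using comp[OF d0] unfolding zF hs .
    show "((\<lambda>s. G1 (\<tau> s)) has_vector_derivative G2 (\<tau> s)) (at s)" using comp[OF d1] unfolding hs .
    show "((\<lambda>s. G2 (\<tau> s)) has_vector_derivative G3 (\<tau> s)) (at s)" using comp[OF d2] unfolding hs .
    show "G2 (\<tau> s) \<bullet> cross3 (G1 (\<tau> s)) (z s) = 1" unfolding zF by (rule det)
    show "G3 (\<tau> s) + (2 * C) *\<^sub>R G1 (\<tau> s) + bb (\<tau> s) *\<^sub>R z s = 0" unfolding zF G3_def by simp
    show "bb (\<tau> (s + 2 * pi)) = bb (\<tau> s)"
      unfolding \<tau>(2) bb_def by (simp add: h(2) per1 per2 per3 per(3))
  qed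
qed

section \<open>Uniqueness of the constant\<close>

lemma second_derivative_at_max:
  fixes f :: "real \<Rightarrow> real"
  assumes d: "\<And>t. (f has_real_derivative f1 t) (at t)" "(f1 has_real_derivative f2) (at c)"
    and max: "\<And>t. f t \<le> f c"
  shows "f1 c = 0" "f2 \<le> 0"
proof -
  show f1: "f1 c = 0" using DERIV_local_max[OF d(1), of 1 c] max by auto
  show "f2 \<le> 0"
  proof (rule ccontr)
    assume "\<not> f2 \<le> 0"
    then obtain \<delta> where \<delta>: "\<delta> > 0" "\<And>h. 0 < h \<Longrightarrow> h < \<delta> \<Longrightarrow> f1 (c + h) > 0"
      using DERIV_pos_inc_right[OF d(2)] f1 by auto
    have "c < c + \<delta>/2" using \<delta> by simp
    from MVT2[OF this d(1)] obtain x where x: "c < x" "x < c + \<delta>/2" "f (c + \<delta>/2) - f c = (c + \<delta>/2 - c) * f1 x"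
      by blast
    have "f1 x > 0" using \<delta>(2)[of "x - c"] x by simp
    then have "(c + \<delta>/2 - c) * f1 x > 0" using \<delta>(1) by (intro mult_pos_pos) auto
    then have "f (c + \<delta>/2) > f c" using x(3) by linarith
    then show False using max[of "c + \<delta>/2"] by simp
  qed
qed

text \<open>Rotating the phase vector (f, f'/\<omega>) back by the angle \<omega> t leaves it
  constant.\<close>

lemma harmonic_oscillator_solution:
  fixes f f1 :: "real \<Rightarrow> real"
  assumes d: "\<And>t. (f has_real_derivative f1 t) (at t)" "\<And>t. (f1 has_real_derivative - \<omega>\<^sup>2 * f t) (at t)"
    and "\<omega> \<noteq> 0" "f 0 = 0"
  shows "f t = f1 0 / \<omega> * sin (\<omega> * t)"
proof -
  let ?p = "\<lambda>t. f t * cos (\<omega> * t) - f1 t / \<omega> * sin (\<omega> * t)"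
  let ?q = "\<lambda>t. f t * sin (\<omega> * t) + f1 t / \<omega> * cos (\<omega> * t)"
  have "(?p has_real_derivative 0) (at t)" for t
    using d(1)[of t] d(2)[of t] assms(3)
    by (auto intro!: derivative_eq_intros simp: field_simps power2_eq_square)
  then have p: "?p t = ?p 0" using DERIV_isconst_all[of ?p t 0] by blast
  have "(?q has_real_derivative 0) (at t)" for t
    using d(1)[of t] d(2)[of t] assms(3)
    by (auto intro!: derivative_eq_intros simp: field_simps power2_eq_square)
  then have q: "?q t = ?q 0" using DERIV_isconst_all[of ?q t 0] by blast
  have "f t = f t * ((cos (\<omega> * t))\<^sup>2 + (sin (\<omega> * t))\<^sup>2)" by simp
  also have "\<dots> = ?p t * cos (\<omega> * t) + ?q t * sin (\<omega> * t)" by (simp add: algebra_simps power2_eq_square del: sin_cos_squared_add sin_cos_squared_add2 sin_cos_squared_add3)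
  also have "\<dots> = f1 0 / \<omega> * sin (\<omega> * t)" unfolding p q using assms(4) by simp
  finally show ?thesis .
qed

text \<open>Two Hill potentials \<open>A/2\<close> and \<open>B/2\<close> related by a degree-one change of variable \<open>\<psi>\<close> with
  \<open>\<psi>' = 1/\<mu>\<close>; in the oscillatory case the zeros of the sines match.\<close>
lemma constant_potential_unique:
  fixes \<mu> \<psi> :: "real \<Rightarrow> real"
  assumes pos: "\<And>t. \<mu> t > 0" and per: "\<And>t. \<mu> (t + 2 * pi) = \<mu> t"
    and d: "\<And>t. (\<mu> has_real_derivative \<mu>1 t) (at t)" "\<And>t. (\<mu>1 has_real_derivative \<mu>2 t) (at t)"
    and eq: "\<And>t. \<mu> t * \<mu>2 t - (\<mu>1 t)\<^sup>2 / 2 + A * (\<mu> t)\<^sup>2 = B"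
    and \<psi>: "\<And>t. (\<psi> has_real_derivative 1 / \<mu> t) (at t)" "\<And>t. \<psi> (t + 2 * pi) = \<psi> t + 2 * pi"
  shows "A = B"
proof -
  have cont: "continuous_on UNIV \<mu>" using d(1) DERIV_isCont continuous_at_imp_continuous_on by blast
  obtain lo hi where lh: "\<And>t. \<mu> lo \<le> \<mu> t" "\<And>t. \<mu> t \<le> \<mu> hi"
    using periodic_attains_bounds[of \<mu> "2 * pi", OF per cont] by auto
  have "\<mu>1 hi = 0" "\<mu>2 hi \<le> 0" using second_derivative_at_max[OF d(1) d(2) lh(2)] by auto
  then have hi: "B \<le> A * (\<mu> hi)\<^sup>2" using eq[of hi] mult_nonneg_nonpos[of "\<mu> hi" "\<mu>2 hi"] pos[of hi] by simp
  have "- \<mu>1 lo = 0" "- \<mu>2 lo \<le> 0"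
    using second_derivative_at_max[of "\<lambda>t. - \<mu> t" "\<lambda>t. - \<mu>1 t" "- \<mu>2 lo" lo] d lh(1) by (auto intro!: DERIV_minus)
  moreover from this have "\<mu> lo * \<mu>2 lo \<ge> 0" using pos[of lo] by (intro mult_nonneg_nonneg) auto
  ultimately have lo: "B \<ge> A * (\<mu> lo)\<^sup>2" using eq[of lo] by simp
  \<comment> \<open>Degree one means that 1/\<mu> has mean 1 over a period, so it takes this value.
    Hence the extrema of \<mu> lie on the two sides of 1.\<close>
  have "\<exists>x. \<mu> x = 1"
  proof -
    have "(0::real) < 2 * pi" by simp
    from MVT2[OF this \<psi>(1)] obtain x where "\<psi> (2 * pi) - \<psi> 0 = (2 * pi - 0) * (1 / \<mu> x)" by blast
    then have "2 * pi = 2 * pi * (1 / \<mu> x)" using \<psi>(2)[of 0] by simp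
    then have "\<mu> x = 1" using pos[of x] by (simp add: field_simps)
    then show ?thesis ..
  qed
  then have one: "\<mu> lo \<le> 1" "1 \<le> \<mu> hi" using lh by metis+
  then have sq: "(\<mu> lo)\<^sup>2 \<le> 1" "1 \<le> (\<mu> hi)\<^sup>2" using pos[of lo] by (auto simp: power_le_one less_imp_le)
  show ?thesis
  proof (cases "A \<le> 0")
    case True
    then have "A * (\<mu> hi)\<^sup>2 \<le> A * 1" "A * 1 \<le> A * (\<mu> lo)\<^sup>2"
      by (rule mult_left_mono_neg[OF sq(2)], rule mult_left_mono_neg[OF sq(1)])
    then show ?thesis using hi lo by simp
  next
    case False
    then have A: "A > 0" by simp
    have "A * (\<mu> lo)\<^sup>2 > 0" using A pos[of lo] by simp
    then have B: "B > 0" using lo by linarith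
    define \<omega> where "\<omega> = sqrt (A / 2)"
    define \<omega>' where "\<omega>' = sqrt (B / 2)"
    have om: "\<omega> > 0" "\<omega>' > 0" "\<omega>\<^sup>2 = A / 2" "\<omega>'\<^sup>2 = B / 2" using A B by (auto simp: \<omega>_def \<omega>'_def)
    \<comment> \<open>The square root linearizes the relation between the potentials: it satisfies
      the Ermakov equation s'' + \<omega>^2 s = \<omega>'^2 / s^3.\<close>
    define s where "s t = sqrt (\<mu> t)" for t
    have s: "s t > 0" "(s t)\<^sup>2 = \<mu> t" "s t \<noteq> 0" for t using pos[of t] by (auto simp: s_def less_imp_neq[THEN not_sym])
    define s1 where "s1 t = \<mu>1 t / (2 * s t)" for t
    have ds: "(s has_real_derivative s1 t) (at t)" for t
      unfolding s_def[abs_def] s1_def using d(1)[of t] pos[of t]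
      by (auto intro!: derivative_eq_intros simp: s_def field_simps)
    have ds1: "(s1 has_real_derivative \<omega>'\<^sup>2 / s t ^ 3 - \<omega>\<^sup>2 * s t) (at t)" for t
    proof -
      have "(s1 has_real_derivative (\<mu>2 t * (2 * s t) - \<mu>1 t * (2 * s1 t)) / (2 * s t * (2 * s t))) (at t)"
        unfolding s1_def[abs_def] using s(3)[of t] d(2)[of t] ds[of t, unfolded s1_def]
        by (auto intro!: derivative_eq_intros)
      moreover have "(\<mu>2 t * (2 * s t) - \<mu>1 t * (2 * s1 t)) / (2 * s t * (2 * s t)) = \<omega>'\<^sup>2 / s t ^ 3 - \<omega>\<^sup>2 * s t"
      proof -
        have e: "(s t)\<^sup>2 * \<mu>2 t - (\<mu>1 t)\<^sup>2 / 2 + A * ((s t)\<^sup>2)\<^sup>2 = B" using eq[of t] s(2) by simp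
        show ?thesis unfolding om e[symmetric] s1_def using s(3)[of t]
          by (simp add: field_simps power2_eq_square power3_eq_cube)
      qed
      ultimately show ?thesis by simp
    qed
    define x where "x t = \<psi> t - \<psi> 0" for t
    have dx: "(x has_real_derivative 1 / (s t)\<^sup>2) (at t)" for t
      unfolding x_def[abs_def] s(2) using \<psi>(1)[of t] by (auto intro!: derivative_eq_intros)
    have x0: "x 0 = 0" by (simp add: x_def)
    \<comment> \<open>An oscillation of frequency \<omega>' in the new parameter, multiplied by an
      Ermakov solution, is an oscillation of frequency \<omega> in the old one.\<close>
    define f where "f t = s t * sin (\<omega>' * x t)" for t
    define f1 where "f1 t = s1 t * sin (\<omega>' * x t) + \<omega>' / s t * cos (\<omega>' * x t)" for t
    have df: "(f has_real_derivative f1 t) (at t)" for t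
      unfolding f_def[abs_def] f1_def using ds[of t] dx[of t] s(3)[of t]
      by (auto intro!: derivative_eq_intros simp: power2_eq_square field_simps)
    have df1: "(f1 has_real_derivative - \<omega>\<^sup>2 * f t) (at t)" for t
    proof -
      let ?e = "((\<omega>'\<^sup>2 / s t ^ 3 - \<omega>\<^sup>2 * s t) * sin (\<omega>' * x t) + (cos (\<omega>' * x t) * (\<omega>' * (1 / (s t)\<^sup>2))) * s1 t)
         + ((0 * s t - \<omega>' * s1 t) / (s t * s t) * cos (\<omega>' * x t) + (- sin (\<omega>' * x t) * (\<omega>' * (1 / (s t)\<^sup>2))) * (\<omega>' / s t))"
      have "(f1 has_real_derivative ?e) (at t)" unfolding f1_def[abs_def]
        by (intro DERIV_add DERIV_mult DERIV_divide DERIV_const ds1 ds s(3) DERIV_fun_sin DERIV_fun_cos DERIV_cmult dx)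
      moreover have "?e = - \<omega>\<^sup>2 * f t"
        unfolding f_def using s(3)[of t] by (simp add: field_simps power2_eq_square power3_eq_cube)
      ultimately show ?thesis by simp
    qed
    have sol: "s t * sin (\<omega>' * x t) = f1 0 / \<omega> * sin (\<omega> * t)" for t
      using harmonic_oscillator_solution[OF df df1, of t] om x0 by (simp add: f_def)
    have f10: "f1 0 > 0" using om s(1)[of 0] by (simp add: f1_def x0)
    have zeros: "sin (\<omega>' * x t) = 0 \<longleftrightarrow> sin (\<omega> * t) = 0" for t
      using sol[of t] s(3)[of t] f10 om by (metis divide_eq_0_iff less_irrefl mult_eq_0_iff)
    have xmono: "x a < x b" if "a < b" for a b
      using that dx s(3) by (intro DERIV_pos_imp_increasing[of a b x]) (auto intro!: exI)
    have xc: "continuous_on S x" for S using dx DERIV_isCont continuous_at_imp_continuous_on by blast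
    \<comment> \<open>Zeros of the two sines correspond in order. The induction excludes a skipped
      zero: it would lie strictly between two consecutive zeros of sin (\<omega> t).\<close>
    have match: "\<omega>' * x (real j * pi / \<omega>) = real j * pi" for j
    proof (induction j)
      case 0
      then show ?case by (simp add: x0)
    next
      case (Suc j)
      let ?T = "real j * pi / \<omega>" and ?T' = "real (Suc j) * pi / \<omega>"
      have TT: "?T < ?T'" using om by (simp add: divide_strict_right_mono)
      have "sin (\<omega> * ?T') = 0" using om sin_zero_iff_int2[of "\<omega> * ?T'"] by (auto intro!: exI[of _ "int (Suc j)"])
      then have "sin (\<omega>' * x ?T') = 0" using zeros by blast
      then obtain i :: int where i: "\<omega>' * x ?T' = of_int i * pi" unfolding sin_zero_iff_int2 by blast
      have "of_int (int j) * pi < of_int i * pi" using i Suc.IH xmono[OF TT] om by (metis mult_strict_left_mono of_int_of_nat_eq)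
      then have ij: "int j < i" by (simp del: of_int_of_nat_eq)
      have "\<not> i \<ge> int j + 2"
      proof
        assume "i \<ge> int j + 2"
        then have "real j + 1 \<le> of_int i" by linarith
        then have "(real j + 1) * pi \<le> of_int i * pi" by (intro mult_right_mono) auto
        then have "(real j + 1) * pi / \<omega>' \<le> x ?T'" unfolding i[symmetric] using om by (simp add: divide_le_eq mult.commute)
        moreover have "x ?T \<le> (real j + 1) * pi / \<omega>'"
          using Suc.IH om by (simp add: le_divide_eq mult.commute distrib_left)
        ultimately obtain t where t: "?T \<le> t" "t \<le> ?T'" "x t = (real j + 1) * pi / \<omega>'"
          using IVT'[of x ?T "(real j + 1) * pi / \<omega>'" ?T'] TT xc by auto
        have xt: "\<omega>' * x t = (real j + 1) * pi" using t(3) om by simp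
        have "t \<noteq> ?T" using xt Suc.IH by auto
        moreover have "t \<noteq> ?T'"
        proof
          assume "t = ?T'"
          then have "(real j + 1) * pi = of_int i * pi" using xt i by simp
          then show False using \<open>i \<ge> int j + 2\<close> by simp
        qed
        ultimately have t': "?T < t" "t < ?T'" using t by auto
        have "sin (\<omega>' * x t) = 0" unfolding xt sin_zero_iff_int2 by (intro exI[of _ "int j + 1"]) simp
        then have "sin (\<omega> * t) = 0" using zeros by blast
        then obtain l :: int where "\<omega> * t = of_int l * pi" unfolding sin_zero_iff_int2 by blast
        moreover have "real j * pi < \<omega> * t" "\<omega> * t < real (Suc j) * pi" using t' om by (simp_all add: field_simps)
        ultimately have "of_int (int j) < (of_int l :: real)" "of_int l < (of_int (int j + 1) :: real)" by simp_all
        then show False unfolding of_int_less_iff by linarith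
      qed
      then have "i = int (Suc j)" using ij by simp
      then show ?case using i by simp
    qed
    \<comment> \<open>As \<open>x\<close> stays within bounded distance of the identity, the matched
      zeros j pi / \<omega> and j pi / \<omega>' cannot drift apart linearly in
      \<open>j\<close>.\<close>
    have "(\<lambda>t. x t - t) (t + 2 * pi) = (\<lambda>t. x t - t) t" for t using \<psi>(2)[of t] by (simp add: x_def)
    moreover have "continuous_on UNIV (\<lambda>t. x t - t)" by (intro continuous_intros xc)
    ultimately obtain lo' hi' where b: "\<And>t. x lo' - lo' \<le> x t - t" "\<And>t. x t - t \<le> x hi' - hi'"
      using periodic_attains_bounds[of "\<lambda>t. x t - t" "2 * pi"] by auto
    define M where "M = \<bar>x lo' - lo'\<bar> + \<bar>x hi' - hi'\<bar>"
    have M: "\<bar>x t - t\<bar> \<le> M" for t using b(1)[of t] b(2)[of t] unfolding M_def by linarith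
    have "pi / \<omega>' - pi / \<omega> = 0"
    proof (rule ccontr)
      assume "pi / \<omega>' - pi / \<omega> \<noteq> 0"
      then obtain j :: nat where j: "M < real j * \<bar>pi / \<omega>' - pi / \<omega>\<bar>"
        using reals_Archimedean3[of "\<bar>pi / \<omega>' - pi / \<omega>\<bar>"] by auto
      have "x (real j * pi / \<omega>) = real j * pi / \<omega>'" using match[of j] om by (simp add: field_simps)
      then have "x (real j * pi / \<omega>) - real j * pi / \<omega> = real j * (pi / \<omega>' - pi / \<omega>)" by (simp add: algebra_simps)
      then show False using M[of "real j * pi / \<omega>"] j by (simp add: abs_mult)
    qed
    then have "\<omega>' = \<omega>" using om by (simp add: field_simps)
    then show ?thesis using om by simp
  qed
qed

text \<open>A smooth branch of the polar angle is built by integrating the derivative that an angle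
  must have, and is afterwards shown to be the angle; this avoids gluing local branches of an
  inverse trigonometric function.\<close>

lemma (in cone_chart) angle_lift:
  fixes x :: "real \<Rightarrow> real^3"
  assumes x: "Ck_on 3 UNIV x" "\<And>t. x t \<in> frontier K - {0}"
  obtains \<theta> where "Ck_on 3 UNIV \<theta>" "\<And>t. x t = (w \<bullet> x t) *\<^sub>R Y (\<theta> t)"
proof -
  have wx: "w \<bullet> x t > 0" for t using frontier_pos[OF x(2)] .
  define p where "p t = (1 / (w \<bullet> x t)) *\<^sub>R x t - e" for t
  have wp: "w \<bullet> p t = 0" for t using wx[of t] we by (simp add: p_def inner_diff_right)
  have Ckp: "Ck_on 3 UNIV p"
    unfolding p_def[abs_def] using wx
    by (intro Ck_on_diff Ck_on_scaleR Ck_on_divide Ck_on_inner Ck_on_const x(1)) (auto simp: less_imp_neq[THEN not_sym])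
  have fr: "e + p t \<in> frontier K" for t
    using frontier_scale[of "x t" "1 / (w \<bullet> x t)"] x(2)[of t] wx[of t] by (simp add: p_def)
  define a where "a t = p t \<bullet> e1" for t
  define b where "b t = p t \<bullet> e2" for t
  have pab: "p t = a t *\<^sub>R e1 + b t *\<^sub>R e2" for t unfolding a_def b_def using span[OF wp] .
  have Cka: "Ck_on 3 UNIV a" "Ck_on 3 UNIV b"
    unfolding a_def[abs_def] b_def[abs_def] by (intro Ck_on_inner Ck_on_const Ckp)+
  have S3: "(3::nat) = Suc 2" by simp
  obtain a1 where a1: "\<And>t. (a has_vector_derivative a1 t) (at t)" "Ck_on 2 UNIV a1"
    using Ck_on_UNIV_SucE[OF Cka(1)[unfolded S3]] by blast
  obtain b1 where b1: "\<And>t. (b has_vector_derivative b1 t) (at t)" "Ck_on 2 UNIV b1"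
    using Ck_on_UNIV_SucE[OF Cka(2)[unfolded S3]] by blast
  have da: "(a has_real_derivative a1 t) (at t)" "(b has_real_derivative b1 t) (at t)" for t
    using a1(1) b1(1) by (simp_all add: real_vd_iff)
  define R where "R t = (a t)\<^sup>2 + (b t)\<^sup>2" for t
  have R: "R t > 0" for t
  proof -
    have "p t \<noteq> 0" using fr[of t] eint by (auto simp: frontier_def)
    then have "a t \<noteq> 0 \<or> b t \<noteq> 0" using pab[of t] by auto
    then show ?thesis unfolding R_def by (simp add: sum_power2_gt_zero_iff)
  qed
  have CkR: "Ck_on 2 UNIV R" unfolding R_def[abs_def] power2_eq_square
    using Ck_on_mono[OF Cka(1), of 2] Ck_on_mono[OF Cka(2), of 2] by (intro Ck_on_add Ck_on_mult) auto
  define \<theta>1 where "\<theta>1 t = (a t * b1 t - b t * a1 t) / R t" for t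
  have Ck1: "Ck_on 2 UNIV \<theta>1" unfolding \<theta>1_def[abs_def]
    using Ck_on_mono[OF Cka(1), of 2] Ck_on_mono[OF Cka(2), of 2] a1 b1 R CkR
    by (intro Ck_on_divide Ck_on_diff Ck_on_mult) (auto simp: less_imp_neq[THEN not_sym])
  obtain r0 t0 where r0: "r0 \<ge> 0" "e + p 0 = e + r0 *\<^sub>R d t0"
    using polar_form[of "e + p 0"] we wp by (auto simp: inner_add_right)
  have c1: "continuous_on UNIV \<theta>1" using Ck_on_continuous[OF Ck1] .
  define \<theta> where "\<theta> t = t0 + primitive \<theta>1 t" for t
  have d\<theta>: "(\<theta> has_real_derivative \<theta>1 t) (at t)" for t
    unfolding \<theta>_def[abs_def] using primitive_deriv[OF c1, of t] by (auto intro!: derivative_eq_intros)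
  have \<theta>0: "\<theta> 0 = t0" using primitive_0[OF c1] by (simp add: \<theta>_def)
  have Ck\<theta>: "Ck_on 3 UNIV \<theta>" unfolding S3
    using d\<theta> Ck1 by (intro Ck_on_SucI[where f = \<theta> and f' = \<theta>1]) (auto simp: real_vd_iff)
  define F where "F t = b t * cos (\<theta> t) - a t * sin (\<theta> t)" for t
  define G where "G t = a t * cos (\<theta> t) + b t * sin (\<theta> t)" for t
  define F1 where "F1 t = b1 t * cos (\<theta> t) - a1 t * sin (\<theta> t) - \<theta>1 t * G t" for t
  have dF: "(F has_real_derivative F1 t) (at t)" for t
    unfolding F_def[abs_def] F1_def G_def using da[of t] d\<theta>[of t]
    by (auto intro!: derivative_eq_intros simp: algebra_simps)
  have dR: "(R has_real_derivative 2 * (a t * a1 t + b t * b1 t)) (at t)" for t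
    unfolding R_def[abs_def] using da[of t] by (auto intro!: derivative_eq_intros simp: algebra_simps)
  have RF: "R t * F1 t = (a t * a1 t + b t * b1 t) * F t" for t
  proof -
    have "R t * \<theta>1 t = a t * b1 t - b t * a1 t" using R[of t] by (simp add: \<theta>1_def)
    moreover have "R t * F1 t = R t * (b1 t * cos (\<theta> t) - a1 t * sin (\<theta> t)) - R t * \<theta>1 t * G t"
      unfolding F1_def by (simp add: algebra_simps)
    ultimately have "R t * F1 t = R t * (b1 t * cos (\<theta> t) - a1 t * sin (\<theta> t)) - (a t * b1 t - b t * a1 t) * G t"
      by simp
    then show ?thesis unfolding R_def F_def G_def by (simp add: algebra_simps power2_eq_square)
  qed
  \<comment> \<open>\<open>F\<close> and \<open>G\<close> are the components of (a, b) across and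
    along the direction \<theta>. The quotient is the squared sine of the error in the angle; it is
    constant and vanishes at 0.\<close>
  have "((\<lambda>t. (F t)\<^sup>2 / R t) has_real_derivative 0) (at t)" for t
  proof -
    have "((\<lambda>t. (F t)\<^sup>2 / R t) has_real_derivative
       (2 * F t * F1 t * R t - (F t)\<^sup>2 * (2 * (a t * a1 t + b t * b1 t))) / (R t * R t)) (at t)"
      using dF[of t] dR[of t] R[of t] by (auto intro!: derivative_eq_intros)
    moreover have "2 * F t * F1 t * R t - (F t)\<^sup>2 * (2 * (a t * a1 t + b t * b1 t)) = 0"
      using RF[of t] by algebra
    ultimately show ?thesis by simp
  qed
  then have "(F t)\<^sup>2 / R t = (F 0)\<^sup>2 / R 0" for t
    using DERIV_isconst_all[of "\<lambda>t. (F t)\<^sup>2 / R t" t 0] by blast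
  moreover have ab0: "a 0 = r0 * cos t0" "b 0 = r0 * sin t0"
    using r0 d_inner by (simp_all add: a_def b_def)
  then have "F 0 = 0" by (simp add: F_def \<theta>0)
  ultimately have "(F t)\<^sup>2 / R t = 0" for t by simp
  then have F0: "F t = 0" for t using R[of t] by (metis divide_eq_0_iff less_irrefl power_eq_0_iff)
  have aG: "a t = G t * cos (\<theta> t)" "b t = G t * sin (\<theta> t)" for t
  proof -
    have "a t = a t * ((cos (\<theta> t))\<^sup>2 + (sin (\<theta> t))\<^sup>2)" "b t = b t * ((cos (\<theta> t))\<^sup>2 + (sin (\<theta> t))\<^sup>2)" by simp_all
    then have "a t = G t * cos (\<theta> t) - F t * sin (\<theta> t)" "b t = G t * sin (\<theta> t) + F t * cos (\<theta> t)"
      unfolding G_def F_def by algebra+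
    then show "a t = G t * cos (\<theta> t)" "b t = G t * sin (\<theta> t)" using F0 by simp_all
  qed
  \<comment> \<open>A vanishing sine leaves the angle undetermined by pi. As \<open>G\<close> has no
    zero and is positive at 0, the correct direction persists.\<close>
  have Gnz: "G t \<noteq> 0" for t
  proof
    assume "G t = 0"
    then have "R t = 0" using aG[of t] by (simp add: R_def)
    then show False using R[of t] by simp
  qed
  have cG: "isCont G t" for t
    unfolding G_def[abs_def] using DERIV_isCont[OF da(1)] DERIV_isCont[OF da(2)] DERIV_isCont[OF d\<theta>]
    by (intro continuous_intros) auto
  have "G 0 = r0 * ((cos t0)\<^sup>2 + (sin t0)\<^sup>2)"
    by (simp only: G_def \<theta>0 ab0 power2_eq_square distrib_left mult.assoc)
  then have G0: "G 0 > 0" using r0(1) Gnz[of 0] by simp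
  have Gpos: "G t > 0" for t
  proof (rule ccontr)
    assume "\<not> G t > 0"
    then have "G t \<le> 0" by simp
    have con: "continuous_on S G" for S using cG by (simp add: continuous_at_imp_continuous_on)
    show False
    proof (cases "0 \<le> t")
      case True
      then show False using IVT2'[of G t 0 0] \<open>G t \<le> 0\<close> G0 con Gnz by force
    next
      case False
      then show False using IVT'[of G t 0 0] \<open>G t \<le> 0\<close> G0 con Gnz by force
    qed
  qed
  have "x t = (w \<bullet> x t) *\<^sub>R Y (\<theta> t)" for t
  proof -
    have "p t = G t *\<^sub>R d (\<theta> t)" unfolding pab d_def using aG[of t] by (simp add: scaleR_add_right)
    then have "e + p t = Y (\<theta> t)" using frontier_ray_eq_Y[of "G t" "\<theta> t"] fr[of t] Gpos[of t] by simp
    moreover have "x t = (w \<bullet> x t) *\<^sub>R (e + p t)" using wx[of t] by (simp add: p_def)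
    ultimately show ?thesis by metis
  qed
  then show thesis using that[of \<theta>] Ck\<theta> by blast
qed

text \<open>Both lifts run over the same rays, so x = \<mu> (z \<circ> \<psi>). The common
  determinant forces \<psi>' = 1/\<mu>, the two equations give the relation between the constants
  and \<mu>, and injectivity makes \<psi> a map of degree one.\<close>

lemma (in cone_chart) lift_constant_unique:
  fixes x x1 x2 x3 z z1 z2 z3 :: "real \<Rightarrow> real^3"
  assumes z: "\<And>s. (z has_vector_derivative z1 s) (at s)" "\<And>s. (z1 has_vector_derivative z2 s) (at s)"
      "\<And>s. (z2 has_vector_derivative z3 s) (at s)" "\<And>s. z2 s \<bullet> cross3 (z1 s) (z s) = 1"
      "\<And>s. z3 s + (2 * B) *\<^sub>R z1 s + \<beta> s *\<^sub>R z s = 0" "\<And>s. z (s + 2 * pi) = z s" "Ck_on 3 UNIV z"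
    and zY: "\<And>s. z s = m s *\<^sub>R Y (\<tau> s)" "\<And>s. m s > 0"
    and \<sigma>: "\<And>t. \<tau> (\<sigma> t) = t" "\<And>t. \<sigma> (t + 2 * pi) = \<sigma> t + 2 * pi" "Ck_on 3 UNIV \<sigma>"
    and x: "\<And>s. (x has_vector_derivative x1 s) (at s)" "\<And>s. (x1 has_vector_derivative x2 s) (at s)"
      "\<And>s. (x2 has_vector_derivative x3 s) (at s)" "\<And>s. x2 s \<bullet> cross3 (x1 s) (x s) = 1"
      "\<And>s. x3 s + (2 * A) *\<^sub>R x1 s + \<gamma> s *\<^sub>R x s = 0" "\<And>s. x (s + 2 * pi) = x s" "Ck_on 3 UNIV x"
    and xK: "\<And>t. x t \<in> frontier K - {0}"
    and inj: "\<And>t a. 0 < t \<Longrightarrow> t < 2 * pi \<Longrightarrow> x t \<noteq> a *\<^sub>R x 0"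
  shows "A = B"
proof -
  obtain \<theta> where \<theta>: "Ck_on 3 UNIV \<theta>" "\<And>t. x t = (w \<bullet> x t) *\<^sub>R Y (\<theta> t)"
    using angle_lift[OF x(7) xK] by blast
  define \<psi> where "\<psi> t = \<sigma> (\<theta> t)" for t
  have Ck\<psi>: "Ck_on 3 UNIV \<psi>" unfolding \<psi>_def[abs_def] using Ck_on_compose[OF \<sigma>(3) \<theta>(1)] by simp
  have wx: "w \<bullet> x t > 0" for t using frontier_pos[OF xK] .
  have wz: "w \<bullet> z s = m s" for s by (simp add: zY(1) w_Y)
  define \<mu> where "\<mu> t = (w \<bullet> x t) / (w \<bullet> z (\<psi> t))" for t
  have \<mu>: "\<mu> t > 0" for t using wx wz zY(2) by (simp add: \<mu>_def)
  have x\<mu>: "x t = \<mu> t *\<^sub>R z (\<psi> t)" for t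
  proof -
    have "z (\<psi> t) = m (\<psi> t) *\<^sub>R Y (\<theta> t)" by (simp add: zY(1) \<psi>_def \<sigma>(1))
    moreover have "\<mu> t * m (\<psi> t) = w \<bullet> x t" using zY(2)[of "\<psi> t"] by (simp add: \<mu>_def wz)
    ultimately have "\<mu> t *\<^sub>R z (\<psi> t) = (w \<bullet> x t) *\<^sub>R Y (\<theta> t)" by simp
    then show ?thesis using \<theta>(2)[of t] by metis
  qed
  have Ckz\<psi>: "Ck_on 3 UNIV (\<lambda>t. z (\<psi> t))" using Ck_on_compose[OF z(7) Ck\<psi>] by simp
  have Ck\<mu>: "Ck_on 3 UNIV \<mu>"
    unfolding \<mu>_def[abs_def] using wz zY(2)
    by (intro Ck_on_divide Ck_on_inner Ck_on_const x(7) Ckz\<psi>) (auto simp: less_imp_neq[THEN not_sym])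
  have S: "(3::nat) = Suc 2" "(2::nat) = Suc 1" "(1::nat) = Suc 0" by simp_all
  obtain \<mu>1 where \<mu>1: "\<And>t. (\<mu> has_vector_derivative \<mu>1 t) (at t)" "Ck_on 2 UNIV \<mu>1"
    using Ck_on_UNIV_SucE[OF Ck\<mu>[unfolded S(1)]] by blast
  obtain \<mu>2 where \<mu>2: "\<And>t. (\<mu>1 has_vector_derivative \<mu>2 t) (at t)" "Ck_on 1 UNIV \<mu>2"
    using Ck_on_UNIV_SucE[OF \<mu>1(2)[unfolded S(2)]] by blast
  obtain \<mu>3 where \<mu>3: "\<And>t. (\<mu>2 has_vector_derivative \<mu>3 t) (at t)"
    using Ck_on_UNIV_SucE[OF \<mu>2(2)[unfolded S(3)]] by blast
  obtain \<kappa> where \<kappa>: "\<And>t. (\<psi> has_vector_derivative \<kappa> t) (at t)" "Ck_on 2 UNIV \<kappa>"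
    using Ck_on_UNIV_SucE[OF Ck\<psi>[unfolded S(1)]] by blast
  have comp: "((\<lambda>t. F (\<psi> t)) has_vector_derivative \<kappa> t *\<^sub>R F' (\<psi> t)) (at t)"
    if "\<And>t. (F has_vector_derivative F' t) (at t)" for F F' :: "real \<Rightarrow> real^3" and t
    using vector_diff_chain_at[OF \<kappa>(1) that] by (simp add: o_def)
  have scal: "((\<lambda>t. a t *\<^sub>R f t) has_vector_derivative a t *\<^sub>R f' + a' *\<^sub>R f t) (at t)"
    if "(a has_vector_derivative a') (at t)" "(f has_vector_derivative f') (at t)"
    for a :: "real \<Rightarrow> real" and a' and f :: "real \<Rightarrow> real^3" and f' t
    by (rule has_vector_derivative_scaleR[OF that(1)[unfolded real_vd_iff[symmetric]] that(2)])
  define p where "p t = \<mu> t * \<kappa> t" for t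
  have x1eq: "x1 t = p t *\<^sub>R z1 (\<psi> t) + \<mu>1 t *\<^sub>R z (\<psi> t)" for t
  proof -
    have "((\<lambda>t. \<mu> t *\<^sub>R z (\<psi> t)) has_vector_derivative \<mu> t *\<^sub>R (\<kappa> t *\<^sub>R z1 (\<psi> t)) + \<mu>1 t *\<^sub>R z (\<psi> t)) (at t)"
      by (intro scal \<mu>1 comp z)
    moreover have "x = (\<lambda>t. \<mu> t *\<^sub>R z (\<psi> t))" by (rule ext) (rule x\<mu>)
    ultimately have "(x has_vector_derivative \<mu> t *\<^sub>R (\<kappa> t *\<^sub>R z1 (\<psi> t)) + \<mu>1 t *\<^sub>R z (\<psi> t)) (at t)" by simp
    from vector_derivative_unique_at[OF x(1) this] show ?thesis by (simp add: p_def)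
  qed
  have "Ck_on (Suc 1) UNIV p"
    unfolding p_def[abs_def] S(2)[symmetric] using Ck_on_mono[OF Ck\<mu>, of 2] \<kappa>(2) by (intro Ck_on_mult) auto
  then obtain p1 where p1: "\<And>t. (p has_vector_derivative p1 t) (at t)" using Ck_on_UNIV_SucE by blast
  have x2eq: "x2 t = (p t *\<^sub>R (\<kappa> t *\<^sub>R z2 (\<psi> t)) + p1 t *\<^sub>R z1 (\<psi> t)) + (\<mu>1 t *\<^sub>R (\<kappa> t *\<^sub>R z1 (\<psi> t)) + \<mu>2 t *\<^sub>R z (\<psi> t))"
    (is "_ = ?r") for t
  proof -
    have "x1 = (\<lambda>t. p t *\<^sub>R z1 (\<psi> t) + \<mu>1 t *\<^sub>R z (\<psi> t))" by (rule ext) (rule x1eq)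
    moreover have "((\<lambda>t. p t *\<^sub>R z1 (\<psi> t) + \<mu>1 t *\<^sub>R z (\<psi> t)) has_vector_derivative ?r) (at t)"
      by (intro has_vector_derivative_add scal \<mu>2 p1 comp z)
    ultimately show ?thesis using vector_derivative_unique_at[OF x(2)] by simp
  qed
  \<comment> \<open>The determinants of \<open>x\<close> and of \<open>z\<close> are both 1 and
    differ by the factor (\<mu> \<psi>')^3; the real cube root is unique.\<close>
  have p: "p t = 1" for t
  proof -
    have "cross3 (x1 t) (x t) = (p t * \<mu> t) *\<^sub>R cross3 (z1 (\<psi> t)) (z (\<psi> t))"
      unfolding x1eq x\<mu> by (simp add: cross3_simps forall_3)
    then have "1 = (p t * \<mu> t) * (x2 t \<bullet> cross3 (z1 (\<psi> t)) (z (\<psi> t)))" using x(4)[of t] by simp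
    also have "x2 t \<bullet> cross3 (z1 (\<psi> t)) (z (\<psi> t)) = p t * \<kappa> t"
      unfolding x2eq inner_add_left inner_scaleR_left dot_cross_self z(4) by simp
    finally have "p t ^ 3 = 1" by (simp add: p_def power3_eq_cube mult_ac)
    then have "(p t - 1) * ((p t)\<^sup>2 + p t + 1) = 0" by (simp add: algebra_simps power2_eq_square power3_eq_cube)
    moreover have "(p t)\<^sup>2 + p t + 1 = (p t + 1/2)\<^sup>2 + 3/4" by (simp add: power2_eq_square algebra_simps)
    then have "(p t)\<^sup>2 + p t + 1 > 0" by (simp add: add_nonneg_pos)
    ultimately show ?thesis by simp
  qed
  have \<kappa>\<mu>: "\<kappa> t = 1 / \<mu> t" for t using p[of t] \<mu>[of t] by (simp add: p_def field_simps)
  have "p1 t = 0" for t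
  proof -
    have "p = (\<lambda>t. 1)" using p by (intro ext)
    then have "(p has_vector_derivative 0) (at t)" by simp
    then show ?thesis using p1 vector_derivative_unique_at by blast
  qed
  then have x2eq': "x2 t = (1 / \<mu> t) *\<^sub>R z2 (\<psi> t) + (\<mu>1 t / \<mu> t) *\<^sub>R z1 (\<psi> t) + \<mu>2 t *\<^sub>R z (\<psi> t)" for t
    using x2eq[of t] by (simp add: p \<kappa>\<mu>)
  have x3eq: "x3 t = ((1 / \<mu> t) *\<^sub>R (\<kappa> t *\<^sub>R z3 (\<psi> t)) + (- \<mu>1 t / (\<mu> t)\<^sup>2) *\<^sub>R z2 (\<psi> t))
      + ((\<mu>1 t / \<mu> t) *\<^sub>R (\<kappa> t *\<^sub>R z2 (\<psi> t)) + ((\<mu>2 t * \<mu> t - \<mu>1 t * \<mu>1 t) / (\<mu> t * \<mu> t)) *\<^sub>R z1 (\<psi> t))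
      + (\<mu>2 t *\<^sub>R (\<kappa> t *\<^sub>R z1 (\<psi> t)) + \<mu>3 t *\<^sub>R z (\<psi> t))" (is "_ = ?r") for t
  proof -
    let ?f = "\<lambda>t. (1 / \<mu> t) *\<^sub>R z2 (\<psi> t) + (\<mu>1 t / \<mu> t) *\<^sub>R z1 (\<psi> t) + \<mu>2 t *\<^sub>R z (\<psi> t)"
    have d: "(\<mu> has_real_derivative \<mu>1 t) (at t)" "(\<mu>1 has_real_derivative \<mu>2 t) (at t)"
      using \<mu>1(1) \<mu>2(1) by (simp_all add: real_vd_iff)
    have "((\<lambda>t. 1 / \<mu> t) has_real_derivative - \<mu>1 t / (\<mu> t)\<^sup>2) (at t)"
      using d(1) \<mu>[of t] by (auto intro!: derivative_eq_intros simp: power2_eq_square)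
    moreover have "((\<lambda>t. \<mu>1 t / \<mu> t) has_real_derivative (\<mu>2 t * \<mu> t - \<mu>1 t * \<mu>1 t) / (\<mu> t * \<mu> t)) (at t)"
      using DERIV_divide[OF d(2,1)] \<mu>[of t] by simp
    ultimately have "(?f has_vector_derivative ?r) (at t)"
      by (intro has_vector_derivative_add scal \<mu>3 comp z) (simp_all add: real_vd_iff)
    moreover have "x2 = ?f" by (rule ext) (rule x2eq')
    ultimately show ?thesis using vector_derivative_unique_at[OF x(3)] by simp
  qed
  have eq: "\<mu> t * \<mu>2 t - (\<mu>1 t)\<^sup>2 / 2 + A * (\<mu> t)\<^sup>2 = B" for t
  proof -
    \<comment> \<open>This covector annihilates \<open>z\<close> and z'', so pairing with it
      isolates the coefficient of z' and removes the unknown functions \<open>\<beta>\<close> and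
      \<open>\<gamma>\<close>.\<close>
    define n where "n = cross3 (z2 (\<psi> t)) (z (\<psi> t))"
    have n: "z (\<psi> t) \<bullet> n = 0" "z2 (\<psi> t) \<bullet> n = 0" by (simp_all add: n_def dot_cross_self)
    have n1: "z1 (\<psi> t) \<bullet> n = - 1"
    proof -
      have "z1 (\<psi> t) \<bullet> n = - (z2 (\<psi> t) \<bullet> cross3 (z1 (\<psi> t)) (z (\<psi> t)))"
        unfolding n_def by (simp add: cross3_simps)
      then show ?thesis using z(4) by simp
    qed
    have "(z3 (\<psi> t) + (2 * B) *\<^sub>R z1 (\<psi> t) + \<beta> (\<psi> t) *\<^sub>R z (\<psi> t)) \<bullet> n = 0" unfolding z(5) by simp
    then have n3: "z3 (\<psi> t) \<bullet> n = 2 * B" using n n1 by (simp add: inner_add_left)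
    have "(x3 t + (2 * A) *\<^sub>R x1 t + \<gamma> t *\<^sub>R x t) \<bullet> n = 0" unfolding x(5) by simp
    then have "(1 / \<mu> t) * (1 / \<mu> t * (2 * B)) - (\<mu>2 t * \<mu> t - \<mu>1 t * \<mu>1 t) / (\<mu> t * \<mu> t) - \<mu>2 t * (1 / \<mu> t) - 2 * A = 0"
      unfolding x3eq x1eq x\<mu> p \<kappa>\<mu> inner_add_left inner_scaleR_left n n1 n3 by (simp add: diff_divide_distrib algebra_simps)
    moreover have "q\<^sup>2 * ((1 / q) * (1 / q * k) - (a * q - b * b) / (q * q) - a * (1 / q) - l)
      = k - (a * q - b * b) - a * q - l * q\<^sup>2" if "q \<noteq> 0" for q k a b l :: real
      using that by (simp add: field_simps power2_eq_square)
    ultimately have "2 * B - (\<mu>2 t * \<mu> t - \<mu>1 t * \<mu>1 t) - \<mu>2 t * \<mu> t - 2 * A * (\<mu> t)\<^sup>2 = 0"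
      using \<mu>[of t] by (metis less_irrefl mult_zero_right)
    then show ?thesis by (simp add: power2_eq_square algebra_simps)
  qed
  have shift: "\<exists>n::int. \<psi> (t + 2 * pi) = \<psi> t + of_int n * (2 * pi)" for t
  proof -
    have "(w \<bullet> x t) *\<^sub>R Y (\<theta> (t + 2 * pi)) = (w \<bullet> x t) *\<^sub>R Y (\<theta> t)"
    proof -
      have "x t = (w \<bullet> x t) *\<^sub>R Y (\<theta> (t + 2 * pi))" using \<theta>(2)[of "t + 2 * pi"] unfolding x(6) .
      from trans[OF this[symmetric] \<theta>(2)[of t]] show ?thesis .
    qed
    then have "Y (\<theta> (t + 2 * pi)) = Y (\<theta> t)" using wx[of t] by simp
    then obtain n :: int where n: "\<theta> (t + 2 * pi) = \<theta> t + of_int n * (2 * pi)" using Y_inj by blast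
    have "(\<lambda>t. \<sigma> t - t) (\<theta> t + of_int n * (2 * pi)) = (\<lambda>t. \<sigma> t - t) (\<theta> t)"
      using \<sigma>(2) by (intro periodic_int_shift) simp
    then show ?thesis unfolding \<psi>_def n by (intro exI[of _ n]) simp
  qed
  have per\<mu>: "\<mu> (t + 2 * pi) = \<mu> t" for t
  proof -
    obtain n :: int where "\<psi> (t + 2 * pi) = \<psi> t + of_int n * (2 * pi)" using shift by blast
    then have "z (\<psi> (t + 2 * pi)) = z (\<psi> t)" using periodic_int_shift[of z "2 * pi", OF z(6)] by simp
    then show ?thesis by (simp add: \<mu>_def x(6))
  qed
  have d\<psi>: "(\<psi> has_real_derivative 1 / \<mu> t) (at t)" for t
    using \<kappa>(1)[of t] by (simp add: real_vd_iff \<kappa>\<mu>)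
  have \<psi>mono: "\<psi> a < \<psi> b" if "a < b" for a b
    using that d\<psi> \<mu> by (intro DERIV_pos_imp_increasing[of a b \<psi>]) (auto intro!: exI)
  have c\<psi>: "continuous_on {a..b} \<psi>" for a b
    using Ck_on_continuous[OF Ck\<psi>] continuous_on_subset by blast
  have "((\<lambda>t. \<psi> (t + 2 * pi) - \<psi> t) has_real_derivative 0) (at t)" for t
  proof -
    have "((\<lambda>t. \<psi> (t + 2 * pi)) has_real_derivative 1 / \<mu> (t + 2 * pi)) (at t)"
      using d\<psi>[of "t + 2 * pi"] by (simp add: DERIV_shift)
    from DERIV_diff[OF this d\<psi>[of t]] show ?thesis using per\<mu> by simp
  qed
  then have const: "\<psi> (t + 2 * pi) - \<psi> t = \<psi> (0 + 2 * pi) - \<psi> 0" for t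
    using DERIV_isconst_all[of "\<lambda>t. \<psi> (t + 2 * pi) - \<psi> t" t 0] by blast
  obtain n :: int where n: "\<psi> (0 + 2 * pi) = \<psi> 0 + of_int n * (2 * pi)" using shift by blast
  \<comment> \<open>The degree is positive because \<psi> increases. If it were at least 2, \<psi>
    would advance by 2 pi before the end of the period and \<open>x\<close> would return to its
    initial ray too early.\<close>
  have "n = 1"
  proof -
    have "of_int n * (2 * pi) > 0" using \<psi>mono[of 0 "2 * pi"] n by simp
    then have "n > 0" by (simp add: zero_less_mult_iff)
    moreover have "\<not> n \<ge> 2"
    proof
      assume n2: "n \<ge> 2"
      then have "(1::real) \<le> of_int n" by simp
      then have "1 * (2 * pi) \<le> of_int n * (2 * pi)" by (intro mult_right_mono) auto
      then have "\<psi> 0 \<le> \<psi> 0 + 2 * pi" "\<psi> 0 + 2 * pi \<le> \<psi> (2 * pi)" using n by auto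
      then obtain t where t: "0 \<le> t" "t \<le> 2 * pi" "\<psi> t = \<psi> 0 + 2 * pi"
        using IVT'[of \<psi> 0 "\<psi> 0 + 2 * pi" "2 * pi"] c\<psi> by auto
      have "t \<noteq> 0" using t(3) by auto
      moreover have "t \<noteq> 2 * pi"
      proof
        assume "t = 2 * pi"
        then have "of_int n * (2 * pi) = 1 * (2 * pi)" using t(3) n by simp
        then have "of_int n = (1::real)" using mult_right_cancel[of "2 * pi" "of_int n" 1] by simp
        then show False using n2 by simp
      qed
      ultimately have t': "0 < t" "t < 2 * pi" using t by auto
      have "z (\<psi> t) = z (\<psi> 0)" using t(3) z(6) by simp
      then have "x t = (\<mu> t / \<mu> 0) *\<^sub>R x 0" using x\<mu>[of t] x\<mu>[of 0] \<mu>[of 0] by simp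
      then show False using inj[OF t'] by blast
    qed
    ultimately show ?thesis by simp
  qed
  then have "\<psi> (t + 2 * pi) = \<psi> t + 2 * pi" for t using const[of t] n by simp
  then show ?thesis
    using constant_potential_unique[OF \<mu> per\<mu> \<mu>1(1)[unfolded real_vd_iff[symmetric]]
      \<mu>2(1)[unfolded real_vd_iff[symmetric]] eq d\<psi>] by blast
qed

section \<open>Existence and uniqueness combined for the cone\<close>

lemma det3_eq: "det3 a b c = a \<bullet> cross3 b c"
  unfolding det3_def by (rule dot_cross_det[symmetric])

context cone_chart
begin

text \<open>\<open>normal_lift\<close> allows the curve to lie on the boundary of \<open>K\<close>
  or of its negative. As \<open>w \<bullet> x\<close> never vanishes, the side cannot change along
  the curve, and a reflection reduces the second case to the first.\<close>

lemma lift_in_frontier_constant_unique: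
  assumes n: "k = n + 5" and l: "normal_lift k K x A \<gamma>"
    and z: "\<And>s. (z has_vector_derivative z1 s) (at s)" "\<And>s. (z1 has_vector_derivative z2 s) (at s)"
      "\<And>s. (z2 has_vector_derivative z3 s) (at s)" "\<And>s. z2 s \<bullet> cross3 (z1 s) (z s) = 1"
      "\<And>s. z3 s + (2 * B) *\<^sub>R z1 s + \<beta> s *\<^sub>R z s = 0" "\<And>s. z (s + 2 * pi) = z s" "Ck_on 3 UNIV z"
    and zY: "\<And>s. z s = m s *\<^sub>R Y (\<tau> s)" "\<And>s. m s > 0"
    and \<sigma>: "\<And>t. \<tau> (\<sigma> t) = t" "\<And>t. \<sigma> (t + 2 * pi) = \<sigma> t + 2 * pi" "Ck_on 3 UNIV \<sigma>"
  shows "A = B"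
proof -
  have per: "x (t + 2 * pi) = x t" and fr: "x t \<noteq> 0" "x t \<in> frontier K \<or> - x t \<in> frontier K" for t
    using l unfolding normal_lift_def by blast+
  have inj: "s = t" if "s \<in> {0..<2 * pi}" "t \<in> {0..<2 * pi}" "x s = a *\<^sub>R x t" for s t a
    using l that unfolding normal_lift_def by blast
  have "Ck_on (k - 2) UNIV x" using l unfolding normal_lift_def by blast
  then have Ck: "Ck_on 3 UNIV x" by (rule Ck_on_mono) (use n in simp)
  obtain x1 x2 x3 where x: "\<And>t. (x has_vector_derivative x1 t) (at t)" "\<And>t. (x1 has_vector_derivative x2 t) (at t)"
      "\<And>t. (x2 has_vector_derivative x3 t) (at t)" "\<And>t. x2 t \<bullet> cross3 (x1 t) (x t) = 1"
      "\<And>t. x3 t + (2 * A) *\<^sub>R x1 t + \<gamma> t *\<^sub>R x t = 0"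
    using l unfolding normal_lift_def det3_eq by blast
  have sgn: "x t \<in> frontier K \<longleftrightarrow> w \<bullet> x t > 0" "w \<bullet> x t \<noteq> 0" for t
    using fr[of t] frontier_pos[of "x t"] frontier_pos[of "- x t"] by auto
  have cw: "continuous_on S (\<lambda>t. w \<bullet> x t)" for S
    using continuous_on_subset[OF Ck_on_continuous[OF Ck] subset_UNIV] by (intro continuous_intros)
  have const: "(w \<bullet> x s > 0) = (w \<bullet> x t > 0)" if "s \<le> t" for s t
  proof (rule ccontr)
    assume ne: "(w \<bullet> x s > 0) \<noteq> (w \<bullet> x t > 0)"
    then have "\<exists>r. s \<le> r \<and> r \<le> t \<and> w \<bullet> x r = 0"
    proof (cases "w \<bullet> x s > 0")
      case True
      then show ?thesis using ne IVT2'[of "\<lambda>t. w \<bullet> x t" t 0 s] that cw by auto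
    next
      case False
      then show ?thesis using ne IVT'[of "\<lambda>t. w \<bullet> x t" s 0 t] that cw by auto
    qed
    then show False using sgn(2) by blast
  qed
  have const': "(w \<bullet> x s > 0) = (w \<bullet> x t > 0)" for s t using const[of s t] const[of t s] by linarith
  show ?thesis
  proof (cases "w \<bullet> x 0 > 0")
    case True
    then have xK: "x t \<in> frontier K - {0}" for t using const'[of 0 t] sgn(1)[of t] fr(1)[of t] by simp
    have inj0: "x t \<noteq> a *\<^sub>R x 0" if "0 < t" "t < 2 * pi" for t a
      using inj[of t 0 a] that by auto
    show ?thesis
      by (rule lift_constant_unique[OF z zY \<sigma> x per Ck xK inj0])
  next
    case False
    \<comment> \<open>The curve lies in \<open>- frontier K\<close>; reversing both the sign and the parameter preserves the normalization.\<close>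
    define X where "X t = - x (- t)" for t
    have XK: "X t \<in> frontier K - {0}" for t
      using False const'[of 0 "- t"] sgn(1)[of "- t"] fr[of "- t"] by (auto simp: X_def)
    have neg: "((\<lambda>t. f (- t)) has_vector_derivative - f' (- t)) (at t)"
      if "\<And>t. (f has_vector_derivative f' t) (at t)" for f f' :: "real \<Rightarrow> real^3" and t
    proof -
      have "((\<lambda>t::real. - t) has_vector_derivative - 1) (at t)" by (auto intro!: derivative_eq_intros)
      from vector_diff_chain_at[OF this that[of "- t"]] show ?thesis by (simp add: o_def)
    qed
    have X: "(X has_vector_derivative x1 (- t)) (at t)" "((\<lambda>t. x1 (- t)) has_vector_derivative - x2 (- t)) (at t)"
      "((\<lambda>t. - x2 (- t)) has_vector_derivative x3 (- t)) (at t)" for t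
      using has_vector_derivative_minus[OF neg[OF x(1)]] neg[OF x(2)] has_vector_derivative_minus[OF neg[OF x(3)]]
      unfolding X_def[abs_def] by simp_all
    have Xdet: "- x2 (- t) \<bullet> cross3 (x1 (- t)) (X t) = 1" for t using x(4)[of "- t"] by (simp add: X_def)
    have Xode: "x3 (- t) + (2 * A) *\<^sub>R x1 (- t) + (- \<gamma> (- t)) *\<^sub>R X t = 0" for t
      using x(5)[of "- t"] by (simp add: X_def)
    have Xper: "X (t + 2 * pi) = X t" for t using per[of "- t - 2 * pi"] by (simp add: X_def)
    have CkX: "Ck_on 3 UNIV X"
      unfolding X_def[abs_def] using Ck_on_compose[OF Ck Ck_on_minus[OF Ck_on_ident]] by (intro Ck_on_minus) auto
    have inj0: "X t \<noteq> a *\<^sub>R X 0" if "0 < t" "t < 2 * pi" for t a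
      using inj[of "2 * pi - t" 0 a] that per[of "- t"] by (auto simp: X_def)
    show ?thesis
      by (rule lift_constant_unique[OF z zY \<sigma> X Xdet Xode Xper CkX XK inj0])
  qed
qed

lemma normal_lift_exists_unique_constant:
  assumes n: "k = n + 5"
  shows "\<exists>\<alpha>. (\<exists>y \<beta>. normal_lift k K y \<alpha> \<beta>) \<and> (\<forall>y' \<alpha>' \<beta>'. normal_lift k K y' \<alpha>' \<beta>' \<longrightarrow> \<alpha>' = \<alpha>)"
proof -
  obtain y y1 y2 y3 al al1 b m where um: "unimodular_curve y y1 y2 y3 al al1 b w"
    and Ckal: "Ck_on (Suc n) UNIV al" and Cky: "Ck_on (n + 3) UNIV y"
    and ym: "\<And>t. y t = m t *\<^sub>R Y t" "\<And>t. m t > 0"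
    using unimodular_lift[OF n] by blast
  interpret U: unimodular_curve y y1 y2 y3 al al1 b w by (rule um)
  obtain N N1 N2 C where N: "\<And>t. N t > 0" "\<And>t. N (t + 2 * pi) = N t"
    "\<And>t. (N has_real_derivative N1 t) (at t)" "\<And>t. (N1 has_real_derivative N2 t) (at t)"
    "\<And>t. N t * N2 t - (N1 t)\<^sup>2 / 2 + al t * (N t)\<^sup>2 = C" "Ck_on (n + 3) UNIV N"
  proof -
    have "Suc n + 2 = n + 3" by simp
    from U.exists_periodic_normalizer[OF Ckal, unfolded this, OF Cky] that show thesis by blast
  qed
  have n3: "n + 3 = Suc (Suc (Suc n))" by simp
  have CkN: "Ck_on (Suc (Suc (Suc n))) UNIV N" using N(6) unfolding n3 .
  have CkN1: "Ck_on (Suc (Suc n)) UNIV N1"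
    using Ck_on_deriv[OF CkN, of N1] N(3) by (simp add: real_vd_iff)
  have CkN2: "Ck_on (Suc n) UNIV N2"
    using Ck_on_deriv[OF CkN1, of N2] N(4) by (simp add: real_vd_iff)
  obtain N3 where N3: "\<And>t. (N2 has_real_derivative N3 t) (at t)"
    using Ck_on_UNIV_SucE[OF CkN2] by (metis real_vd_iff)
  obtain lam \<sigma> \<tau> where lam: "lam > 0" and "\<And>t. (\<sigma> has_real_derivative lam / N t) (at t)"
    and \<sigma>\<tau>: "\<And>s. (\<tau> has_real_derivative N (\<tau> s) / lam) (at s)"
    "\<And>s. \<sigma> (\<tau> s) = s" "\<And>t. \<tau> (\<sigma> t) = t" "\<And>t. \<sigma> (t + 2 * pi) = \<sigma> t + 2 * pi"
    "\<And>s. \<tau> (s + 2 * pi) = \<tau> s + 2 * pi" "Ck_on (Suc (Suc (Suc (Suc n)))) UNIV \<sigma>" "Ck_on (Suc (Suc (Suc (Suc n)))) UNIV \<tau>"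
    using periodic_change_of_variable[OF N(1,2) CkN] by blast
  \<comment> \<open>Division by \<open>lam\<close> keeps the period 2 pi; the first integral is
    quadratic in the normalizer, so its constant becomes C / lam^2.\<close>
  define h where "h t = N t / lam" for t
  define z where "z s = (1 / h (\<tau> s)) *\<^sub>R y (\<tau> s)" for s
  have h: "h t > 0" "h (t + 2 * pi) = h t" for t using N(1,2) lam by (simp_all add: h_def)
  obtain z1 z2 z3 \<beta> where z: "\<And>s. (z has_vector_derivative z1 s) (at s)" "\<And>s. (z1 has_vector_derivative z2 s) (at s)"
    "\<And>s. (z2 has_vector_derivative z3 s) (at s)" "\<And>s. z2 s \<bullet> cross3 (z1 s) (z s) = 1"
    "\<And>s. z3 s + (2 * (C / lam\<^sup>2)) *\<^sub>R z1 s + \<beta> s *\<^sub>R z s = 0" "\<And>s. \<beta> (s + 2 * pi) = \<beta> s"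
  proof (rule U.reparametrized_ode[of h "\<lambda>t. N1 t / lam" "\<lambda>t. N2 t / lam" "\<lambda>t. N3 t / lam" "C / lam\<^sup>2" \<tau> z])
    show "(h has_real_derivative N1 t / lam) (at t)" for t unfolding h_def[abs_def] by (rule DERIV_cdivide[OF N(3)])
    show "((\<lambda>t. N1 t / lam) has_real_derivative N2 t / lam) (at t)" for t by (rule DERIV_cdivide[OF N(4)])
    show "((\<lambda>t. N2 t / lam) has_real_derivative N3 t / lam) (at t)" for t by (rule DERIV_cdivide[OF N3])
    show "h t * (N2 t / lam) - (N1 t / lam)\<^sup>2 / 2 + al t * (h t)\<^sup>2 = C / lam\<^sup>2" for t
      unfolding N(5)[of t, symmetric] h_def using lam by (simp add: field_simps power2_eq_square)
    show "(\<tau> has_real_derivative h (\<tau> s)) (at s)" for s unfolding h_def by (rule \<sigma>\<tau>(1))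
  qed (use h \<sigma>\<tau>(5) z_def in auto)
  define M where "M s = m (\<tau> s) / h (\<tau> s)" for s
  have zY: "z s = M s *\<^sub>R Y (\<tau> s)" "M s > 0" for s using ym h(1) by (simp_all add: z_def M_def)
  have zper: "z (s + 2 * pi) = z s" for s by (simp add: z_def \<sigma>\<tau>(5) h(2) U.per(1))
  have Ck\<tau>: "Ck_on (n + 3) UNIV \<tau>" unfolding n3 by (rule Ck_on_SucD[OF \<sigma>\<tau>(7)])
  have Ckh: "Ck_on (n + 3) UNIV h" unfolding h_def[abs_def] n3 using lam by (intro Ck_on_divide CkN Ck_on_const) auto
  have Ckz: "Ck_on (n + 3) UNIV z"
  proof -
    have "Ck_on (n + 3) UNIV (\<lambda>t. (1 / h t) *\<^sub>R y t)"
      using h(1) by (intro Ck_on_scaleR Ck_on_divide Ck_on_const Ckh Cky) (metis less_irrefl)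
    from Ck_on_compose[OF this Ck\<tau>] show ?thesis unfolding z_def[abs_def] by simp
  qed
  \<comment> \<open>Normalization cancels the factors \<open>m\<close> and \<open>h\<close>, which
    have only class C^(k-2). What remains is the unit vector of \<open>Y\<close> composed with
    \<tau>, and \<tau> has class C^(k-1).\<close>
  have Ckunit: "Ck_on (k - 1) UNIV (\<lambda>s. (1 / norm (z s)) *\<^sub>R z s)"
  proof -
    have "Ck_on k UNIV (\<lambda>t. (1 / (Y t \<bullet> Y t) powr (1/2)) *\<^sub>R Y t)"
      using Y_nonzero by (intro Ck_on_scaleR Ck_on_divide Ck_on_const Ck_on_powr Ck_on_inner Y_Ck) auto
    then have "Ck_on (k - 1) UNIV (\<lambda>t. (1 / (Y t \<bullet> Y t) powr (1/2)) *\<^sub>R Y t)" by (rule Ck_on_mono) simp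
    moreover have "Ck_on (k - 1) UNIV \<tau>" by (rule Ck_on_mono[OF \<sigma>\<tau>(7)]) (use n in simp)
    ultimately have "Ck_on (k - 1) UNIV (\<lambda>s. (1 / (Y (\<tau> s) \<bullet> Y (\<tau> s)) powr (1/2)) *\<^sub>R Y (\<tau> s))"
      using Ck_on_compose[where f = "\<lambda>t. (1 / (Y t \<bullet> Y t) powr (1/2)) *\<^sub>R Y t" and T = UNIV] by blast
    moreover have "(1 / (Y (\<tau> s) \<bullet> Y (\<tau> s)) powr (1/2)) *\<^sub>R Y (\<tau> s) = (1 / norm (z s)) *\<^sub>R z s" for s
      using zY[of s] by (simp add: powr_half_sqrt norm_eq_sqrt_inner[symmetric])
    ultimately show ?thesis by simp
  qed
  have "normal_lift k K z (C / lam\<^sup>2) \<beta>"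
    unfolding normal_lift_def det3_eq
  proof (intro conjI allI ballI impI)
    fix s
    show "z (s + 2 * pi) = z s" "\<beta> (s + 2 * pi) = \<beta> s" by (rule zper z(6))+
    show "z s \<noteq> 0" using zY[of s] Y_nonzero by simp
    show "z s \<in> frontier K \<or> - z s \<in> frontier K" using zY[of s] frontier_scale[OF Y_frontier] by simp
  next
    fix x assume x: "x \<in> frontier K - {0}"
    obtain t where t: "x = (w \<bullet> x) *\<^sub>R Y t" using Y_cover[OF x] by blast
    obtain j :: int where j: "0 \<le> \<sigma> t + of_int j * (2 * pi)" "\<sigma> t + of_int j * (2 * pi) < 0 + 2 * pi"
      using period_representative[of "2 * pi" 0 "\<sigma> t"] by auto
    let ?s = "\<sigma> t + of_int j * (2 * pi)"
    have "z ?s = z (\<sigma> t)" using periodic_int_shift[of z "2 * pi", OF zper] .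
    then have "z ?s = M (\<sigma> t) *\<^sub>R Y t" using zY(1) \<sigma>\<tau>(3) by simp
    then have "Y t = (1 / M (\<sigma> t)) *\<^sub>R z ?s" using zY(2)[of "\<sigma> t"] by simp
    then have "x = ((w \<bullet> x) * (1 / M (\<sigma> t))) *\<^sub>R z ?s" using t by (metis scaleR_scaleR)
    then show "\<exists>t\<in>{0..<2 * pi}. \<exists>c. x = c *\<^sub>R z t" using j by (intro bexI[of _ ?s]) auto
  next
    fix s t assume st: "s \<in> {0..<2 * pi}" "t \<in> {0..<2 * pi}" and "\<exists>c. z s = c *\<^sub>R z t"
    then obtain c where "z s = c *\<^sub>R z t" by blast
    then have c: "M s *\<^sub>R Y (\<tau> s) = (c * M t) *\<^sub>R Y (\<tau> t)" using zY(1) by simp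
    then have "w \<bullet> (M s *\<^sub>R Y (\<tau> s)) = w \<bullet> ((c * M t) *\<^sub>R Y (\<tau> t))" by simp
    \<comment> \<open>Points of the affine plane on the same line through 0 coincide; a negative
      \<open>c\<close> is excluded together with every other discrepancy.\<close>
    then have "M s = c * M t" by (simp add: w_Y)
    then have "Y (\<tau> s) = Y (\<tau> t)" using c zY(2)[of s] by auto
    then obtain j :: int where j: "\<tau> s = \<tau> t + of_int j * (2 * pi)" using Y_inj by blast
    have "(\<lambda>t. \<sigma> t - t) (\<tau> t + of_int j * (2 * pi)) = (\<lambda>t. \<sigma> t - t) (\<tau> t)"
      using \<sigma>\<tau>(4) by (intro periodic_int_shift) simp
    then have s: "s = t + of_int j * (2 * pi)" using \<sigma>\<tau>(2)[of s, unfolded j] \<sigma>\<tau>(2)[of t] by simp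
    then have "of_int j * (2 * pi) < 1 * (2 * pi)" "(- 1) * (2 * pi) < of_int j * (2 * pi)"
      using st unfolding atLeastLessThan_iff mult_1 mult_minus1 by linarith+
    then have "of_int j < (1::real)" "(- 1) < (of_int j :: real)"
      using mult_less_cancel_right_pos[of "2 * pi" "of_int j" 1] mult_less_cancel_right_pos[of "2 * pi" "- 1" "of_int j"] by simp_all
    then have "j = 0" by linarith
    then show "s = t" using s by simp
  next
    show "Ck_on (k - 1) UNIV (\<lambda>t. (1 / norm (z t)) *\<^sub>R z t)" by (rule Ckunit)
    show "Ck_on (k - 2) UNIV z" by (rule Ck_on_mono[OF Ckz]) (use n in simp)
    show "\<exists>y1 y2 y3. \<forall>t. (z has_vector_derivative y1 t) (at t) \<and> (y1 has_vector_derivative y2 t) (at t) \<and>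
      (y2 has_vector_derivative y3 t) (at t) \<and> y2 t \<bullet> cross3 (y1 t) (z t) = 1 \<and>
      y3 t + (2 * (C / lam\<^sup>2)) *\<^sub>R y1 t + \<beta> t *\<^sub>R z t = 0"
      using z by blast
  qed
  moreover have "\<alpha>' = C / lam\<^sup>2" if "normal_lift k K y' \<alpha>' \<beta>'" for y' \<alpha>' \<beta>'
  proof (rule lift_in_frontier_constant_unique[OF n that z(1-5) zper _ zY \<sigma>\<tau>(3,4)])
    show "Ck_on 3 UNIV z" by (rule Ck_on_mono[OF Ckz]) simp
    show "Ck_on 3 UNIV \<sigma>" by (rule Ck_on_mono[OF \<sigma>\<tau>(6)]) simp
  qed
  ultimately show ?thesis by blast
qed

end

theorem theorem1:
  fixes K :: "(real^3) set" and k :: nat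
  assumes "regular_convex_cone K"
    and "k \<ge> 5"
    and "boundary_Ck_pos_curved k K"
  shows "\<exists>\<alpha>. (\<exists>y \<beta>. normal_lift k K y \<alpha> \<beta>) \<and>
              (\<forall>y' \<alpha>' \<beta>'. normal_lift k K y' \<alpha>' \<beta>' \<longrightarrow> \<alpha>' = \<alpha>)"
proof -
  have K: "closed K" "convex K" "cone K" "interior K \<noteq> {}"
    using assms(1) unfolding regular_convex_cone_def by auto
  obtain w c where wc: "c > 0" "\<And>x. x \<in> K \<Longrightarrow> c * norm x \<le> w \<bullet> x"
    using regular_convex_cone_functional[OF assms(1)] by blast
  obtain e0 \<epsilon> where e0: "e0 \<in> interior K" "\<epsilon> > 0" "ball e0 \<epsilon> \<subseteq> K"
    using K(4) mem_interior by (metis all_not_in_conv)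
  \<comment> \<open>If 0 were interior, some nonzero vector and its opposite would both lie in
    \<open>K\<close>, and \<open>w\<close> would be positive on both.\<close>
  have "e0 \<noteq> 0"
  proof
    assume "e0 = 0"
    let ?v = "(\<epsilon>/2) *\<^sub>R (axis 1 1 :: real^3)"
    have v: "?v \<in> K" "- ?v \<in> K" using e0 \<open>e0 = 0\<close> by (auto simp: subset_iff)
    have "?v \<noteq> 0" using e0(2) by simp
    then have "c * norm ?v > 0" "c * norm (- ?v) > 0" using wc(1) by simp_all
    then show False using wc(2)[OF v(1)] wc(2)[OF v(2)] by (simp add: inner_minus_right)
  qed
  then have we0: "w \<bullet> e0 > 0"
    using wc(1) wc(2)[of e0] e0(1) interior_subset[of K] by (meson less_le_trans mult_pos_pos subsetD zero_less_norm_iff)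
  then have "w \<noteq> 0" by auto
  then obtain e1 e2 where onb: "norm e1 = 1" "norm e2 = 1" "e1 \<bullet> e2 = 0" "w \<bullet> e1 = 0" "w \<bullet> e2 = 0"
    "\<And>v. w \<bullet> v = 0 \<Longrightarrow> v = (v \<bullet> e1) *\<^sub>R e1 + (v \<bullet> e2) *\<^sub>R e2" "cross3 e2 e1 = (1 / norm w) *\<^sub>R w"
    using orthonormal_completion3 by metis
  define e where "e = (1 / (w \<bullet> e0)) *\<^sub>R e0"
  have we: "w \<bullet> e = 1" using we0 by (simp add: e_def)
  interpret cone_chart K k w e e1 e2 c
  proof
    show "e \<in> interior K" unfolding e_def using cone_interior_scale[OF K(3) e0(1)] we0 by simp
    show "0 < e \<bullet> cross3 e2 e1" using onb(7) we \<open>w \<noteq> 0\<close> by (simp add: inner_commute)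
  qed (use K wc we onb assms in auto)
  obtain n where "k = n + 5" using assms(2) by (metis add.commute le_Suc_ex)
  then show ?thesis by (rule normal_lift_exists_unique_constant)
qed

end
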